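(* Let $i,b\ge2$ be integers and let $P_{ib}$ be the poset described below, with $q_n$ elements of rank $n$. Define $\tilde q_n$ by $\tilde q_n=i^n$ for $0\le n\le b-1$ and $\tilde q_n=i\tilde q_{n-1}-(i-1)\tilde q_{n-b}$ for $n\ge b$. Then: (a) $E_{P_{ib}}=\sum_\lambda z_\lambda^{-1}\tilde q_{\lambda_1}\tilde q_{\lambda_2}\cdots\,p_\lambda$, where $\lambda=(\lambda_1,\lambda_2,\dots)$ ranges over all partitions of all $n\ge0$; (b) $E_{P_{ib}}=\sum_{n\ge0}\sum_{j\ge0,\ jb\le n}(-1)^{jb}(i-1)^j\,i^{\,n-jb}\,\mathrm{fo}_{b^j1^{n-jb}}$.
   Context: $P_{ib}$ is the (infinite) graded poset with a unique minimal element $\hat0$ and finitely many elements of each rank, determined up to isomorphism by: every element is covered by exactly $i$ elements; and $P_{ib}$ has a planar Hasse diagram such that whenever $u,u'$ are consecutive (left to right) elements covering $t$, there is an element $v>t$ such that the Hasse diagram of the interval $[t,v]$ contains $u,u'$ and is a $2b$-gon with no vertices or edges in its interior, $t$ and $v$ antipodal (so $[t,v]$ is graded of rank $b$). (The paper asserts such a poset exists and is unique up to isomorphism.) For a finite graded poset $Q$ with $\hat0$ and $\hat1$, its Ehrenborg quasisymmetric function is $E_Q=\sum x_1^{\rho(t_0,t_1)}x_2^{\rho(t_1,t_2)}\cdots x_k^{\rho(t_{k-1},t_k)}$, summed over all $k\ge1$ and all multichains $\hat0=t_0\le t_1\le\cdots\le t_{k-1}<t_k=\hat1$, where $\rho(s,t)$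 is the rank of $[s,t]$; for the one-element poset set $E_Q=1$. For $P=P_{ib}$ define $E_P=\sum_{t\in P}E_{[\hat0,t]}$. Here $p_\lambda$ are power sum symmetric functions, $z_\lambda=\prod_j j^{m_j}m_j!$ where $m_j$ is the number of parts of $\lambda$ equal to $j$, $m_\lambda$ are monomial symmetric functions, $\omega$ is the standard involution on symmetric functions, and $\mathrm{fo}_\lambda=\omega m_\lambda$ (forgotten symmetric functions). The notation $b^j1^{n-jb}$ denotes the partition with $j$ parts equal to $b$ and $n-jb$ parts equal to $1$.
   Formalization: The initial value q̃_0 is taken to be b instead of i^0=1 (the values i^n for 1≤n≤b−1 and the recurrence for n≥b are kept), because with q̃_0=1 part (a) fails: for i=b=2 it gives 7/2 instead of 3 as the coefficient of x_1^2. *)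

theory Defs
  imports "HOL-Analysis.Analysis" "HOL-Library.Multiset"
begin

section \<open>Formal power series in countably many variables\<close>

text \<open>A monomial is the multiset of the indices of its variables. Indices start at 0, so the
  variable with index \<open>k\<close> is the one usually written \<open>x\<^bsub>k+1\<^esub>\<close>.\<close>

typedef 'a mps = "UNIV :: (nat multiset \<Rightarrow> 'a) set"
  morphisms mcoeff Abs_mps by simp

lemma mcoeff_Abs_mps [simp]: "mcoeff (Abs_mps f) = f"
  by (simp add: Abs_mps_inverse)

lemma mps_eqI: "(\<And>A. mcoeff f A = mcoeff g A) \<Longrightarrow> f = g"
  by (subst mcoeff_inject[symmetric]) (rule ext)

lemma finite_submultisets [simp]: "finite {B. B \<subseteq># A}"
proof (induction A)
  case empty
  then show ?case by simp
next
  case (add a A)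
  have "{B. B \<subseteq># add_mset a A} \<subseteq> {B. B \<subseteq># A} \<union> add_mset a ` {B. B \<subseteq># A}"
  proof
    fix B assume "B \<in> {B. B \<subseteq># add_mset a A}"
    hence B: "B \<subseteq># add_mset a A" by simp
    show "B \<in> {B. B \<subseteq># A} \<union> add_mset a ` {B. B \<subseteq># A}"
    proof (cases "a \<in># B")
      case True
      then obtain C where "B = add_mset a C" by (metis multi_member_split)
      with B show ?thesis by auto
    next
      case False
      have "B \<subseteq># A"
        unfolding subseteq_mset_def
      proof
        fix x
        have "count B x \<le> count (add_mset a A) x"
          using B by (auto simp only: subseteq_mset_def)
        with False show "count B x \<le> count A x"
          by (cases "x = a") (auto simp: not_in_iff)
      qed
      then show ?thesis by simp
    qed
  qed
  with add show ?case by (meson finite_UnI finite_imageI finite_subset)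
qed

instantiation mps :: (comm_ring_1) comm_ring_1
begin

definition "0 = Abs_mps (\<lambda>A. 0)"
definition "1 = Abs_mps (\<lambda>A. if A = {#} then 1 else 0)"
definition "f + g = Abs_mps (\<lambda>A. mcoeff f A + mcoeff g A)"
definition "f - g = Abs_mps (\<lambda>A. mcoeff f A - mcoeff g A)"
definition "- f = Abs_mps (\<lambda>A. - mcoeff f A)"
definition "f * g = Abs_mps (\<lambda>A. \<Sum>B | B \<subseteq># A. mcoeff f B * mcoeff g (A - B))"

instance
proof
  fix f g h :: "'a mps"
  show "f + g + h = f + (g + h)" "f + g = g + f" "0 + f = f" "- f + f = 0" "f - g = f + - g"
    by (auto intro!: mps_eqI simp: zero_mps_def plus_mps_def minus_mps_def uminus_mps_def)
  show "(f + g) * h = f * h + g * h"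
    by (rule mps_eqI) (simp add: plus_mps_def times_mps_def distrib_right sum.distrib)
  show "(0 :: 'a mps) \<noteq> 1"
  proof
    assume "(0 :: 'a mps) = 1"
    hence "mcoeff (0 :: 'a mps) {#} = mcoeff 1 {#}" by simp
    thus False by (simp add: zero_mps_def one_mps_def)
  qed
  show "1 * f = f"
  proof (rule mps_eqI)
    fix A
    have "(\<Sum>B | B \<subseteq># A. (if B = {#} then 1 else 0) * mcoeff f (A - B))
        = (\<Sum>B | B \<subseteq># A. if B = {#} then mcoeff f (A - B) else 0)"
      by (intro sum.cong) auto
    also have "\<dots> = mcoeff f A" by (subst sum.delta) auto
    finally show "mcoeff (1 * f) A = mcoeff f A" by (simp add: one_mps_def times_mps_def)
  qed
  show "f * g = g * f"
  proof (rule mps_eqI)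
    fix A
    show "mcoeff (f * g) A = mcoeff (g * f) A"
      unfolding times_mps_def mcoeff_Abs_mps
      by (rule sum.reindex_bij_witness[of _ "\<lambda>B. A - B" "\<lambda>B. A - B"])
         (auto simp: mult.commute subset_mset.diff_diff_right)
  qed
  show "f * g * h = f * (g * h)"
  proof (rule mps_eqI)
    fix A
    have "mcoeff (f * g * h) A
        = (\<Sum>(B, C) \<in> Sigma {B. B \<subseteq># A} (\<lambda>B. {C. C \<subseteq># B}).
            mcoeff f C * mcoeff g (B - C) * mcoeff h (A - B))"
      by (simp add: times_mps_def sum_distrib_right sum.Sigma)
    also have "\<dots> = (\<Sum>(C, D) \<in> Sigma {C. C \<subseteq># A} (\<lambda>C. {D. D \<subseteq># A - C}).
            mcoeff f C * (mcoeff g D * mcoeff h (A - C - D)))"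
    proof (rule sum.reindex_bij_witness[of _ "\<lambda>(C, D). (C + D, C)" "\<lambda>(B, C). (C, B - C)"],
           goal_cases)
      case (1 a) then show ?case by auto
    next
      case (2 a)
      obtain B C where a: "a = (B, C)" by (cases a)
      have "B - C \<subseteq># A - C" if "B \<subseteq># A"
        using that by (simp add: subseteq_mset_def diff_le_mono)
      with 2 show ?case by (auto simp: a intro: subset_mset.order_trans)
    next
      case (3 a) then show ?case by auto
    next
      case (4 a)
      obtain C D where a: "a = (C, D)" by (cases a)
      have "C + D \<subseteq># A" if CD: "C \<subseteq># A" "D \<subseteq># A - C"
        unfolding subseteq_mset_def
      proof
        fix x
        have "count C x \<le> count A x" "count D x \<le> count (A - C) x"
          using CD by (auto simp only: subseteq_mset_def)
        thus "count (C + D) x \<le> count A x" by simp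
      qed
      with 4 show ?case by (simp add: a)
    next
      case (5 a) then show ?case
        by (auto simp: mult.assoc)
    qed
    also have "\<dots> = mcoeff (f * (g * h)) A"
      by (simp add: times_mps_def sum_distrib_left sum.Sigma)
    finally show "mcoeff (f * g * h) A = mcoeff (f * (g * h)) A" .
  qed
qed

end

definition mps_const :: "'a::comm_ring_1 \<Rightarrow> 'a mps" where
  "mps_const c = Abs_mps (\<lambda>A. if A = {#} then c else 0)"

definition mps_var :: "nat \<Rightarrow> 'a::comm_ring_1 mps" where
  "mps_var k = Abs_mps (\<lambda>A. if A = {#k#} then 1 else 0)"

text \<open>Infinite sums are taken coefficientwise. The value is meaningful only if each monomial
  has a nonzero coefficient in finitely many summands; \<open>has_formal_sum\<close> includes this
  requirement.\<close>

definition formal_sum :: "('i \<Rightarrow> 'a::comm_ring_1 mps) \<Rightarrow> 'i set \<Rightarrow> 'a mps" where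
  "formal_sum f I = Abs_mps (\<lambda>A. \<Sum>i | i \<in> I \<and> mcoeff (f i) A \<noteq> 0. mcoeff (f i) A)"

definition has_formal_sum :: "('i \<Rightarrow> 'a::comm_ring_1 mps) \<Rightarrow> 'i set \<Rightarrow> 'a mps \<Rightarrow> bool" where
  "has_formal_sum f I s \<longleftrightarrow>
     (\<forall>A. finite {i \<in> I. mcoeff (f i) A \<noteq> 0}) \<and> formal_sum f I = s"


section \<open>Symmetric functions\<close>

text \<open>Partitions are finite multisets of positive integers.\<close>

definition partitions :: "nat multiset set" where
  "partitions = {l. 0 \<notin># l}"

definition zee :: "nat multiset \<Rightarrow> nat" where
  "zee l = (\<Prod>j\<in>set_mset l. j ^ count l j * fact (count l j))"

definition exponents :: "nat multiset \<Rightarrow> nat multiset" where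
  "exponents A = image_mset (count A) (mset_set (set_mset A))"

definition monomial_sym :: "nat multiset \<Rightarrow> rat mps" where
  "monomial_sym l = formal_sum (\<lambda>A. \<Prod>k\<in>#A. mps_var k) {A. exponents A = l}"

definition elementary_sym :: "nat \<Rightarrow> rat mps" where
  "elementary_sym n = formal_sum (\<lambda>S. \<Prod>k\<in>S. mps_var k) {S. finite S \<and> card S = n}"

definition complete_sym :: "nat \<Rightarrow> rat mps" where
  "complete_sym n = formal_sum (\<lambda>A. \<Prod>k\<in>#A. mps_var k) {A. size A = n}"

definition power_sum_sym :: "nat multiset \<Rightarrow> rat mps" where
  "power_sum_sym l = (\<Prod>n\<in>#l. formal_sum (\<lambda>k. mps_var k ^ n) UNIV)"

definition symmetric_functions :: "rat mps set" where
  "symmetric_functions =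
     {f. (\<forall>\<pi> A. bij \<pi> \<longrightarrow> mcoeff f (image_mset \<pi> A) = mcoeff f A) \<and>
         (\<exists>d. \<forall>A. mcoeff f A \<noteq> 0 \<longrightarrow> size A \<le> d)}"

text \<open>The algebra endomorphism of the ring of symmetric functions that sends each elementary
  to the corresponding complete homogeneous symmetric function. As the elementary symmetric
  functions are algebraically independent generators, this determines the map on
  \<open>symmetric_functions\<close>; its values elsewhere are irrelevant. It preserves 1 because
  the case \<open>n = 0\<close> of the last condition reads \<open>\<omega> 1 = 1\<close>.\<close>

definition standard_involution :: "(rat mps \<Rightarrow> rat mps) \<Rightarrow> bool" where
  "standard_involution \<omega> \<longleftrightarrow>
     (\<forall>f\<in>symmetric_functions. \<omega> f \<in> symmetric_functions) \<and>
     (\<forall>f\<in>symmetric_functions. \<forall>g\<in>symmetric_functions. \<omega> (f + g) = \<omega> f + \<omega> g) \<and>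
     (\<forall>f\<in>symmetric_functions. \<forall>g\<in>symmetric_functions. \<omega> (f * g) = \<omega> f * \<omega> g) \<and>
     (\<forall>c. \<forall>f\<in>symmetric_functions. \<omega> (mps_const c * f) = mps_const c * \<omega> f) \<and>
     (\<forall>n. \<omega> (elementary_sym n) = complete_sym n)"

definition forgotten_sym :: "(rat mps \<Rightarrow> rat mps) \<Rightarrow> nat multiset \<Rightarrow> rat mps" where
  "forgotten_sym \<omega> l = \<omega> (monomial_sym l)"


section \<open>Graded posets and their quasisymmetric functions\<close>

definition covers :: "'a::order \<Rightarrow> 'a \<Rightarrow> bool" where
  "covers s t \<longleftrightarrow> s < t \<and> (\<nexists>u. s < u \<and> u < t)"

definition rank_function :: "('a::order_bot \<Rightarrow> nat) \<Rightarrow> bool" where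
  "rank_function \<rho> \<longleftrightarrow> \<rho> bot = 0 \<and>
     (\<forall>s t. s < t \<longrightarrow> \<rho> s < \<rho> t) \<and>
     (\<forall>s t. covers s t \<longrightarrow> \<rho> t = Suc (\<rho> s))"

text \<open>The lists \<open>[t\<^sub>0, \<dots>, t\<^sub>k]\<close> with \<open>k \<ge> 1\<close> and \<open>s = t\<^sub>0 \<le> \<dots> \<le> t\<^bsub>k-1\<^esub> < t\<^sub>k = t\<close>.\<close>

definition multichains :: "'a::order \<Rightarrow> 'a \<Rightarrow> 'a list set" where
  "multichains s t = {ts. length ts \<ge> 2 \<and> hd ts = s \<and> last ts = t \<and>
     sorted_wrt (\<le>) ts \<and> ts ! (length ts - 2) < last ts}"

text \<open>The Ehrenborg quasisymmetric function of the interval from \<open>s\<close> to \<open>t\<close>.\<close>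

definition ehrenborg :: "('a::order \<Rightarrow> nat) \<Rightarrow> 'a \<Rightarrow> 'a \<Rightarrow> rat mps" where
  "ehrenborg \<rho> s t =
     (if s = t then 1
      else formal_sum
        (\<lambda>ts. \<Prod>k<length ts - 1. mps_var k ^ (\<rho> (ts ! Suc k) - \<rho> (ts ! k)))
        (multichains s t))"

definition ehrenborg_poset :: "('a::order_bot \<Rightarrow> nat) \<Rightarrow> rat mps" where
  "ehrenborg_poset \<rho> = formal_sum (\<lambda>t. ehrenborg \<rho> bot t) UNIV"


section \<open>Planar Hasse diagrams and the posets \<open>P\<^bsub>ib\<^esub>\<close>\<close>

definition hasse_edges :: "('a::order \<Rightarrow> real \<times> real) \<Rightarrow> 'a set \<Rightarrow> (real \<times> real) set" where
  "hasse_edges pos S =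
     \<Union> {closed_segment (pos s) (pos t) | s t. s \<in> S \<and> t \<in> S \<and> covers s t}"

definition planar_hasse_diagram :: "('a::order \<Rightarrow> real \<times> real) \<Rightarrow> bool" where
  "planar_hasse_diagram pos \<longleftrightarrow> inj pos \<and>
     (\<forall>s t. s < t \<longrightarrow> snd (pos s) < snd (pos t)) \<and>
     (\<forall>s t u. covers s t \<and> pos u \<in> closed_segment (pos s) (pos t) \<longrightarrow> u = s \<or> u = t) \<and>
     (\<forall>s t s' t'. covers s t \<and> covers s' t' \<and> (s, t) \<noteq> (s', t') \<longrightarrow>
        closed_segment (pos s) (pos t) \<inter> closed_segment (pos s') (pos t')
          \<subseteq> pos ` ({s, t} \<inter> {s', t'}))"

text \<open>Horizontal displacement per unit of height along the edge from \<open>t\<close> up to \<open>u\<close>: edges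
  leaving \<open>t\<close> upwards are ordered from left to right by this quantity.\<close>

definition inclination :: "('a \<Rightarrow> real \<times> real) \<Rightarrow> 'a \<Rightarrow> 'a \<Rightarrow> real" where
  "inclination pos t u = (fst (pos u) - fst (pos t)) / (snd (pos u) - snd (pos t))"

definition consecutive_covers ::
  "('a::order \<Rightarrow> real \<times> real) \<Rightarrow> 'a \<Rightarrow> 'a \<Rightarrow> 'a \<Rightarrow> bool" where
  "consecutive_covers pos t u u' \<longleftrightarrow> covers t u \<and> covers t u' \<and>
     inclination pos t u < inclination pos t u' \<and>
     (\<nexists>w. covers t w \<and> inclination pos t u < inclination pos t w \<and>
          inclination pos t w < inclination pos t u')"

text \<open>The Hasse diagram of the interval from \<open>t\<close> to \<open>v\<close>, as a graph, is a cycle with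
  \<open>2 * b\<close> vertices (listed in cyclic order by \<open>c\<close>) in which \<open>t\<close> and \<open>v\<close> are antipodal.
  Covering relations of an interval are those of the whole poset.\<close>

definition polygon_interval :: "nat \<Rightarrow> 'a::order \<Rightarrow> 'a \<Rightarrow> bool" where
  "polygon_interval b t v \<longleftrightarrow>
     (\<exists>c. length c = 2 * b \<and> distinct c \<and> set c = {t..v} \<and> c ! 0 = t \<and> c ! b = v \<and>
       (\<forall>j<2 * b. \<forall>k<2 * b.
          (covers (c ! j) (c ! k) \<or> covers (c ! k) (c ! j)) \<longleftrightarrow>
          (k = Suc j mod (2 * b) \<or> j = Suc k mod (2 * b))))"

definition is_P :: "nat \<Rightarrow> nat \<Rightarrow> ('a::order_bot \<Rightarrow> nat) \<Rightarrow> bool" where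
  "is_P i b \<rho> \<longleftrightarrow> rank_function \<rho> \<and>
     (\<forall>n. finite {t. \<rho> t = n}) \<and>
     (\<forall>t :: 'a. finite {u. covers t u} \<and> card {u. covers t u} = i) \<and>
     (\<exists>pos :: 'a \<Rightarrow> real \<times> real. planar_hasse_diagram pos \<and>
       (\<forall>t u u'. consecutive_covers pos t u u' \<longrightarrow>
         (\<exists>v>t. u \<in> {t..v} \<and> u' \<in> {t..v} \<and> polygon_interval b t v \<and>
            inside (hasse_edges pos {t..v}) \<inter> (range pos \<union> hasse_edges pos UNIV) = {})))"

text \<open>The initial value at 0 is \<open>b\<close>, not \<open>i ^ 0 = 1\<close>. The sequence consists of the power sums
  of the reciprocal roots of \<open>1 - i x + (i - 1) x ^ b\<close>, so at \<open>n = b\<close> its value is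
  \<open>i ^ b - b (i - 1)\<close>; started with 1 at \<open>n = 0\<close>, the recurrence would give
  \<open>i ^ b - (i - 1)\<close> there, and the power sum expansion would fail in degree \<open>b\<close>. The value at 0
  enters only through the recurrence at \<open>n = b\<close>, since partitions have positive parts.\<close>

fun qtilde :: "nat \<Rightarrow> nat \<Rightarrow> nat \<Rightarrow> rat" where
  "qtilde i b n =
     (if n = 0 then of_nat b
      else if b = 0 \<or> n < b then of_nat i ^ n
      else of_nat i * qtilde i b (n - 1) - (of_nat i - 1) * qtilde i b (n - b))"

declare qtilde.simps [simp del]

end

theory Submission
  imports Defs "HOL-Computational_Algebra.Formal_Power_Series"
begin

text \<open>Saturated chains are graphs over the vertical axis, so planarity and the intermediate value
  theorem say that two chains change sides only at a common element. Hence an empty polygon is the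
  region between two chains that turn inwards as sharply as possible at every step, both upwards
  and downwards, and is determined by its two edges at the bottom as well as by its two edges at
  the top. Conversely, in the principal filter of \<open>s\<close>, two consecutive lower covers \<open>w\<close>, \<open>w'\<close> of \<open>v\<close>
  bound such a polygon: its bottom is a common lower bound of maximal rank of \<open>w\<close> and \<open>w'\<close>, because
  a polygon entering the region enclosed below \<open>v\<close> could not leave it again, although its top would
  lie above \<open>v\<close>. So consecutive lower covers at rank \<open>n\<close> correspond to consecutive upper covers
  at rank \<open>n - b\<close>, and counting edges shows that every principal filter has rank generating function
  \<open>1 / G(x)\<close> with \<open>G(x) = 1 - i x + (i - 1) x ^ b\<close>.

  Therefore \<open>E\<^sub>P\<close> is the product of \<open>1 / G(x\<^sub>k)\<close> over all variables. Taking logarithmic derivatives,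
  its homogeneous parts \<open>X n\<close> satisfy \<open>n X n = (\<Sum>k=1..n. c k * p\<^sub>k * X (n - k))\<close> with
  \<open>c k = qtilde i b k\<close>, as do the homogeneous parts of the power sum expansion. The parts of
  the product of \<open>G(- x\<^sub>k)\<close> satisfy it with an additional sign \<open>(-1) ^ (k - 1)\<close>, which the
  involution removes, since it multiplies \<open>p\<^sub>k\<close> by the same sign.\<close>

section \<open>Saturated chains in a planar Hasse diagram\<close>

text \<open>The hypotheses describe polygons from their bottom corner only and say nothing about
  lower covers. The hard geometric step is therefore to find, for two neighbouring lower covers, a
  polygon that closes there. Once this is known, an element with \<open>d > 0\<close> lower covers
  in a filter closes \<open>d - 1\<close> polygons of that filter, which turns the count of edges
  between two levels into a linear recurrence. The filter of an arbitrary \<open>s\<close> is needed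
  because a multichain asks for the number of elements of a given rank above each of its members;
  the recurrence shows that this number is the same for all members, and only then does the count of
  multichains become a product. The topology of the plane enters through a single inclusion: points
  between two chains are \<open>inside\<close> the polygon which they form. Everything else compares
  continuous functions of the height. On the algebraic side \<open>c\<close> is the coefficient
  sequence of \<open>- x G' / G\<close>, and \<open>n X n\<close> is the effect of the Euler
  operator, the sum over all variables of the variable times its derivative, in degree
  \<open>n\<close>.\<close>

definition saturated :: "(nat \<Rightarrow> 'a::order) \<Rightarrow> nat \<Rightarrow> bool" where
  "saturated c n \<longleftrightarrow> (\<forall>k<n. covers (c k) (c (Suc k)))"

lemma saturatedD: "saturated c n \<Longrightarrow> k < n \<Longrightarrow> covers (c k) (c (Suc k))"
  by (simp add: saturated_def)

lemma coversD: "covers s t \<Longrightarrow> s < t"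
  by (simp add: covers_def)

lemma saturated_mono:
  assumes "saturated c n" "j \<le> k" "k \<le> n"
  shows "c j \<le> c k"
  using assms(2,3)
proof (induction k rule: dec_induct)
  case base
  show ?case by simp
next
  case (step k)
  then have "covers (c k) (c (Suc k))" using assms(1) by (simp add: saturatedD)
  with step show ?case using coversD by fastforce
qed

lemma saturated_strict:
  assumes "saturated c n" "j < k" "k \<le> n"
  shows "c j < c k"
proof -
  have "c j < c (Suc j)" using assms by (simp add: coversD saturatedD)
  also have "c (Suc j) \<le> c k" using assms by (simp add: saturated_mono[of c n])
  finally show ?thesis .
qed

lemma saturated_shift: "saturated c n \<Longrightarrow> saturated (\<lambda>k. c (j + k)) (n - j)"
  by (simp add: saturated_def)

definition splice_at :: "nat \<Rightarrow> (nat \<Rightarrow> 'a) \<Rightarrow> (nat \<Rightarrow> 'a) \<Rightarrow> nat \<Rightarrow> 'a" where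
  "splice_at j c d k = (if k \<le> j then c k else d (k - j))"

lemma splice_at_left: "k \<le> j \<Longrightarrow> splice_at j c d k = c k"
  by (simp add: splice_at_def)

lemma splice_at_right: "c j = d 0 \<Longrightarrow> splice_at j c d (j + k) = d k"
  by (cases k) (auto simp: splice_at_def)

lemma saturated_splice:
  assumes "saturated c j" "saturated d l" "c j = d 0"
  shows "saturated (splice_at j c d) (j + l)"
  unfolding saturated_def
proof (intro allI impI)
  fix k assume "k < j + l"
  show "covers (splice_at j c d k) (splice_at j c d (Suc k))"
  proof (cases "k < j")
    case True
    with assms(1) show ?thesis by (simp add: splice_at_left saturatedD)
  next
    case False
    then obtain k' where k': "k = j + k'" using le_Suc_ex not_less by blast
    with \<open>k < j + l\<close> have "covers (d k') (d (Suc k'))" using assms(2) by (simp add: saturatedD)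
    then show ?thesis
      using splice_at_right[of c j d k'] splice_at_right[of c j d "Suc k'"] assms(3) k' by simp
  qed
qed

section \<open>Chains as graphs of functions of the height\<close>

definition edge_x :: "('a \<Rightarrow> real \<times> real) \<Rightarrow> 'a \<Rightarrow> 'a \<Rightarrow> real \<Rightarrow> real" where
  "edge_x pos s t y = fst (pos s) + inclination pos s t * (y - snd (pos s))"

text \<open>Total in \<open>y\<close>: constant below the first vertex and, for positive length,
  prolonging the last edge above the last vertex. Continuity then holds on the whole line, and
  chains of different heights can be subtracted without tracking domains.\<close>

primrec chain_x :: "('a \<Rightarrow> real \<times> real) \<Rightarrow> (nat \<Rightarrow> 'a) \<Rightarrow> nat \<Rightarrow> real \<Rightarrow> real" where
  "chain_x pos c 0 y = fst (pos (c 0))"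
| "chain_x pos c (Suc n) y =
     (if y \<le> snd (pos (c n)) then chain_x pos c n y else edge_x pos (c n) (c (Suc n)) y)"

locale ranked_diagram =
  fixes pos :: "'a::order \<Rightarrow> real \<times> real" and \<rho> :: "'a \<Rightarrow> nat"
  assumes planar: "planar_hasse_diagram pos"
    and rank_less: "s < t \<Longrightarrow> \<rho> s < \<rho> t"
    and rank_covers: "covers s t \<Longrightarrow> \<rho> t = Suc (\<rho> s)"
begin

abbreviation xc :: "'a \<Rightarrow> real" where "xc a \<equiv> fst (pos a)"
abbreviation yc :: "'a \<Rightarrow> real" where "yc a \<equiv> snd (pos a)"
abbreviation incl :: "'a \<Rightarrow> 'a \<Rightarrow> real" where "incl \<equiv> inclination pos"

lemma yc_less: "s < t \<Longrightarrow> yc s < yc t"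
  using planar by (simp add: planar_hasse_diagram_def)

lemma yc_le: "s \<le> t \<Longrightarrow> yc s \<le> yc t"
  using yc_less by (metis order_le_less order.refl)

lemma yc_covers: "covers s t \<Longrightarrow> yc s < yc t"
  by (simp add: coversD yc_less)

lemma edge_x_bot: "edge_x pos s t (yc s) = xc s"
  by (simp add: edge_x_def)

lemma edge_x_top: "covers s t \<Longrightarrow> edge_x pos s t (yc t) = xc t"
  using yc_covers[of s t] by (simp add: edge_x_def inclination_def)

lemma edge_x_from_top: "covers s t \<Longrightarrow> edge_x pos s t y = xc t + incl s t * (y - yc t)"
  using yc_covers[of s t] by (simp add: edge_x_def inclination_def divide_simps) argo

lemma mem_edge_iff:
  assumes "covers s t"
  shows "p \<in> closed_segment (pos s) (pos t) \<longleftrightarrow>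
           yc s \<le> snd p \<and> snd p \<le> yc t \<and> fst p = edge_x pos s t (snd p)"
proof
  have h: "yc s < yc t" by (rule yc_covers[OF assms])
  assume "p \<in> closed_segment (pos s) (pos t)"
  then obtain u where u: "0 \<le> u" "u \<le> 1" "p = (1 - u) *\<^sub>R pos s + u *\<^sub>R pos t"
    by (auto simp: closed_segment_def)
  have y: "snd p = yc s + u * (yc t - yc s)" and x: "fst p = xc s + u * (xc t - xc s)"
    unfolding u(3) by (simp_all add: algebra_simps)
  have "u * (yc t - yc s) \<le> 1 * (yc t - yc s)"
    using u h by (intro mult_right_mono) auto
  then have "snd p \<le> yc t" unfolding y by simp
  then show "yc s \<le> snd p \<and> snd p \<le> yc t \<and> fst p = edge_x pos s t (snd p)"
    using u(1) h unfolding y x by (simp add: edge_x_def inclination_def)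
next
  have h: "yc s < yc t" by (rule yc_covers[OF assms])
  assume a: "yc s \<le> snd p \<and> snd p \<le> yc t \<and> fst p = edge_x pos s t (snd p)"
  define u where "u = (snd p - yc s) / (yc t - yc s)"
  have "0 \<le> u" "u \<le> 1" using a h by (auto simp: u_def)
  moreover have "p = (1 - u) *\<^sub>R pos s + u *\<^sub>R pos t"
  proof (rule prod_eqI)
    have e: "u * (yc t - yc s) = snd p - yc s" using h by (simp add: u_def)
    then show "snd p = snd ((1 - u) *\<^sub>R pos s + u *\<^sub>R pos t)" by (simp add: left_diff_distrib right_diff_distrib)
    have "fst p = xc s + (xc t - xc s) * u"
      using a by (simp add: edge_x_def inclination_def u_def)
    then show "fst p = fst ((1 - u) *\<^sub>R pos s + u *\<^sub>R pos t)" by (simp add: algebra_simps)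
  qed
  ultimately show "p \<in> closed_segment (pos s) (pos t)" by (auto simp: closed_segment_def)
qed

lemma vertex_on_edge:
  assumes "covers s t" "pos u \<in> closed_segment (pos s) (pos t)"
  shows "u = s \<or> u = t"
  using planar assms by (simp add: planar_hasse_diagram_def)

lemma edges_meet:
  assumes "covers s t" "covers s' t'" "(s, t) \<noteq> (s', t')"
    and "yc s \<le> y" "y \<le> yc t" "yc s' \<le> y" "y \<le> yc t'"
    and "edge_x pos s t y = edge_x pos s' t' y"
  shows "\<exists>z \<in> {s, t} \<inter> {s', t'}. yc z = y"
proof -
  let ?p = "(edge_x pos s t y, y)"
  have "?p \<in> closed_segment (pos s) (pos t) \<inter> closed_segment (pos s') (pos t')"
    using assms by (simp add: mem_edge_iff)
  moreover have "closed_segment (pos s) (pos t) \<inter> closed_segment (pos s') (pos t')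
          \<subseteq> pos ` ({s, t} \<inter> {s', t'})"
    using planar assms(1-3) unfolding planar_hasse_diagram_def by blast
  ultimately have "?p \<in> pos ` ({s, t} \<inter> {s', t'})" by blast
  then obtain z where "z \<in> {s, t} \<inter> {s', t'}" "?p = pos z" by blast
  then show ?thesis by (metis snd_conv)
qed

text \<open>Two edges of equal inclination with the same bottom overlap, so the lower of the two
  tops would lie on the other edge. Hence inclination orders the upper covers of an element
  strictly.\<close>

lemma incl_inj_up:
  assumes "covers t u" "covers t u'" "incl t u = incl t u'"
  shows "u = u'"
proof -
  have *: "u = u'" if "covers t u" "covers t u'" "incl t u = incl t u'" "yc u \<le> yc u'" for u u'
  proof -
    have "pos u \<in> closed_segment (pos t) (pos u')"
      using that edge_x_top[OF that(1)] yc_covers[OF that(1)]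
      by (simp add: mem_edge_iff edge_x_def)
    then have "u = t \<or> u = u'" using that(2) vertex_on_edge by blast
    with that(1) show ?thesis by (auto simp: covers_def)
  qed
  show ?thesis using *[of u u'] *[of u' u] assms by (metis linear)
qed

lemma incl_inj_down:
  assumes "covers w v" "covers w' v" "incl w v = incl w' v"
  shows "w = w'"
proof -
  have *: "w = w'" if "covers w v" "covers w' v" "incl w v = incl w' v" "yc w' \<le> yc w" for w w'
  proof -
    have "xc w = edge_x pos w' v (yc w)"
      using that edge_x_from_top[OF that(1), of "yc w"] edge_x_from_top[OF that(2), of "yc w"]
      by (simp add: edge_x_bot)
    then have "pos w \<in> closed_segment (pos w') (pos v)"
      using that yc_covers[OF that(1)] by (simp add: mem_edge_iff)
    then have "w = w' \<or> w = v" using that(2) vertex_on_edge by blast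
    with that(1) show ?thesis by (auto simp: covers_def)
  qed
  show ?thesis using *[of w w'] *[of w' w] assms by (metis linear)
qed

lemma rank_saturated:
  assumes "saturated c n" "k \<le> n"
  shows "\<rho> (c k) = \<rho> (c 0) + k"
  using assms(2)
proof (induction k)
  case (Suc k)
  then show ?case using rank_covers[OF saturatedD[OF assms(1), of k]] by simp
qed simp

lemma ex_upper_cover:
  fixes s t :: 'a
  assumes "s < t"
  shows "\<exists>z. covers s z \<and> z \<le> t"
proof -
  have "\<exists>z. (s < z \<and> z \<le> t) \<and> (\<forall>z'. s < z' \<and> z' \<le> t \<longrightarrow> \<rho> z \<le> \<rho> z')"
    by (rule ex_has_least_nat[of _ t]) (use assms in simp)
  then obtain z where z: "s < z" "z \<le> t" "\<And>z'. s < z' \<Longrightarrow> z' \<le> t \<Longrightarrow> \<rho> z \<le> \<rho> z'"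
    by blast
  have "covers s z"
    unfolding covers_def
  proof (intro conjI notI)
    assume "\<exists>u. s < u \<and> u < z"
    then obtain u where "s < u" "u < z" by blast
    then have "\<rho> z \<le> \<rho> u" using z by (meson order.strict_implies_order order.trans)
    with rank_less[OF \<open>u < z\<close>] show False by simp
  qed (use z in simp)
  with z show ?thesis by blast
qed

lemma ex_lower_cover:
  fixes s t :: 'a
  assumes "s < t"
  shows "\<exists>z. covers z t \<and> s \<le> z"
proof -
  have "\<exists>z. (s \<le> z \<and> z < t) \<and> (\<forall>z'. s \<le> z' \<and> z' < t \<longrightarrow> \<rho> z' \<le> \<rho> z)"
    by (rule ex_has_greatest_nat[of _ s _ "\<rho> t"]) (use assms rank_less in \<open>auto intro: less_imp_le\<close>)
  then obtain z where z: "s \<le> z" "z < t" "\<And>z'. s \<le> z' \<Longrightarrow> z' < t \<Longrightarrow> \<rho> z' \<le> \<rho> z"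
    by blast
  have "covers z t"
    unfolding covers_def
  proof (intro conjI notI)
    assume "\<exists>u. z < u \<and> u < t"
    then obtain u where u: "z < u" "u < t" by blast
    then have "\<rho> u \<le> \<rho> z" using z by (meson order.strict_implies_order order.trans)
    with rank_less[OF u(1)] show False by simp
  qed (use z in simp)
  with z show ?thesis by blast
qed

text \<open>Greedy choice: at each step the upper cover of largest inclination among those still
  below \<open>w\<close>. Finiteness of the covers sits inside the conclusion so that the bare
  existence of a chain, \<open>ex_saturated\<close>, follows without it.\<close>

lemma ex_rightmost_chain:
  assumes "x \<le> w"
  shows "\<exists>c n. c 0 = x \<and> c n = w \<and> saturated c n \<and>
     (\<forall>j<n. \<forall>z. covers (c j) z \<longrightarrow> incl (c j) (c (Suc j)) < incl (c j) z \<longrightarrow>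
        finite {z. covers (c j) z} \<longrightarrow> \<not> z \<le> w)"
  using assms
proof (induction "\<rho> w - \<rho> x" arbitrary: x rule: less_induct)
  case less
  show ?case
  proof (cases "x = w")
    case True
    then show ?thesis by (intro exI[of _ "\<lambda>_. x"] exI[of _ 0]) (auto simp: saturated_def)
  next
    case False
    with less have "x < w" by simp
    let ?Z = "{z. covers x z \<and> z \<le> w}"
    have ne: "?Z \<noteq> {}" using ex_upper_cover[OF \<open>x < w\<close>] by blast
    obtain u where u: "u \<in> ?Z" "finite {z. covers x z} \<Longrightarrow> \<forall>z\<in>?Z. incl x z \<le> incl x u"
    proof (cases "finite {z. covers x z}")
      case True
      then have fin: "finite ?Z" by simp
      then have "Max (incl x ` ?Z) \<in> incl x ` ?Z" using ne by (intro Max_in) auto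
      then obtain u where u: "u \<in> ?Z" "incl x u = Max (incl x ` ?Z)" by (metis (no_types, lifting) imageE)
      have "\<forall>z\<in>?Z. incl x z \<le> incl x u" using fin u(2) by simp
      with u that show ?thesis by blast
    qed (use ne that in blast)
    have "\<rho> w - \<rho> u < \<rho> w - \<rho> x"
      using u(1) rank_less[OF \<open>x < w\<close>] rank_covers[of x u] by simp
    then obtain c n where c: "c 0 = u" "c n = w" "saturated c n"
      "\<And>j z. j < n \<Longrightarrow> covers (c j) z \<Longrightarrow> incl (c j) (c (Suc j)) < incl (c j) z \<Longrightarrow>
        finite {z. covers (c j) z} \<Longrightarrow> \<not> z \<le> w"
      using less(1)[of u] u(1) by blast
    define d where "d = case_nat x c"
    have "saturated d (Suc n)"
      unfolding saturated_def
    proof (intro allI impI)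
      fix k assume "k < Suc n"
      then show "covers (d k) (d (Suc k))"
        using c u(1) by (cases k) (auto simp: d_def saturated_def)
    qed
    moreover have "\<not> z \<le> w" if "j < Suc n" "covers (d j) z" "incl (d j) (d (Suc j)) < incl (d j) z"
      "finite {z. covers (d j) z}" for j z
    proof (cases j)
      case 0
      then show ?thesis using that u c(1) by (fastforce simp: d_def)
    next
      case (Suc j')
      then show ?thesis using that c(4)[of j' z] by (simp add: d_def)
    qed
    moreover have "d 0 = x" "d (Suc n) = w" by (simp_all add: d_def c)
    ultimately show ?thesis by blast
  qed
qed

lemma ex_saturated:
  fixes x w :: 'a
  assumes "x \<le> w"
  obtains c n where "c 0 = x" "c n = w" "saturated c n"
  using ex_rightmost_chain[OF assms] by blast

lemma ex_saturated_via:
  fixes x z w :: 'a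
  assumes "covers x z" "z \<le> w"
  obtains c n where "c 0 = x" "c (Suc 0) = z" "c (Suc n) = w" "saturated c (Suc n)"
proof -
  obtain d n where d: "d 0 = z" "d n = w" "saturated d n" using ex_saturated[OF assms(2)] .
  have "saturated (case_nat x d) (Suc n)"
    unfolding saturated_def
  proof (intro allI impI)
    fix k assume "k < Suc n"
    then show "covers (case_nat x d k) (case_nat x d (Suc k))"
      using d assms by (cases k) (auto simp: saturated_def)
  qed
  with d show ?thesis by (intro that[of "case_nat x d" n]) auto
qed

lemma chain_x_at_top:
  assumes "saturated c n"
  shows "chain_x pos c n (yc (c n)) = xc (c n)"
proof (cases n)
  case (Suc m)
  then have "covers (c m) (c (Suc m))" using assms by (simp add: saturatedD)
  then show ?thesis using yc_covers[of "c m" "c (Suc m)"] edge_x_top[of "c m" "c (Suc m)"] Suc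
    by (simp add: not_le)
qed simp

lemma yc_chain_mono: "saturated c n \<Longrightarrow> j \<le> k \<Longrightarrow> k \<le> n \<Longrightarrow> yc (c j) \<le> yc (c k)"
  by (rule yc_le[OF saturated_mono])

lemma yc_chain_strict: "saturated c n \<Longrightarrow> j < k \<Longrightarrow> k \<le> n \<Longrightarrow> yc (c j) < yc (c k)"
  by (rule yc_less[OF saturated_strict])

lemma chain_x_edge:
  assumes "saturated c n" "k < n" "yc (c k) \<le> y" "y \<le> yc (c (Suc k))"
  shows "chain_x pos c n y = edge_x pos (c k) (c (Suc k)) y"
  using assms
proof (induction n)
  case (Suc n)
  have sat: "saturated c n" using Suc.prems(1) by (simp add: saturated_def)
  show ?case
  proof (cases "k = n")
    case True
    show ?thesis
    proof (cases "y \<le> yc (c n)")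
      case le: True
      then have "y = yc (c n)" using Suc.prems True by simp
      then show ?thesis using chain_x_at_top[OF sat] True by (simp add: edge_x_bot)
    qed (simp add: True)
  next
    case False
    then have "k < n" using Suc.prems by simp
    then have "y \<le> yc (c n)"
      using Suc.prems yc_chain_mono[OF sat, of "Suc k" n] by simp
    then show ?thesis using Suc.IH[OF sat \<open>k < n\<close>] Suc.prems by simp
  qed
qed simp

lemma chain_x_vertex:
  assumes "saturated c n" "k \<le> n"
  shows "chain_x pos c n (yc (c k)) = xc (c k)"
proof (cases "k = n")
  case True
  then show ?thesis using chain_x_at_top[OF assms(1)] by simp
next
  case False
  then have "k < n" using assms by simp
  then show ?thesis
    using chain_x_edge[OF assms(1) \<open>k < n\<close>, of "yc (c k)"] yc_covers[OF saturatedD[OF assms(1) \<open>k < n\<close>]]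
    by (simp add: edge_x_bot)
qed

lemma chain_x_continuous:
  assumes "saturated c n"
  shows "continuous_on UNIV (chain_x pos c n)"
  using assms
proof (induction n)
  case (Suc n)
  have sat: "saturated c n" using Suc.prems by (simp add: saturated_def)
  have "continuous_on ({..yc (c n)} \<union> {yc (c n)..})
    (\<lambda>y. if y \<le> yc (c n) then chain_x pos c n y else edge_x pos (c n) (c (Suc n)) y)"
  proof (rule continuous_on_If)
    show "continuous_on {..yc (c n)} (chain_x pos c n)"
      using Suc.IH[OF sat] continuous_on_subset by blast
    show "continuous_on {yc (c n)..} (edge_x pos (c n) (c (Suc n)))"
      unfolding edge_x_def by (intro continuous_intros)
    fix y
    show "chain_x pos c n y = edge_x pos (c n) (c (Suc n)) y"
      if "y \<in> {..yc (c n)}" "\<not> y \<le> yc (c n)" using that by simp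
    show "chain_x pos c n y = edge_x pos (c n) (c (Suc n)) y"
      if "y \<in> {yc (c n)..}" "y \<le> yc (c n)"
    proof -
      have "y = yc (c n)" using that by simp
      then show ?thesis using chain_x_at_top[OF sat] by (simp add: edge_x_bot)
    qed
  qed simp_all
  moreover have "{..yc (c n)} \<union> {yc (c n)..} = UNIV" by auto
  ultimately show ?case by simp
qed simp

lemma ex_chain_edge:
  assumes "yc (c 0) \<le> y" "y \<le> yc (c n)" "n > 0"
  shows "\<exists>k<n. yc (c k) \<le> y \<and> y \<le> yc (c (Suc k))"
  using assms
proof (induction n)
  case (Suc n)
  show ?case
  proof (cases "n > 0 \<and> y \<le> yc (c n)")
    case True
    with Suc show ?thesis by (metis less_Suc_eq)
  next
    case False
    with Suc show ?thesis by (intro exI[of _ n]) auto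
  qed
qed simp

text \<open>Turns a geometric coincidence into an order-theoretic one: an edge of each chain passes
  through the common point, and planarity leaves only a shared vertex at that height or one and the
  same edge.\<close>

lemma chains_meet:
  assumes "saturated c n" "saturated d l" "n > 0" "l > 0"
    and "yc (c 0) \<le> y" "y \<le> yc (c n)" "yc (d 0) \<le> y" "y \<le> yc (d l)"
    and "chain_x pos c n y = chain_x pos d l y"
  shows "(\<exists>j\<le>n. \<exists>k\<le>l. c j = d k \<and> yc (c j) = y) \<or>
         (\<exists>j<n. \<exists>k<l. c j = d k \<and> c (Suc j) = d (Suc k) \<and> yc (c j) \<le> y \<and> y \<le> yc (c (Suc j)))"
proof -
  obtain j where j: "j < n" "yc (c j) \<le> y" "y \<le> yc (c (Suc j))"
    using ex_chain_edge[of c y n] assms by blast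
  obtain k where k: "k < l" "yc (d k) \<le> y" "y \<le> yc (d (Suc k))"
    using ex_chain_edge[of d y l] assms by blast
  have cov: "covers (c j) (c (Suc j))" "covers (d k) (d (Suc k))"
    using assms j k saturatedD by blast+
  have eq: "edge_x pos (c j) (c (Suc j)) y = edge_x pos (d k) (d (Suc k)) y"
    using chain_x_edge[OF assms(1) j] chain_x_edge[OF assms(2) k] assms(9) by simp
  show ?thesis
  proof (cases "(c j, c (Suc j)) = (d k, d (Suc k))")
    case True
    with j k show ?thesis by blast
  next
    case False
    obtain z where "z \<in> {c j, c (Suc j)} \<inter> {d k, d (Suc k)}" "yc z = y"
      using edges_meet[OF cov False j(2,3) k(2,3) eq] by blast
    moreover have "Suc j \<le> n" "Suc k \<le> l" "j \<le> n" "k \<le> l" using j k by auto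
    ultimately show ?thesis by blast
  qed
qed

text \<open>The inclinations decide the sides just above the common bottom, and a later change of
  sides would force a coincidence in between.\<close>

lemma left_of_preserved:
  assumes sat: "saturated c n" "saturated d l" and pos: "n > 0" "l > 0" and "c 0 = d 0"
    and less: "incl (c 0) (c 1) < incl (d 0) (d 1)"
    and ne: "\<And>y. yc (c 0) < y \<Longrightarrow> y \<le> b \<Longrightarrow> chain_x pos c n y \<noteq> chain_x pos d l y"
    and b: "yc (c 0) < b"
  shows "chain_x pos c n b < chain_x pos d l b"
proof -
  \<comment> \<open>A height at which both chains are still on their first edges, so that only the
    inclinations matter.\<close>
  define e where "e = min b (min (yc (c 1)) (yc (d 1)))"
  have cov: "covers (c 0) (c 1)" "covers (d 0) (d 1)" using sat pos by (auto simp: saturated_def)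
  have e: "yc (c 0) < e" "e \<le> b" "e \<le> yc (c 1)" "e \<le> yc (d 1)"
    using b yc_covers[OF cov(1)] yc_covers[OF cov(2)] \<open>c 0 = d 0\<close> by (auto simp: e_def)
  have "chain_x pos c n e = edge_x pos (c 0) (c 1) e" "chain_x pos d l e = edge_x pos (d 0) (d 1) e"
    using chain_x_edge[OF sat(1) pos(1), of e] chain_x_edge[OF sat(2) pos(2), of e] e \<open>c 0 = d 0\<close>
    by auto
  moreover have "incl (c 0) (c 1) * (e - yc (c 0)) < incl (d 0) (d 1) * (e - yc (c 0))"
    using less e by (intro mult_strict_right_mono) auto
  ultimately have at_e: "chain_x pos c n e < chain_x pos d l e"
    using \<open>c 0 = d 0\<close> by (simp add: edge_x_def)
  show ?thesis
  proof (rule ccontr)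
    let ?f = "\<lambda>y. chain_x pos c n y - chain_x pos d l y"
    assume "\<not> ?thesis"
    then have "?f e \<le> 0" "0 \<le> ?f b" using at_e by auto
    moreover have "continuous_on {e..b} ?f"
      using chain_x_continuous[OF sat(1)] chain_x_continuous[OF sat(2)]
      by (intro continuous_intros) (auto intro: continuous_on_subset)
    ultimately obtain y where "e \<le> y" "y \<le> b" "?f y = 0"
      using IVT'[of ?f e 0 b] e by blast
    with ne[of y] e show False by simp
  qed
qed

text \<open>\<open>c\<close> is the left side and \<open>d\<close> the right one. One length serves
  for both, since the rank makes saturated chains with the same ends equally long.\<close>

definition bigon :: "(nat \<Rightarrow> 'a) \<Rightarrow> (nat \<Rightarrow> 'a) \<Rightarrow> nat \<Rightarrow> bool" where
  "bigon c d n \<longleftrightarrow> saturated c n \<and> saturated d n \<and> n > 0 \<and> c 0 = d 0 \<and> c n = d n \<and>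
     (\<forall>j k. 0 < j \<longrightarrow> j < n \<longrightarrow> 0 < k \<longrightarrow> k < n \<longrightarrow> c j \<noteq> d k) \<and>
     incl (c 0) (c 1) < incl (d 0) (d 1)"

lemma bigon_common:
  assumes "bigon c d n" "j \<le> n" "k \<le> n" "c j = d k"
  shows "j = k \<and> (j = 0 \<or> j = n)"
proof -
  have "\<rho> (c j) = \<rho> (c 0) + j" "\<rho> (d k) = \<rho> (d 0) + k"
    using assms rank_saturated[of c n j] rank_saturated[of d n k] by (auto simp: bigon_def)
  then have "j = k" using assms by (simp add: bigon_def)
  moreover have "j = 0 \<or> j = n"
  proof (rule ccontr)
    assume "\<not> ?thesis"
    then have "0 < j" "j < n" using assms(2) by auto
    then have "c j \<noteq> d j" using assms(1) by (simp add: bigon_def)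
    with assms(4) \<open>j = k\<close> show False by simp
  qed
  ultimately show ?thesis by simp
qed

lemma bigon_ge_2:
  assumes "bigon c d n"
  shows "n \<ge> 2"
proof (rule ccontr)
  assume "\<not> n \<ge> 2"
  then have "n = 1" using assms by (auto simp: bigon_def)
  then show False using assms by (auto simp: bigon_def)
qed

lemma bigon_between:
  assumes "bigon c d n" "yc (c 0) < y" "y < yc (c n)"
  shows "chain_x pos c n y < chain_x pos d n y"
proof -
  have b: "saturated c n" "saturated d n" "n > 0" "c 0 = d 0" "c n = d n"
    "incl (c 0) (c 1) < incl (d 0) (d 1)" using assms(1) by (auto simp: bigon_def)
  show ?thesis
  proof (rule left_of_preserved[OF b(1,2,3,3,4,6) _ assms(2)])
    fix y' assume y': "yc (c 0) < y'" "y' \<le> y"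
    show "chain_x pos c n y' \<noteq> chain_x pos d n y'"
    proof
      assume "chain_x pos c n y' = chain_x pos d n y'"
      moreover have "yc (c 0) \<le> y'" "y' \<le> yc (c n)" "yc (d 0) \<le> y'" "y' \<le> yc (d n)"
        using y' assms b by auto
      ultimately have "(\<exists>j\<le>n. \<exists>k\<le>n. c j = d k \<and> yc (c j) = y') \<or>
         (\<exists>j<n. \<exists>k<n. c j = d k \<and> c (Suc j) = d (Suc k) \<and> yc (c j) \<le> y' \<and> y' \<le> yc (c (Suc j)))"
        using chains_meet[OF b(1,2,3,3)] by blast
      then show False
      proof (elim disjE exE conjE)
        fix j k assume "j \<le> n" "k \<le> n" "c j = d k" "yc (c j) = y'"
        with bigon_common[OF assms(1)] have "j = 0 \<or> j = n" by blast
        with y' assms \<open>yc (c j) = y'\<close> show False by auto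
      next
        \<comment> \<open>A shared edge has two common vertices, which would have to be bottom and
          top; length at least 2 rules this out.\<close>
        fix j k assume "j < n" "k < n" "c j = d k" "c (Suc j) = d (Suc k)"
        with bigon_common[OF assms(1), of j k] bigon_common[OF assms(1), of "Suc j" "Suc k"]
          bigon_ge_2[OF assms(1)]
        show False by auto
      qed
    qed
  qed
qed

text \<open>Just below the top both sides run along lines through \<open>c n\<close>, with
  \<open>c\<close> on the left. Of two lines with a common upper end the one further left has the
  larger inclination, so the order of inclinations is reversed at the top.\<close>

lemma bigon_top:
  assumes "bigon c d n"
  shows "incl (d (n - 1)) (d n) < incl (c (n - 1)) (c n)"
proof -
  have b: "saturated c n" "saturated d n" "n > 0" "c 0 = d 0" "c n = d n"
    using assms by (auto simp: bigon_def)
  let ?v = "c n"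
  have cov: "covers (c (n - 1)) ?v" "covers (d (n - 1)) ?v"
    using saturatedD[OF b(1), of "n - 1"] saturatedD[OF b(2), of "n - 1"] b by auto
  define y where "y = max (yc (c (n - 1))) (yc (d (n - 1)))"
  have y: "yc (c (n - 1)) \<le> y" "yc (d (n - 1)) \<le> y" "y < yc ?v"
    using yc_covers[OF cov(1)] yc_covers[OF cov(2)] by (auto simp: y_def)
  have "yc (c 0) < y"
    using yc_chain_strict[OF b(1), of 0 "n - 1"] y bigon_ge_2[OF assms] by simp
  then have "chain_x pos c n y < chain_x pos d n y" using bigon_between[OF assms] y by simp
  moreover have "chain_x pos c n y = xc ?v + incl (c (n - 1)) ?v * (y - yc ?v)"
    using chain_x_edge[OF b(1), of "n - 1" y] y b edge_x_from_top[OF cov(1)] by simp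
  moreover have "chain_x pos d n y = xc ?v + incl (d (n - 1)) ?v * (y - yc ?v)"
    using chain_x_edge[OF b(2), of "n - 1" y] y b edge_x_from_top[OF cov(2)] by simp
  ultimately have "incl (d (n - 1)) ?v * (yc ?v - y) < incl (c (n - 1)) ?v * (yc ?v - y)"
    by (simp add: algebra_simps)
  then show ?thesis using y b by (simp add: mult_less_cancel_right)
qed

end

section \<open>Faces\<close>

lemma continuous_positive_nearby:
  fixes g :: "real \<Rightarrow> real"
  assumes "continuous_on UNIV g" "g a > 0"
  shows "\<exists>e>0. \<forall>y. \<bar>y - a\<bar> < e \<longrightarrow> g y > 0"
proof -
  have "open {y. 0 < g y}" using assms(1) by (intro open_Collect_less) auto
  then obtain e where "e > 0" "ball a e \<subseteq> {y. 0 < g y}"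
    using assms(2) open_contains_ball by (metis mem_Collect_eq)
  then show ?thesis by (intro exI[of _ e]) (auto simp: subset_iff dist_real_def abs_minus_commute)
qed

context ranked_diagram
begin

text \<open>Emptiness of the enclosed region, tested on edges height by height. In this form the
  arguments about chains can do without \<open>inside\<close>, which is translated once, in
  \<open>face_of_polygon\<close>.\<close>

definition face :: "(nat \<Rightarrow> 'a) \<Rightarrow> (nat \<Rightarrow> 'a) \<Rightarrow> nat \<Rightarrow> bool" where
  "face c d n \<longleftrightarrow> bigon c d n \<and>
     (\<forall>s z y. covers s z \<longrightarrow> yc s \<le> y \<longrightarrow> y \<le> yc z \<longrightarrow> yc (c 0) < y \<longrightarrow> y < yc (c n) \<longrightarrow>
        \<not> (chain_x pos c n y < edge_x pos s z y \<and> edge_x pos s z y < chain_x pos d n y))"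

lemma faceD:
  assumes "face c d n" "covers s z" "yc s \<le> y" "y \<le> yc z" "yc (c 0) < y" "y < yc (c n)"
    "chain_x pos c n y < edge_x pos s z y" "edge_x pos s z y < chain_x pos d n y"
  shows False
  using assms unfolding face_def by blast

text \<open>An edge leaving \<open>c j\<close> to the right of \<open>c\<close> would start out
  strictly between the sides: right of \<open>c\<close> by its inclination, and left of
  \<open>d\<close> by continuity, because \<open>c j\<close> itself lies strictly left of
  \<open>d\<close>.\<close>

lemma face_right_up:
  assumes "face c d n" "0 < j" "j < n" "covers (c j) z"
  shows "incl (c j) z \<le> incl (c j) (c (Suc j))"
proof (rule ccontr)
  assume "\<not> ?thesis"
  then have lt: "incl (c j) (c (Suc j)) < incl (c j) z" by simp
  have bg: "bigon c d n" using assms(1) by (simp add: face_def)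
  then have sat: "saturated c n" "saturated d n" by (auto simp: bigon_def)
  let ?y = "yc (c j)"
  let ?g = "\<lambda>y. chain_x pos d n y - edge_x pos (c j) z y"
  have y0: "yc (c 0) < ?y" "?y < yc (c n)" using yc_chain_strict[OF sat(1)] assms by auto
  have "?g ?y > 0"
    using bigon_between[OF bg y0] chain_x_vertex[OF sat(1), of j] assms by (simp add: edge_x_bot)
  moreover have "continuous_on UNIV ?g"
    unfolding edge_x_def by (intro continuous_intros chain_x_continuous sat)
  ultimately obtain e where e: "e > 0" "\<And>y. \<bar>y - ?y\<bar> < e \<Longrightarrow> ?g y > 0"
    using continuous_positive_nearby[of ?g ?y] by blast
  have cov: "covers (c j) (c (Suc j))" using sat assms by (simp add: saturatedD)
  \<comment> \<open>The term with \<open>e\<close> keeps the edge left of \<open>d\<close>, the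
    midpoint keeps \<open>y\<close> below the top, and the last two bounds keep it within both
    edges.\<close>
  define y where "y = min (?y + e / 2) (min ((?y + yc (c n)) / 2) (min (yc z) (yc (c (Suc j)))))"
  have y: "?y < y" "\<bar>y - ?y\<bar> < e" "y < yc (c n)" "y \<le> yc z" "y \<le> yc (c (Suc j))"
    using e(1) y0 yc_covers[OF cov] yc_covers[OF assms(4)] by (auto simp: y_def min_def max_def)
  have "chain_x pos c n y = edge_x pos (c j) (c (Suc j)) y"
    using chain_x_edge[OF sat(1) assms(3)] y by simp
  moreover have "incl (c j) (c (Suc j)) * (y - ?y) < incl (c j) z * (y - ?y)"
    using lt y by (intro mult_strict_right_mono) auto
  ultimately have "chain_x pos c n y < edge_x pos (c j) z y" by (simp add: edge_x_def)
  moreover have "edge_x pos (c j) z y < chain_x pos d n y" using e(2)[OF y(2)] by simp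
  ultimately show False using faceD[OF assms(1,4), of y] y y0 by simp
qed

text \<open>The argument of \<open>face_right_up\<close> run downwards: below \<open>c j\<close> the
  smaller inclination lies further right, hence the reversed inequality.\<close>

lemma face_right_down:
  assumes "face c d n" "0 < j" "j < n" "covers z (c j)"
  shows "incl (c (j - 1)) (c j) \<le> incl z (c j)"
proof (rule ccontr)
  assume "\<not> ?thesis"
  then have lt: "incl z (c j) < incl (c (j - 1)) (c j)" by simp
  have bg: "bigon c d n" using assms(1) by (simp add: face_def)
  then have sat: "saturated c n" "saturated d n" by (auto simp: bigon_def)
  let ?y = "yc (c j)"
  let ?g = "\<lambda>y. chain_x pos d n y - edge_x pos z (c j) y"
  have y0: "yc (c 0) < ?y" "?y < yc (c n)" using yc_chain_strict[OF sat(1)] assms by auto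
  have "?g ?y > 0"
    using bigon_between[OF bg y0] chain_x_vertex[OF sat(1), of j] assms by (simp add: edge_x_top)
  moreover have "continuous_on UNIV ?g"
    unfolding edge_x_def by (intro continuous_intros chain_x_continuous sat)
  ultimately obtain e where e: "e > 0" "\<And>y. \<bar>y - ?y\<bar> < e \<Longrightarrow> ?g y > 0"
    using continuous_positive_nearby[of ?g ?y] by blast
  have cov: "covers (c (j - 1)) (c j)" using saturatedD[OF sat(1), of "j - 1"] assms by simp
  define y where "y = max (?y - e / 2) (max ((?y + yc (c 0)) / 2) (max (yc z) (yc (c (j - 1)))))"
  have y: "y < ?y" "\<bar>y - ?y\<bar> < e" "yc (c 0) < y" "yc z \<le> y" "yc (c (j - 1)) \<le> y"
    using e(1) y0 yc_covers[OF cov] yc_covers[OF assms(4)] by (auto simp: y_def min_def max_def)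
  have "chain_x pos c n y = edge_x pos (c (j - 1)) (c j) y"
    using chain_x_edge[OF sat(1), of "j - 1" y] y assms by simp
  moreover have "incl z (c j) * (?y - y) < incl (c (j - 1)) (c j) * (?y - y)"
    using lt y by (intro mult_strict_right_mono) auto
  ultimately have "chain_x pos c n y < edge_x pos z (c j) y"
    by (simp only: edge_x_from_top[OF cov] edge_x_from_top[OF assms(4)] algebra_simps)
  moreover have "edge_x pos z (c j) y < chain_x pos d n y" using e(2)[OF y(2)] by simp
  ultimately show False using faceD[OF assms(1,4), of y] y y0 by simp
qed

text \<open>Just below the top such an edge would run between the last edges of the two
  sides.\<close>

lemma face_top_consecutive:
  assumes "face c d n" "covers z (c n)"
    "incl (d (n - 1)) (c n) < incl z (c n)" "incl z (c n) < incl (c (n - 1)) (c n)"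
  shows False
proof -
  have bg: "bigon c d n" using assms(1) by (simp add: face_def)
  then have b: "saturated c n" "saturated d n" "n > 0" "c n = d n" by (auto simp: bigon_def)
  let ?v = "c n"
  have cov: "covers (c (n - 1)) ?v" "covers (d (n - 1)) ?v"
    using saturatedD[OF b(1), of "n - 1"] saturatedD[OF b(2), of "n - 1"] b by auto
  define y where "y = max (yc z) (max (yc (c (n - 1))) (yc (d (n - 1))))"
  have y: "yc (c (n - 1)) \<le> y" "yc (d (n - 1)) \<le> y" "yc z \<le> y" "y < yc ?v"
    using yc_covers[OF cov(1)] yc_covers[OF cov(2)] yc_covers[OF assms(2)] by (auto simp: y_def min_def max_def)
  have "yc (c 0) < y"
    using yc_chain_strict[OF b(1), of 0 "n - 1"] y bigon_ge_2[OF bg] by simp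
  moreover have "chain_x pos c n y = xc ?v + incl (c (n - 1)) ?v * (y - yc ?v)"
    using chain_x_edge[OF b(1), of "n - 1" y] y b edge_x_from_top[OF cov(1)] by simp
  moreover have "chain_x pos d n y = xc ?v + incl (d (n - 1)) ?v * (y - yc ?v)"
    using chain_x_edge[OF b(2), of "n - 1" y] y b edge_x_from_top[OF cov(2)] by simp
  moreover have "incl (d (n - 1)) ?v * (yc ?v - y) < incl z ?v * (yc ?v - y)"
    using assms y by (intro mult_strict_right_mono) auto
  moreover have "incl z ?v * (yc ?v - y) < incl (c (n - 1)) ?v * (yc ?v - y)"
    using assms y by (intro mult_strict_right_mono) auto
  ultimately show False
    using faceD[OF assms(1,2), of y] y by (simp add: edge_x_from_top[OF assms(2)] algebra_simps)
qed

text \<open>An edge that leaves the left side into the enclosed region. At the bottom the right side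
  starts from the same vertex, hence the additional bound for \<open>j = 0\<close>.\<close>

definition right_branch :: "(nat \<Rightarrow> 'a) \<Rightarrow> (nat \<Rightarrow> 'a) \<Rightarrow> nat \<Rightarrow> 'a \<Rightarrow> bool" where
  "right_branch c d j z \<longleftrightarrow> covers (c j) z \<and> incl (c j) (c (Suc j)) < incl (c j) z \<and>
     (j = 0 \<longrightarrow> incl (c 0) z < incl (c 0) (d 1))"

lemma chain_x_splice:
  assumes "saturated c j" "saturated d l" "c j = d 0" "l > 0" "yc (d 0) \<le> y" "y \<le> yc (d l)"
  shows "chain_x pos (splice_at j c d) (j + l) y = chain_x pos d l y"
proof -
  obtain k where k: "k < l" "yc (d k) \<le> y" "y \<le> yc (d (Suc k))"
    using ex_chain_edge[of d y l] assms by blast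
  have s: "splice_at j c d (j + k) = d k" "splice_at j c d (Suc (j + k)) = d (Suc k)"
    using splice_at_right[of c j d] assms(3) by (metis add_Suc_right)+
  have "chain_x pos (splice_at j c d) (j + l) y
      = edge_x pos (splice_at j c d (j + k)) (splice_at j c d (Suc (j + k))) y"
    using k s by (intro chain_x_edge saturated_splice assms) auto
  then show ?thesis using chain_x_edge[OF assms(2) k] s by simp
qed

lemma splice_incl:
  assumes "bigon c d n" "j < n" "right_branch c d j z" "e 0 = c j" "e (Suc 0) = z"
  shows "incl (splice_at j c e 0) (splice_at j c e 1) < incl (d 0) (d 1)"
  using assms by (cases "j = 0") (auto simp: splice_at_def bigon_def right_branch_def)

text \<open>Otherwise a chain through \<open>z\<close> would, at the height of the top, still run strictly between
  \<open>c\<close> and \<open>d\<close>, which meet there.\<close>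

lemma trapped_below_top:
  assumes bg: "bigon c d n" and "j < n" and br: "right_branch c d j z"
    and nle: "\<not> z \<le> c n" and "z \<le> e"
  shows "yc e < yc (c n)"
proof (rule ccontr)
  assume "\<not> ?thesis"
  then have ye: "yc (c n) \<le> yc e" by simp
  let ?v = "c n"
  have sat: "saturated c n" "saturated d n" and ends: "c 0 = d 0" "c n = d n" "n > 0"
    using bg by (auto simp: bigon_def)
  have cov: "covers (c j) z" using br by (simp add: right_branch_def)
  obtain D l where D: "D 0 = c j" "D (Suc 0) = z" "D (Suc l) = e" "saturated D (Suc l)"
    using ex_saturated_via[OF cov \<open>z \<le> e\<close>] .
  \<comment> \<open>\<open>z\<close> is not below the top, hence no later vertex of \<open>D\<close>
    is, whereas all vertices of \<open>c\<close> and \<open>d\<close> are. So \<open>D\<close> meets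
    neither side after \<open>c j\<close>.\<close>
  have D_ge: "\<not> D k \<le> ?v" if "0 < k" "k \<le> Suc l" for k
    using saturated_mono[OF D(4), of "Suc 0" k] that D(2) nle by (auto dest: order.trans)
  define cs where "cs = (\<lambda>k. c (j + k))"
  have cs: "saturated cs (n - j)" "cs 0 = c j" "cs (n - j) = ?v" "cs (Suc 0) = c (Suc j)"
    using saturated_shift[OF sat(1), of j] \<open>j < n\<close> by (auto simp: cs_def)
  have cs_le: "cs k \<le> ?v" if "k \<le> n - j" for k
    using saturated_mono[OF cs(1) that] cs(3) by simp
  have yv: "yc (c j) < yc ?v" using yc_chain_strict[OF sat(1) \<open>j < n\<close>] by simp
  have "chain_x pos cs (n - j) (yc ?v) < chain_x pos D (Suc l) (yc ?v)"
  proof (rule left_of_preserved)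
    show "saturated cs (n - j)" "saturated D (Suc l)" by fact+
    show "n - j > 0" "Suc l > 0" using \<open>j < n\<close> by auto
    show "cs 0 = D 0" by (simp add: cs D)
    show "incl (cs 0) (cs 1) < incl (D 0) (D 1)" using br by (simp add: cs D right_branch_def)
    show "yc (cs 0) < yc ?v" using yv by (simp add: cs)
    fix y assume y: "yc (cs 0) < y" "y \<le> yc ?v"
    show "chain_x pos cs (n - j) y \<noteq> chain_x pos D (Suc l) y"
    proof
      assume "chain_x pos cs (n - j) y = chain_x pos D (Suc l) y"
      then consider k k' where "k \<le> n - j" "k' \<le> Suc l" "cs k = D k'" "yc (cs k) = y"
        | k k' where "k < n - j" "k' < Suc l" "cs (Suc k) = D (Suc k')"
        using chains_meet[OF cs(1) D(4), of y] y \<open>j < n\<close> cs D ye by auto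
      then show False
      proof cases
        case 1
        then have "k' \<noteq> 0" using y D(1) cs(2) by (intro notI) auto
        with 1 D_ge[of k'] cs_le[of k] show False by simp
      next
        case 2
        with D_ge[of "Suc k'"] cs_le[of "Suc k"] show False by simp
      qed
    qed
  qed
  moreover
  \<comment> \<open>The comparison with \<open>d\<close> has to start at a common vertex, so
    \<open>D\<close> is prolonged downwards along \<open>c\<close> to the bottom.\<close>
  define ct where "ct = splice_at j c D"
  have ct: "saturated ct (j + Suc l)"
    unfolding ct_def
    by (intro saturated_splice D) (use sat \<open>j < n\<close> D in \<open>auto simp: saturated_def\<close>)
  have ct0: "ct 0 = c 0" by (simp add: ct_def splice_at_def)
  have ct_end: "ct (j + Suc l) = e" unfolding ct_def using splice_at_right[of c j D "Suc l"] D by simp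
  have common: "k = 0 \<and> k' = 0" if "k \<le> j + Suc l" "k' \<le> n" "ct k = d k'" for k k'
  proof (cases "k \<le> j")
    case True
    then have "c k = d k'" using that by (simp add: ct_def splice_at_left)
    then show ?thesis using bigon_common[OF bg, of k k'] that True \<open>j < n\<close> by auto
  next
    case False
    then have "D (k - j) = d k'" using that by (simp add: ct_def splice_at_def)
    moreover have "d k' \<le> ?v" using saturated_mono[OF sat(2) that(2)] ends by simp
    moreover have "0 < k - j" "k - j \<le> Suc l" using False that by auto
    ultimately show ?thesis using D_ge[of "k - j"] by simp
  qed
  have "chain_x pos ct (j + Suc l) (yc ?v) < chain_x pos d n (yc ?v)"
  proof (rule left_of_preserved)
    show "saturated ct (j + Suc l)" "saturated d n" "n > 0" "j + Suc l > 0" using ct sat ends by auto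
    show "ct 0 = d 0" using ct0 ends by simp
    show "incl (ct 0) (ct 1) < incl (d 0) (d 1)"
      unfolding ct_def by (rule splice_incl[OF bg \<open>j < n\<close> br D(1,2)])
    show "yc (ct 0) < yc ?v" using yc_chain_strict[OF sat(1) \<open>n > 0\<close>] ct0 by simp
    fix y assume y: "yc (ct 0) < y" "y \<le> yc ?v"
    show "chain_x pos ct (j + Suc l) y \<noteq> chain_x pos d n y"
    proof
      assume "chain_x pos ct (j + Suc l) y = chain_x pos d n y"
      then consider k k' where "k \<le> j + Suc l" "k' \<le> n" "ct k = d k'" "yc (ct k) = y"
        | k k' where "k < j + Suc l" "k' < n" "ct (Suc k) = d (Suc k')"
        using chains_meet[OF ct sat(2), of y] y ends ct0 ct_end ye by auto
      then show False
      proof cases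
        case 1
        with common[of k k'] y show False by auto
      next
        case 2
        with common[of "Suc k" "Suc k'"] show False by simp
      qed
    qed
  qed
  moreover have "chain_x pos ct (j + Suc l) (yc ?v) = chain_x pos D (Suc l) (yc ?v)"
    unfolding ct_def
    by (rule chain_x_splice) (use sat D yv ye \<open>j < n\<close> in \<open>auto simp: saturated_def\<close>)
  moreover have "chain_x pos cs (n - j) (yc ?v) = xc ?v" "chain_x pos d n (yc ?v) = xc ?v"
    using chain_x_at_top[OF cs(1)] chain_x_at_top[OF sat(2)] cs ends by auto
  ultimately show False by simp
qed

text \<open>A chain \<open>D\<close> from \<open>c j\<close> through \<open>z\<close> to the top has
  no inner vertex on either side, because \<open>z\<close> lies below neither
  \<open>c (n - 1)\<close> nor \<open>d (n - 1)\<close>. So \<open>D\<close> cuts the bigon into two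
  bigons, and \<open>bigon_top\<close> for each of them puts the last edge of \<open>D\<close>
  between the last edges of the sides.\<close>

lemma branch_reaches_top:
  assumes bg: "bigon c d n" and "j < n" and br: "right_branch c d j z"
    and le: "z \<le> c n" and nle: "\<not> z \<le> c (n - 1)" "\<not> z \<le> d (n - 1)"
  shows "\<exists>x. covers x (c n) \<and> z \<le> x \<and>
           incl (d (n - 1)) (c n) < incl x (c n) \<and> incl x (c n) < incl (c (n - 1)) (c n)"
proof -
  let ?v = "c n"
  have sat: "saturated c n" "saturated d n" and ends: "c 0 = d 0" "c n = d n" "n > 0"
    using bg by (auto simp: bigon_def)
  have cov: "covers (c j) z" using br by (simp add: right_branch_def)
  obtain D l where D: "D 0 = c j" "D (Suc 0) = z" "D (Suc l) = ?v" "saturated D (Suc l)"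
    using ex_saturated_via[OF cov le] .
  have "\<rho> ?v = \<rho> (c 0) + n" "\<rho> (c j) = \<rho> (c 0) + j" "\<rho> ?v = \<rho> (D 0) + Suc l"
    using rank_saturated[OF sat(1), of n] rank_saturated[OF sat(1), of j]
      rank_saturated[OF D(4), of "Suc l"] \<open>j < n\<close> D by auto
  then have l: "n = j + Suc l" using D by simp
  have l0: "l \<noteq> 0"
  proof
    assume "l = 0"
    then have "z = c (Suc j)" using D l by simp
    with br show False by (simp add: right_branch_def)
  qed
  have D_c: "D k \<noteq> c a" if "0 < k" "k < Suc l" "a \<le> n" for k a
  proof
    assume e: "D k = c a"
    have "z \<le> D k" using saturated_mono[OF D(4), of "Suc 0" k] that D(2) by simp
    moreover have "a \<noteq> n" using saturated_strict[OF D(4), of k "Suc l"] that D(3) e by auto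
    then have "c a \<le> c (n - 1)" using saturated_mono[OF sat(1), of a "n - 1"] that by simp
    ultimately show False using e nle by auto
  qed
  have D_d: "D k \<noteq> d a" if "0 < k" "k < Suc l" "a \<le> n" for k a
  proof
    assume e: "D k = d a"
    have "z \<le> D k" using saturated_mono[OF D(4), of "Suc 0" k] that D(2) by simp
    moreover have "a \<noteq> n" using saturated_strict[OF D(4), of k "Suc l"] that D(3) e ends by auto
    then have "d a \<le> d (n - 1)" using saturated_mono[OF sat(2), of a "n - 1"] that by simp
    ultimately show False using e nle by auto
  qed
  have "bigon (\<lambda>k. c (j + k)) D (Suc l)"
    unfolding bigon_def
  proof (intro conjI allI impI)
    show "saturated (\<lambda>k. c (j + k)) (Suc l)" using saturated_shift[OF sat(1), of j] l by simp
    fix k k' assume "0 < k" "k < Suc l" "0 < k'" "k' < Suc l"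
    then show "c (j + k) \<noteq> D k'" using D_c[of k' "j + k"] l by simp
  qed (use D l br in \<open>auto simp: right_branch_def\<close>)
  from bigon_top[OF this] have 1: "incl (D l) ?v < incl (c (n - 1)) ?v" using D l by simp
  define ct where "ct = splice_at j c D"
  have ct: "saturated ct n"
    unfolding ct_def l
    by (intro saturated_splice D) (use sat \<open>j < n\<close> D in \<open>auto simp: saturated_def\<close>)
  have ctn: "ct (n - 1) = D l" "ct n = ?v"
    unfolding ct_def using splice_at_right[of c j D] D l
    by (simp_all flip: add_Suc_right)
  have "bigon ct d n"
    unfolding bigon_def
  proof (intro conjI allI impI)
    show "ct 0 = d 0" by (simp add: ct_def splice_at_def ends)
    show "incl (ct 0) (ct 1) < incl (d 0) (d 1)"
      unfolding ct_def by (rule splice_incl[OF bg \<open>j < n\<close> br D(1,2)])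
    fix k k' assume k: "0 < k" "k < n" "0 < k'" "k' < n"
    show "ct k \<noteq> d k'"
    proof (cases "k \<le> j")
      case True
      then show ?thesis using bg k by (simp add: ct_def splice_at_left bigon_def)
    next
      case False
      then show ?thesis using D_d[of "k - j" k'] k l by (simp add: ct_def splice_at_def)
    qed
  qed (use ct sat ends ctn in auto)
  from bigon_top[OF this] have 2: "incl (d (n - 1)) ?v < incl (D l) ?v" using ctn ends by simp
  have "covers (D l) ?v" using saturatedD[OF D(4), of l] D by simp
  moreover have "z \<le> D l" using saturated_mono[OF D(4), of "Suc 0" l] l0 D by simp
  ultimately show ?thesis using 1 2 by blast
qed

text \<open>Both chains follow the upper cover of largest inclination, which is unique by
  \<open>incl_inj_up\<close>. The condition starts at index 1 because the first edge is given. The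
  lengths may differ: the lemma serves to compare a polygon with a chain before their lengths are
  known to match.\<close>

lemma rightmost_chains_agree:
  assumes "saturated c n" "saturated d l" "c 1 = d 1"
    and c: "\<And>j z. 0 < j \<Longrightarrow> j < n \<Longrightarrow> covers (c j) z \<Longrightarrow> incl (c j) z \<le> incl (c j) (c (Suc j))"
    and d: "\<And>j z. 0 < j \<Longrightarrow> j < l \<Longrightarrow> covers (d j) z \<Longrightarrow> incl (d j) z \<le> incl (d j) (d (Suc j))"
    and "1 \<le> k" "k \<le> n" "k \<le> l"
  shows "c k = d k"
  using assms(6-8)
proof (induction k rule: dec_induct)
  case base
  show ?case using assms(3) by simp
next
  case (step k)
  then have eq: "c k = d k" by simp
  have cov: "covers (c k) (c (Suc k))" "covers (d k) (d (Suc k))"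
    using step.prems assms(1,2) by (simp_all add: saturatedD)
  have "incl (c k) (d (Suc k)) \<le> incl (c k) (c (Suc k))" using c[of k "d (Suc k)"] cov eq step by simp
  moreover have "incl (c k) (c (Suc k)) \<le> incl (c k) (d (Suc k))"
    using d[of k "c (Suc k)"] cov eq step by simp
  ultimately show ?case using incl_inj_up cov eq by (metis order.antisym)
qed

end

section \<open>Reflection in a vertical line, which exchanges left and right sides\<close>

definition mirror :: "('a \<Rightarrow> real \<times> real) \<Rightarrow> 'a \<Rightarrow> real \<times> real" where
  "mirror pos a = (- fst (pos a), snd (pos a))"

lemma inclination_mirror [simp]: "inclination (mirror pos) s t = - inclination pos s t"
  by (simp add: inclination_def mirror_def minus_divide_left)

lemma edge_x_mirror [simp]: "edge_x (mirror pos) s t y = - edge_x pos s t y"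
  by (simp add: edge_x_def) (simp add: mirror_def)

lemma snd_mirror [simp]: "snd (mirror pos a) = snd (pos a)"
  by (simp add: mirror_def)

lemma chain_x_mirror [simp]: "chain_x (mirror pos) c n y = - chain_x pos c n y"
  by (induction n) (simp_all, simp add: mirror_def)

lemma consecutive_covers_mirror:
  "consecutive_covers (mirror pos) t u u' \<longleftrightarrow> consecutive_covers pos t u' u"
  by (auto simp: consecutive_covers_def)

lemma planar_mirror:
  assumes "planar_hasse_diagram pos"
  shows "planar_hasse_diagram (mirror pos)"
proof -
  define h :: "real \<times> real \<Rightarrow> real \<times> real" where "h = (\<lambda>p. (- fst p, snd p))"
  have lin: "linear h" unfolding h_def by (intro linearI) auto
  have inj: "inj h" unfolding h_def by (auto simp: inj_def prod_eq_iff)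
  have m: "mirror pos a = h (pos a)" for a by (simp add: mirror_def h_def)
  have seg: "closed_segment (mirror pos s) (mirror pos t) = h ` closed_segment (pos s) (pos t)" for s t
    unfolding m by (rule closed_segment_linear_image[OF lin])
  have im: "mirror pos ` S = h ` pos ` S" for S by (auto simp: m)
  show ?thesis
    unfolding planar_hasse_diagram_def
  proof (intro conjI allI impI)
    have "inj pos" using assms by (simp add: planar_hasse_diagram_def)
    then show "inj (mirror pos)" using inj unfolding inj_def m by blast
    fix s t :: 'a
    show "snd (mirror pos s) < snd (mirror pos t)" if "s < t"
      using assms that by (simp add: planar_hasse_diagram_def)
    show "u = s \<or> u = t"
      if "covers s t \<and> mirror pos u \<in> closed_segment (mirror pos s) (mirror pos t)" for u
      using that assms inj unfolding seg unfolding m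
      by (auto simp: planar_hasse_diagram_def inj_image_mem_iff)
    show "closed_segment (mirror pos s) (mirror pos t) \<inter> closed_segment (mirror pos s') (mirror pos t')
        \<subseteq> mirror pos ` ({s, t} \<inter> {s', t'})"
      if "covers s t \<and> covers s' t' \<and> (s, t) \<noteq> (s', t')" for s' t'
    proof -
      have "closed_segment (pos s) (pos t) \<inter> closed_segment (pos s') (pos t')
        \<subseteq> pos ` ({s, t} \<inter> {s', t'})"
        using assms that unfolding planar_hasse_diagram_def by blast
      then show ?thesis
        unfolding seg im image_Int[OF inj, symmetric] by (rule image_mono)
    qed
  qed
qed

context ranked_diagram
begin

lemma ranked_diagram_mirror: "ranked_diagram (mirror pos) \<rho>"
  by unfold_locales (use planar_mirror[OF planar] rank_less rank_covers in auto)

lemma bigon_mirror: "ranked_diagram.bigon (mirror pos) c d n \<longleftrightarrow> bigon d c n"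
  unfolding ranked_diagram.bigon_def[OF ranked_diagram_mirror] bigon_def
  by (auto simp: eq_commute[of "c _" "d _"])

lemma face_mirror: "ranked_diagram.face (mirror pos) c d n \<longleftrightarrow> face d c n"
  unfolding ranked_diagram.face_def[OF ranked_diagram_mirror] face_def bigon_mirror
  by (auto simp: bigon_def)

end

section \<open>Polygons below two neighbouring lower covers\<close>

lemma ex_min_on:
  fixes f :: "'a \<Rightarrow> real"
  assumes "finite S" "S \<noteq> {}"
  shows "\<exists>x\<in>S. \<forall>y\<in>S. f x \<le> f y"
  using ex_is_arg_min_if_finite[OF assms, of f] by (auto simp: is_arg_min_def not_less)

text \<open>\<open>faces\<close> is the polygon condition after its translation to chains; it yields
  a face only from its bottom corner. The axioms are invariant under \<open>mirror\<close>, so each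
  result about left sides also gives one about right sides.\<close>

locale face_diagram = ranked_diagram +
  fixes b :: nat
  assumes finite_covers: "finite {u. covers t u}"
    and faces: "consecutive_covers pos t u u' \<Longrightarrow>
      \<exists>c d. face c d b \<and> c 0 = t \<and> c 1 = u \<and> d 1 = u'"
begin

lemma rank_le: "s \<le> t \<Longrightarrow> \<rho> s \<le> \<rho> t"
  using rank_less[of s t] by (auto simp: order.order_iff_strict)

lemma face_diagram_mirror: "face_diagram (mirror pos) \<rho> b"
proof -
  interpret M: ranked_diagram "mirror pos" \<rho> by (rule ranked_diagram_mirror)
  show ?thesis
  proof
    fix t u u' :: 'a
    show "finite {u. covers t u}" by (rule finite_covers)
    assume "consecutive_covers (mirror pos) t u u'"
    then obtain c d where "face c d b" "c 0 = t" "c 1 = u'" "d 1 = u"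
      using faces[of t u' u] unfolding consecutive_covers_mirror by blast
    moreover have "d 0 = c 0" using \<open>face c d b\<close> by (simp add: face_def bigon_def)
    ultimately show "\<exists>c d. M.face c d b \<and> c 0 = t \<and> c 1 = u \<and> d 1 = u'"
      by (intro exI[of _ d] exI[of _ c]) (simp add: face_mirror)
  qed
qed

lemma face_left_up:
  assumes "face c d n" "0 < j" "j < n" "covers (d j) z"
  shows "incl (d j) (d (Suc j)) \<le> incl (d j) z"
  using ranked_diagram.face_right_up[OF ranked_diagram_mirror, of d c n j z] assms
  by (simp add: face_mirror)

text \<open>Induction from the top of \<open>c\<close> downwards. The leftmost branch at
  \<open>c j\<close> is consecutive to the edge of \<open>c\<close>, so the two span a face. As
  \<open>c\<close> has no branches higher up, it turns right as sharply as the left side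
  \<open>L\<close> of this face, and \<open>L\<close> follows \<open>c\<close>.\<close>

lemma no_right_branch:
  assumes bg: "bigon c d n"
    and nle: "\<And>j z. j < n \<Longrightarrow> right_branch c d j z \<Longrightarrow> \<not> z \<le> c n"
    and "j < n"
  shows "\<not> right_branch c d j z"
  using \<open>j < n\<close>
proof (induction "n - j" arbitrary: j z rule: less_induct)
  case less
  show ?case
  proof
    assume br: "right_branch c d j z"
    have sat: "saturated c n" using bg by (simp add: bigon_def)
    let ?Z = "{z. right_branch c d j z}"
    have "finite ?Z" using finite_covers[of "c j"] by (auto simp: right_branch_def intro: finite_subset)
    moreover have "?Z \<noteq> {}" using br by blast
    ultimately have "\<exists>z\<in>?Z. \<forall>z'\<in>?Z. incl (c j) z \<le> incl (c j) z'" by (rule ex_min_on)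
    then obtain z where z: "right_branch c d j z"
      "\<And>z'. right_branch c d j z' \<Longrightarrow> incl (c j) z \<le> incl (c j) z'" by auto
    have cov: "covers (c j) (c (Suc j))" using sat less.prems by (simp add: saturatedD)
    have "consecutive_covers pos (c j) (c (Suc j)) z"
      unfolding consecutive_covers_def
    proof (intro conjI notI)
      assume "\<exists>w. covers (c j) w \<and> incl (c j) (c (Suc j)) < incl (c j) w \<and> incl (c j) w < incl (c j) z"
      then obtain w where w: "covers (c j) w" "incl (c j) (c (Suc j)) < incl (c j) w"
        "incl (c j) w < incl (c j) z" by blast
      then have "right_branch c d j w" using z(1) by (auto simp: right_branch_def)
      with z(2)[of w] w show False by simp
    qed (use cov z in \<open>auto simp: right_branch_def\<close>)
    then obtain L R where LR: "face L R b" "L 0 = c j" "L 1 = c (Suc j)" "R 1 = z"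
      using faces by blast
    then have bLR: "bigon L R b" by (simp add: face_def)
    then have satLR: "saturated L b" "saturated R b" "b > 0" "L b = R b" by (auto simp: bigon_def)
    have follow: "L k = c (j + k)" if "1 \<le> k" "k \<le> b" "k \<le> n - j" for k
    proof (rule rightmost_chains_agree[OF satLR(1) saturated_shift[OF sat], of j])
      show "L 1 = c (j + 1)" using LR by simp
      show "incl (L k) z \<le> incl (L k) (L (Suc k))" if "0 < k" "k < b" "covers (L k) z" for k z
        using face_right_up[OF LR(1) that] .
      show "incl (c (j + k)) z \<le> incl (c (j + k)) (c (j + Suc k))"
        if "0 < k" "k < n - j" "covers (c (j + k)) z" for k z
      proof -
        have "\<not> right_branch c d (j + k) z" using that less.hyps[of "j + k" z] by simp
        then show ?thesis using that by (auto simp: right_branch_def)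
      qed
    qed (use that in auto)
    have zL: "z \<le> L b" using saturated_mono[OF satLR(2), of 1 b] satLR LR by simp
    show False
    \<comment> \<open>A face that closes on \<open>c\<close> puts \<open>z\<close> below
      \<open>c n\<close>. A face that follows \<open>c\<close> beyond its end is taller than
      \<open>c n\<close>, against \<open>trapped_below_top\<close>.\<close>
    proof (cases "b \<le> n - j")
      case True
      then have "L b = c (j + b)" using follow[of b] satLR by simp
      then have "L b \<le> c n" using saturated_mono[OF sat, of "j + b" n] True less.prems by simp
      with zL nle[OF less.prems z(1)] show False by simp
    next
      case False
      then have "L (n - j) = c n" using follow[of "n - j"] less.prems by simp
      then have "yc (c n) < yc (L b)" using yc_chain_strict[OF satLR(1), of "n - j" b] False by simp
      moreover have "yc (L b) < yc (c n)"
        using trapped_below_top[OF bg less.prems z(1) nle[OF less.prems z(1)] zL] .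
      ultimately show False by simp
    qed
  qed
qed

text \<open>Rightmost among the chains with prescribed first and last edge: index 0 is left out, and
  competing edges must stay below \<open>c (n - 1)\<close> instead of \<open>c n\<close>.\<close>

definition rightmost_via :: "(nat \<Rightarrow> 'a) \<Rightarrow> nat \<Rightarrow> bool" where
  "rightmost_via c n \<longleftrightarrow> (\<forall>j z. 0 < j \<longrightarrow> j < n \<longrightarrow> covers (c j) z \<longrightarrow>
      incl (c j) (c (Suc j)) < incl (c j) z \<longrightarrow> \<not> z \<le> c (n - 1))"

lemma ex_rightmost_via:
  assumes "covers m a" "a \<le> w" "covers w v"
  shows "\<exists>c n. n \<ge> 2 \<and> saturated c n \<and> c 0 = m \<and> c 1 = a \<and> c (n - 1) = w \<and> c n = v \<and> rightmost_via c n"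
proof -
  obtain c l where c: "c 0 = a" "c l = w" "saturated c l"
     "\<And>j z. j < l \<Longrightarrow> covers (c j) z \<Longrightarrow> incl (c j) (c (Suc j)) < incl (c j) z \<Longrightarrow> \<not> z \<le> w"
    using ex_rightmost_chain[OF assms(2)] finite_covers by auto
  define e where "e k = (if k = 0 then m else if k \<le> Suc l then c (k - 1) else v)" for k
  have "saturated e (Suc (Suc l))"
    unfolding saturated_def
  proof (intro allI impI)
    fix k assume "k < Suc (Suc l)"
    then consider "k = 0" | k' where "k = Suc k'" "k' < l" | "k = Suc l" by (cases k) force+
    then show "covers (e k) (e (Suc k))"
      by cases (use c assms in \<open>auto simp: e_def saturated_def\<close>)
  qed
  moreover have "rightmost_via e (Suc (Suc l))"
    unfolding rightmost_via_def
  proof (intro allI impI)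
    fix j z assume j: "0 < j" "j < Suc (Suc l)" "covers (e j) z" "incl (e j) (e (Suc j)) < incl (e j) z"
    have ew: "e (Suc (Suc l) - 1) = w" by (simp add: e_def c)
    show "\<not> z \<le> e (Suc (Suc l) - 1)"
    proof (cases "j = Suc l")
      case True
      then have "w < z" using j(3) c by (auto simp: e_def covers_def)
      then show ?thesis using ew by (simp add: less_le_not_le)
    next
      case False
      then have "\<not> z \<le> w" using j c(4)[of "j - 1" z] by (auto simp: e_def)
      then show ?thesis using ew by simp
    qed
  qed
  moreover have "e 0 = m" "e 1 = a" "e (Suc (Suc l) - 1) = w" "e (Suc (Suc l)) = v"
    by (simp_all add: e_def c)
  ultimately show ?thesis by (intro exI[of _ e] exI[of _ "Suc (Suc l)"]) auto
qed

text \<open>Verifies the hypothesis of \<open>no_right_branch\<close>. A branch below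
  \<open>c (n - 1)\<close> contradicts \<open>rm\<close>, or \<open>closest\<close> if it starts at
  the bottom. A branch below \<open>d (n - 1)\<close> contradicts \<open>closest\<close> at the
  bottom; higher up it would make \<open>c j\<close> a common lower bound of too large rank. Any
  other branch below the top would by \<open>branch_reaches_top\<close> yield a lower cover that
  \<open>top\<close> excludes.\<close>

lemma no_right_branch_of_closest:
  assumes bg: "bigon c d n" and rm: "rightmost_via c n" and "s \<le> c 0"
    and top: "\<And>z. s \<le> z \<Longrightarrow> covers z (c n) \<Longrightarrow>
        \<not> (incl (d (n - 1)) (c n) < incl z (c n) \<and> incl z (c n) < incl (c (n - 1)) (c n))"
    and max: "\<And>m. s \<le> m \<Longrightarrow> m \<le> c (n - 1) \<Longrightarrow> m \<le> d (n - 1) \<Longrightarrow> \<rho> m \<le> \<rho> (c 0)"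
    and closest: "\<And>z. covers (c 0) z \<Longrightarrow> incl (c 0) (c 1) < incl (c 0) z \<Longrightarrow>
        incl (c 0) z < incl (c 0) (d 1) \<Longrightarrow> \<not> z \<le> c (n - 1) \<and> \<not> z \<le> d (n - 1)"
    and "j < n"
  shows "\<not> right_branch c d j z"
proof (rule no_right_branch[OF bg _ \<open>j < n\<close>])
  fix j z assume j: "j < n" and br: "right_branch c d j z"
  have sat: "saturated c n" using bg by (simp add: bigon_def)
  have cov: "covers (c j) z" using br by (simp add: right_branch_def)
  have "s \<le> c j" using saturated_mono[OF sat, of 0 j] j \<open>s \<le> c 0\<close> by (auto intro: order.trans)
  then have sz: "s \<le> z" using coversD[OF cov] by (auto intro: order.trans)
  have 1: "\<not> z \<le> c (n - 1)"
  proof (cases "j = 0")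
    case True
    then show ?thesis using closest[of z] br by (simp add: right_branch_def)
  next
    case False
    then show ?thesis using rm j br by (auto simp: rightmost_via_def right_branch_def)
  qed
  have 2: "\<not> z \<le> d (n - 1)"
  proof (cases "j = 0")
    case True
    then show ?thesis using closest[of z] br by (simp add: right_branch_def)
  next
    case False
    show ?thesis
    proof
      assume "z \<le> d (n - 1)"
      then have "c j \<le> d (n - 1)" using coversD[OF cov] by (auto intro: order.trans)
      moreover have "c j \<le> c (n - 1)" using saturated_mono[OF sat, of j "n - 1"] j by simp
      ultimately have "\<rho> (c j) \<le> \<rho> (c 0)" using max \<open>s \<le> c j\<close> by blast
      with rank_saturated[OF sat, of j] j False show False by simp
    qed
  qed
  show "\<not> z \<le> c n"
  proof
    assume "z \<le> c n"
    from branch_reaches_top[OF bg j br this 1 2] obtain x where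
      "covers x (c n)" "z \<le> x" "incl (d (n - 1)) (c n) < incl x (c n)"
      "incl x (c n) < incl (c (n - 1)) (c n)" by blast
    with top[of x] sz show False by (auto intro: order.trans)
  qed
qed

text \<open>The rightmost chain through \<open>a\<close> and \<open>w\<close> and the leftmost one
  through \<open>a'\<close> and \<open>w'\<close> form a bigon, because an inner common vertex would
  exceed \<open>m\<close> in rank. As no edge branches off inwards from either side, it coincides
  with the face spanned by \<open>a\<close> and \<open>a'\<close>.\<close>

lemma face_of_closest:
  assumes cov: "covers w v" "covers w' v" and "s \<le> m" and m: "m \<le> w" "m \<le> w'"
    and top: "\<And>z. s \<le> z \<Longrightarrow> covers z v \<Longrightarrow> \<not> (incl w' v < incl z v \<and> incl z v < incl w v)"
    and max: "\<And>m'. s \<le> m' \<Longrightarrow> m' \<le> w \<Longrightarrow> m' \<le> w' \<Longrightarrow> \<rho> m' \<le> \<rho> m"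
    and a: "covers m a" "covers m a'" "a \<le> w" "a' \<le> w'" "incl m a < incl m a'"
    and closest: "\<And>z. covers m z \<Longrightarrow> incl m a < incl m z \<Longrightarrow>
        incl m z < incl m a' \<Longrightarrow> \<not> z \<le> w \<and> \<not> z \<le> w'"
  shows "consecutive_covers pos m a a' \<and> (\<exists>c d. face c d b \<and> c 0 = m \<and> c 1 = a \<and> d 1 = a' \<and>
           c b = v \<and> c (b - 1) = w \<and> d (b - 1) = w')"
proof -
  interpret M: face_diagram "mirror pos" \<rho> b by (rule face_diagram_mirror)
  obtain c n where c: "n \<ge> 2" "saturated c n" "c 0 = m" "c 1 = a" "c (n - 1) = w" "c n = v"
    "rightmost_via c n"
    using ex_rightmost_via[OF a(1,3) cov(1)] by blast
  obtain d l where d: "l \<ge> 2" "saturated d l" "d 0 = m" "d 1 = a'" "d (l - 1) = w'" "d l = v"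
    "M.rightmost_via d l"
    using M.ex_rightmost_via[OF a(2,4) cov(2)] by blast
  have "l = n" using rank_saturated[OF c(2), of n] rank_saturated[OF d(2), of l] c d by simp
  have bg: "bigon c d n"
    unfolding bigon_def
  proof (intro conjI allI impI)
    fix j k assume jk: "0 < j" "j < n" "0 < k" "k < n"
    show "c j \<noteq> d k"
    proof
      assume "c j = d k"
      have "c j \<le> w" using saturated_mono[OF c(2), of j "n - 1"] jk c by simp
      moreover have "d k \<le> w'" using saturated_mono[OF d(2), of k "n - 1"] jk d \<open>l = n\<close> by simp
      moreover have "s \<le> c j"
        using saturated_mono[OF c(2), of 0 j] jk c \<open>s \<le> m\<close> by (auto intro: order.trans)
      ultimately have "\<rho> (c j) \<le> \<rho> m" using max \<open>c j = d k\<close> by simp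
      with rank_saturated[OF c(2), of j] c jk show False by simp
    qed
  qed (use c d a \<open>l = n\<close> in auto)
  have nb: "\<not> right_branch c d j z" if "j < n" for j z
    by (rule no_right_branch_of_closest[OF bg c(7) _ _ _ _ that, where s = s])
      (use \<open>s \<le> m\<close> c d \<open>l = n\<close> top max closest in auto)
  have nb': "\<not> M.right_branch d c j z" if "j < n" for j z
    by (rule M.no_right_branch_of_closest[OF _ _ _ _ _ _ that, where s = s])
      (use \<open>s \<le> m\<close> c d \<open>l = n\<close> top max closest bg in \<open>auto simp: bigon_mirror\<close>)
  have cons: "consecutive_covers pos m a a'"
    unfolding consecutive_covers_def
    using a nb[of 0] c d by (auto simp: right_branch_def)
  obtain L R where LR: "face L R b" "L 0 = m" "L 1 = a" "R 1 = a'" using faces[OF cons] by blast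
  then have bLR: "bigon L R b" by (simp add: face_def)
  then have satLR: "saturated L b" "saturated R b" "b > 0" "L b = R b" "L 0 = R 0"
    by (auto simp: bigon_def)
  have L: "L k = c k" if "1 \<le> k" "k \<le> b" "k \<le> n" for k
  proof (rule rightmost_chains_agree[OF satLR(1) c(2)])
    show "incl (c k) z \<le> incl (c k) (c (Suc k))" if "0 < k" "k < n" "covers (c k) z" for k z
      using nb[of k z] that by (auto simp: right_branch_def)
  qed (use that face_right_up[OF LR(1)] LR c in auto)
  have R: "R k = d k" if "1 \<le> k" "k \<le> b" "k \<le> n" for k
  proof (rule M.rightmost_chains_agree[OF satLR(2) d(2)])
    show "inclination (mirror pos) (d k) z \<le> inclination (mirror pos) (d k) (d (Suc k))"
      if "0 < k" "k < l" "covers (d k) z" for k z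
      using nb'[of k z] that \<open>l = n\<close> by (auto simp: M.right_branch_def)
  qed (use that face_left_up[OF LR(1)] LR d \<open>l = n\<close> in auto)
  \<comment> \<open>A shorter polygon would close at an inner vertex of the bigon, and a longer one
    would have \<open>c n = d n\<close> as an inner vertex of both its sides.\<close>
  have "b = n"
  proof (rule ccontr)
    assume "b \<noteq> n"
    then consider "b < n" | "n < b" by linarith
    then show False
    proof cases
      case 1
      then have "c b = d b" using L[of b] R[of b] satLR by simp
      then show False using bigon_common[OF bg, of b b] 1 satLR by simp
    next
      case 2
      then have "L n = R n" using L[of n] R[of n] c d \<open>l = n\<close> by simp
      then show False using bigon_common[OF bLR, of n n] 2 c by simp
    qed
  qed
  then show ?thesis
    using cons LR L[of n] L[of "n - 1"] R[of "n - 1"] c d \<open>l = n\<close>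
    by (intro conjI exI[of _ L] exI[of _ R]) auto
qed

text \<open>Seen from \<open>v\<close>, a lower cover lies further left if its inclination is larger.\<close>

definition down_gap :: "'a \<Rightarrow> 'a \<Rightarrow> 'a \<Rightarrow> 'a \<Rightarrow> bool" where
  "down_gap s v w w' \<longleftrightarrow> s \<le> w \<and> s \<le> w' \<and> covers w v \<and> covers w' v \<and> incl w' v < incl w v \<and>
     (\<forall>z. s \<le> z \<longrightarrow> covers z v \<longrightarrow> \<not> (incl w' v < incl z v \<and> incl z v < incl w v))"

text \<open>A face as a relation between its two corners, each given by the vertex with its left and
  its right neighbour on the boundary. A corner is exactly a gap to be counted.\<close>

definition face_between :: "'a \<times> 'a \<times> 'a \<Rightarrow> 'a \<times> 'a \<times> 'a \<Rightarrow> bool" where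
  "face_between = (\<lambda>(t, u, u') (v, w, w'). \<exists>c d. face c d b \<and> c 0 = t \<and> c 1 = u \<and> d 1 = u' \<and>
     c b = v \<and> c (b - 1) = w \<and> d (b - 1) = w')"

text \<open>Besides the bottom \<open>m\<close> the first edges have to be chosen. Among the upper
  covers \<open>a\<close> below \<open>w\<close> and \<open>a'\<close> below \<open>w'\<close> a
  pair of smallest distance in inclination is taken, so that no cover in between lies below
  \<open>w\<close> or \<open>w'\<close>.\<close>

lemma ex_face_below:
  assumes "down_gap s v w w'"
  shows "\<exists>t u u'. s \<le> t \<and> consecutive_covers pos t u u' \<and> face_between (t, u, u') (v, w, w')"
proof -
  have g: "s \<le> w" "s \<le> w'" "covers w v" "covers w' v" "incl w' v < incl w v"
    "\<And>z. s \<le> z \<Longrightarrow> covers z v \<Longrightarrow> \<not> (incl w' v < incl z v \<and> incl z v < incl w v)"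
    using assms by (auto simp: down_gap_def)
  have rw: "\<rho> w = \<rho> w'" using rank_covers[OF g(3)] rank_covers[OF g(4)] by simp
  have "\<exists>m. (s \<le> m \<and> m \<le> w \<and> m \<le> w') \<and> (\<forall>m'. s \<le> m' \<and> m' \<le> w \<and> m' \<le> w' \<longrightarrow> \<rho> m' \<le> \<rho> m)"
    by (rule ex_has_greatest_nat[of _ s _ "Suc (\<rho> w)"])
      (use g rank_le in \<open>auto simp: less_Suc_eq_le\<close>)
  then obtain m where m: "s \<le> m" "m \<le> w" "m \<le> w'"
    "\<And>m'. s \<le> m' \<Longrightarrow> m' \<le> w \<Longrightarrow> m' \<le> w' \<Longrightarrow> \<rho> m' \<le> \<rho> m" by blast
  have "w \<noteq> w'" using g(5) by auto
  then have lt: "m < w" "m < w'"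
    using m(2,3) rw rank_less by (metis less_irrefl order.order_iff_strict)+
  \<comment> \<open>It is not yet known which of the two edges is on the left, so the distance
    minimised over this set is an absolute value.\<close>
  let ?S = "{(a, a'). covers m a \<and> covers m a' \<and> a \<le> w \<and> a' \<le> w'}"
  have "?S \<subseteq> {u. covers m u} \<times> {u. covers m u}" by auto
  then have "finite ?S" using finite_covers by (meson finite_SigmaI finite_subset)
  moreover have "?S \<noteq> {}" using ex_upper_cover[OF lt(1)] ex_upper_cover[OF lt(2)] by auto
  ultimately have "\<exists>p\<in>?S. \<forall>q\<in>?S. \<bar>incl m (fst p) - incl m (snd p)\<bar> \<le> \<bar>incl m (fst q) - incl m (snd q)\<bar>"
    by (rule ex_min_on)
  then obtain p where p: "p \<in> ?S"
    "\<And>q. q \<in> ?S \<Longrightarrow> \<bar>incl m (fst p) - incl m (snd p)\<bar> \<le> \<bar>incl m (fst q) - incl m (snd q)\<bar>"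
    by blast
  obtain a a' where pa: "p = (a, a')" by (cases p)
  have a: "covers m a" "covers m a'" "a \<le> w" "a' \<le> w'" using p pa by auto
  have min: "\<bar>incl m a - incl m a'\<bar> \<le> \<bar>incl m z - incl m z'\<bar>"
    if "covers m z" "covers m z'" "z \<le> w" "z' \<le> w'" for z z'
    using p(2)[of "(z, z')"] that pa by simp
  have "a \<noteq> a'"
  proof
    assume "a = a'"
    then have "\<rho> a \<le> \<rho> m" using m(4)[of a] a m(1) coversD[OF a(1)] by (auto intro: order.trans)
    then show False using rank_covers[OF a(1)] by simp
  qed
  then consider "incl m a < incl m a'" | "incl m a' < incl m a"
    using incl_inj_up[OF a(1,2)] by linarith
  then show ?thesis
  proof cases
    case 1
    have "\<not> z \<le> w \<and> \<not> z \<le> w'"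
      if "covers m z" "incl m a < incl m z" "incl m z < incl m a'" for z
      using min[OF that(1) a(2) _ a(4)] min[OF a(1) that(1) a(3)] that by auto
    then have "consecutive_covers pos m a a' \<and>
        (\<exists>c d. face c d b \<and> c 0 = m \<and> c 1 = a \<and> d 1 = a' \<and> c b = v \<and> c (b - 1) = w \<and> d (b - 1) = w')"
      using face_of_closest[OF g(3,4) m(1,2,3) g(6) m(4) a 1] by blast
    then show ?thesis using m(1) unfolding face_between_def prod.case by blast
  next
    \<comment> \<open>With the first edges in the opposite order the same construction gives a face
      whose left side ends in \<open>w'\<close>, and \<open>bigon_top\<close> contradicts the
      inclinations of the gap.\<close>
    case 2
    have "\<not> z \<le> w' \<and> \<not> z \<le> w"
      if "covers m z" "incl m a' < incl m z" "incl m z < incl m a" for z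
      using min[OF that(1) a(2) _ a(4)] min[OF a(1) that(1) a(3)] that by auto
    moreover have "\<not> (incl w v < incl z v \<and> incl z v < incl w' v)" for z using g(5) by simp
    ultimately have "\<exists>c d. face c d b \<and> c 0 = m \<and> c 1 = a' \<and> d 1 = a \<and> c b = v \<and> c (b - 1) = w' \<and> d (b - 1) = w"
      using face_of_closest[OF g(4,3) m(1,3,2) _ _ a(2,1,4,3) 2] m(4) by blast
    then obtain c d where cd: "face c d b" "c b = v" "c (b - 1) = w'" "d (b - 1) = w" by blast
    then have "bigon c d b" "d b = v" by (auto simp: face_def bigon_def)
    from bigon_top[OF this(1)] cd \<open>d b = v\<close> g(5) show ?thesis by simp
  qed
qed

end

section \<open>Counting the elements of a given rank\<close>

text \<open>A new maximum creates exactly one new pair, with the previous maximum. On the empty set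
  truncated subtraction gives the right value 0.\<close>

lemma card_consecutive_pairs:
  fixes f :: "'a \<Rightarrow> real"
  assumes "finite S" "inj_on f S"
  shows "card {(x, y). x \<in> S \<and> y \<in> S \<and> f x < f y \<and> \<not> (\<exists>z\<in>S. f x < f z \<and> f z < f y)} = card S - 1"
  using assms
proof (induction S rule: finite_ranking_induct[where f = f])
  case empty
  then show ?case by simp
next
  case (insert x S)
  let ?P = "\<lambda>S. {(x, y). x \<in> S \<and> y \<in> S \<and> f x < f y \<and> \<not> (\<exists>z\<in>S. f x < f z \<and> f z < f y)}"
  have inj: "inj_on f S" using insert.prems by simp
  show ?case
  proof (cases "x \<in> S \<or> S = {}")
    case True
    then show ?thesis
    proof
      assume "x \<in> S"
      then have "insert x S = S" by blast
      then show ?thesis using insert.IH[OF inj] by simp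
    next
      assume "S = {}"
      then have "?P (insert x S) = {}" by auto
      then show ?thesis using \<open>S = {}\<close> by (simp only: card.empty) simp
    qed
  next
    case False
    have lt: "f y < f x" if "y \<in> S" for y
    proof -
      have "f y \<noteq> f x" using insert.prems that False by (metis inj_onD insertI1 insertI2)
      with insert.hyps(2)[OF that] show ?thesis by simp
    qed
    have "\<exists>m\<in>S. \<forall>y\<in>S. - f m \<le> - f y" by (rule ex_min_on) (use insert False in auto)
    then obtain m where m: "m \<in> S" "\<And>y. y \<in> S \<Longrightarrow> f y \<le> f m" by auto
    have eq: "?P (insert x S) = insert (m, x) (?P S)"
    proof (intro equalityI subsetI)
      fix p assume p: "p \<in> ?P (insert x S)"
      obtain y z where yz: "p = (y, z)" by (cases p)
      have h: "y \<in> insert x S" "z \<in> insert x S" "f y < f z"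
        "\<not> (\<exists>w\<in>insert x S. f y < f w \<and> f w < f z)" using p yz by auto
      have "y \<in> S" using h lt by (metis insertE order.asym order_less_irrefl)
      show "p \<in> insert (m, x) (?P S)"
      proof (cases "z = x")
        case True
        then have "f m \<le> f y" using h(4) m(1) lt[OF m(1)] by (meson insertCI not_less)
        then have "y = m" using m \<open>y \<in> S\<close> inj by (metis inj_on_eq_iff order.antisym)
        then show ?thesis using yz True by simp
      next
        case False
        then show ?thesis using h yz \<open>y \<in> S\<close> by auto
      qed
    next
      fix p assume "p \<in> insert (m, x) (?P S)"
      then show "p \<in> ?P (insert x S)"
      proof
        assume "p = (m, x)"
        then show ?thesis using m lt by (auto simp: not_less)
      next
        assume "p \<in> ?P S"
        then show ?thesis using lt by (auto dest: order.strict_trans)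
      qed
    qed
    have "finite (?P S)" by (rule finite_subset[of _ "S \<times> S"]) (use insert in auto)
    moreover have "(m, x) \<notin> ?P S" using False by auto
    moreover have "card S > 0" using False insert(1) by (simp add: card_gt_0_iff)
    ultimately show ?thesis unfolding eq using insert.IH[OF inj] False insert(1) by simp
  qed
qed

lemma bij_rel_card:
  assumes "\<And>x. x \<in> A \<Longrightarrow> \<exists>y\<in>B. r x y" "\<And>y. y \<in> B \<Longrightarrow> \<exists>x\<in>A. r x y"
    and "\<And>x y y'. r x y \<Longrightarrow> r x y' \<Longrightarrow> y = y'" "\<And>x x' y. r x y \<Longrightarrow> r x' y \<Longrightarrow> x = x'"
  shows "card A = card B"
proof -
  obtain g where g: "\<And>x. x \<in> A \<Longrightarrow> g x \<in> B \<and> r x (g x)" using assms(1) by metis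
  have "inj_on g A" using g assms(4) by (metis inj_onI)
  moreover have "g ` A = B" using g assms(2,3) by blast
  ultimately show ?thesis by (metis card_image)
qed

context face_diagram
begin

lemma face_chains_determined_up:
  assumes "face c d b" "face c' d' b" "c 1 = c' 1" "1 \<le> k" "k \<le> b"
  shows "c k = c' k"
proof (rule rightmost_chains_agree)
  show "saturated c b" "saturated c' b" using assms by (auto simp: face_def bigon_def)
qed (use assms face_right_up in auto)

text \<open>By \<open>face_right_down\<close> the left side takes an extremal edge at every inner
  vertex also when followed downwards, and \<open>incl_inj_down\<close> makes that edge
  unique.\<close>

lemma face_chains_determined_down:
  assumes f: "face c d b" "face c' d' b" and eq: "c (b - 1) = c' (b - 1)" and "k \<le> b - 1"
  shows "c k = c' k"
  using assms(4)
proof (induction k rule: inc_induct)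
  case base
  show ?case by (rule eq)
next
  case (step k)
  have sat: "saturated c b" "saturated c' b" using f by (auto simp: face_def bigon_def)
  have k: "0 < Suc k" "Suc k < b" using step.hyps by auto
  have cov: "covers (c k) (c (Suc k))" "covers (c' k) (c' (Suc k))"
    using sat k by (auto simp: saturated_def)
  have "incl (c k) (c (Suc k)) = incl (c' k) (c (Suc k))"
    using face_right_down[OF f(1) k, of "c' k"] face_right_down[OF f(2) k, of "c k"] cov step.IH
    by simp
  then show ?case using incl_inj_down cov step.IH by metis
qed

lemma face_between_unique:
  assumes "face_between p q" "face_between p q'"
  shows "q = q'"
proof -
  interpret M: face_diagram "mirror pos" \<rho> b by (rule face_diagram_mirror)
  obtain t u u' v w w' v1 w1 w1' where [simp]: "p = (t, u, u')" "q = (v, w, w')" "q' = (v1, w1, w1')"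
    by (metis prod_cases3)
  obtain c d where c: "face c d b" "c 1 = u" "d 1 = u'" "c b = v" "c (b - 1) = w" "d (b - 1) = w'"
    using assms(1) by (auto simp: face_between_def)
  obtain c' d' where c': "face c' d' b" "c' 1 = u" "d' 1 = u'" "c' b = v1" "c' (b - 1) = w1" "d' (b - 1) = w1'"
    using assms(2) by (auto simp: face_between_def)
  have b: "b \<ge> 2" using c(1) bigon_ge_2 by (auto simp: face_def)
  have "c k = c' k" "d k = d' k" if "1 \<le> k" "k \<le> b" for k
    using face_chains_determined_up[of c d c' d' k] M.face_chains_determined_up[of d c d' c' k] c c' that
    by (auto simp: face_mirror)
  from this[of b] this[of "b - 1"] show ?thesis using c c' b by auto
qed

lemma face_between_inj:
  assumes "face_between p q" "face_between p' q"
  shows "p = p'"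
proof -
  interpret M: face_diagram "mirror pos" \<rho> b by (rule face_diagram_mirror)
  obtain t u u' v w w' t1 u1 u1' where [simp]: "p = (t, u, u')" "q = (v, w, w')" "p' = (t1, u1, u1')"
    by (metis prod_cases3)
  obtain c d where c: "face c d b" "c 0 = t" "c 1 = u" "d 1 = u'" "c (b - 1) = w" "d (b - 1) = w'"
    using assms(1) by (auto simp: face_between_def)
  obtain c' d' where c': "face c' d' b" "c' 0 = t1" "c' 1 = u1" "d' 1 = u1'" "c' (b - 1) = w" "d' (b - 1) = w'"
    using assms(2) by (auto simp: face_between_def)
  have b: "b \<ge> 2" using c(1) bigon_ge_2 by (auto simp: face_def)
  have "c k = c' k" "d k = d' k" if "k \<le> b - 1" for k
    using face_chains_determined_down[of c d c' d' k] M.face_chains_determined_down[of d c d' c' k] c c' that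
    by (auto simp: face_mirror)
  from this[of 0] this[of 1] show ?thesis using c c' b by auto
qed

lemma ex_face_above:
  assumes "consecutive_covers pos t u u'" "s \<le> t"
  shows "\<exists>v w w'. face_between (t, u, u') (v, w, w') \<and> down_gap s v w w'"
proof -
  obtain c d where cd: "face c d b" "c 0 = t" "c 1 = u" "d 1 = u'" using faces[OF assms(1)] by blast
  then have bg: "bigon c d b" by (simp add: face_def)
  then have b: "saturated c b" "saturated d b" "b > 0" "c 0 = d 0" "c b = d b" by (auto simp: bigon_def)
  have "down_gap s (c b) (c (b - 1)) (d (b - 1))"
    unfolding down_gap_def
  proof (intro conjI allI impI)
    show "s \<le> c (b - 1)" "s \<le> d (b - 1)"
      using saturated_mono[OF b(1), of 0 "b - 1"] saturated_mono[OF b(2), of 0 "b - 1"] b cd assms(2)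
      by (auto intro: order.trans)
    show "covers (c (b - 1)) (c b)" "covers (d (b - 1)) (c b)"
      using saturatedD[OF b(1), of "b - 1"] saturatedD[OF b(2), of "b - 1"] b by auto
    show "incl (d (b - 1)) (c b) < incl (c (b - 1)) (c b)" using bigon_top[OF bg] b by simp
    fix z assume "covers z (c b)"
    then show "\<not> (incl (d (b - 1)) (c b) < incl z (c b) \<and> incl z (c b) < incl (c (b - 1)) (c b))"
      using face_top_consecutive[OF cd(1)] by blast
  qed
  moreover have "face_between (t, u, u') (c b, c (b - 1), d (b - 1))"
    using cd by (auto simp: face_between_def)
  ultimately show ?thesis by blast
qed

lemma face_between_rank:
  assumes "face_between (t, u, u') (v, w, w')"
  shows "t \<le> v" "\<rho> v = \<rho> t + b"
proof -
  obtain c d where "face c d b" and c: "c 0 = t" "c b = v"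
    using assms by (auto simp: face_between_def)
  then have "saturated c b" by (simp add: face_def bigon_def)
  from saturated_mono[OF this, of 0 b] rank_saturated[OF this, of b] c
  show "t \<le> v" "\<rho> v = \<rho> t + b" by auto
qed

definition upper_level :: "'a \<Rightarrow> nat \<Rightarrow> 'a set" where
  "upper_level s n = {t. s \<le> t \<and> \<rho> t = \<rho> s + n}"

lemma upper_level_0: "upper_level s 0 = {s}"
proof -
  have "t = s" if "s \<le> t" "\<rho> t = \<rho> s" for t
    using rank_less[of s t] that by (auto simp: order.order_iff_strict)
  then show ?thesis by (auto simp: upper_level_def)
qed

definition up_gaps :: "'a \<Rightarrow> nat \<Rightarrow> ('a \<times> 'a \<times> 'a) set" where
  "up_gaps s n = {(t, u, u'). t \<in> upper_level s n \<and> consecutive_covers pos t u u'}"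

definition down_gaps :: "'a \<Rightarrow> nat \<Rightarrow> ('a \<times> 'a \<times> 'a) set" where
  "down_gaps s n = {(v, w, w'). v \<in> upper_level s n \<and> down_gap s v w w'}"

lemma card_gaps: "card (up_gaps s n) = card (down_gaps s (n + b))"
proof (rule bij_rel_card[of _ _ face_between])
  fix x assume "x \<in> up_gaps s n"
  then obtain t u u' where x: "x = (t, u, u')" "s \<le> t" "\<rho> t = \<rho> s + n" "consecutive_covers pos t u u'"
    by (auto simp: up_gaps_def upper_level_def)
  obtain v w w' where v: "face_between x (v, w, w')" "down_gap s v w w'"
    using ex_face_above[OF x(4,2)] x(1) by blast
  then have "(v, w, w') \<in> down_gaps s (n + b)"
    using face_between_rank[of t u u' v w w'] x
    by (auto simp: down_gaps_def upper_level_def intro: order.trans)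
  with v show "\<exists>y\<in>down_gaps s (n + b). face_between x y" by blast
next
  fix y assume "y \<in> down_gaps s (n + b)"
  then obtain v w w' where y: "y = (v, w, w')" "\<rho> v = \<rho> s + (n + b)" "down_gap s v w w'"
    by (auto simp: down_gaps_def upper_level_def)
  obtain t u u' where t: "s \<le> t" "consecutive_covers pos t u u'" "face_between (t, u, u') y"
    using ex_face_below[OF y(3)] y(1) by blast
  then have "(t, u, u') \<in> up_gaps s n"
    using face_between_rank[of t u u' v w w'] y by (auto simp: up_gaps_def upper_level_def)
  with t show "\<exists>x\<in>up_gaps s n. face_between x y" by blast
qed (erule (1) face_between_unique, erule (1) face_between_inj)

text \<open>The polygon below a gap has its bottom above \<open>s\<close> and spans \<open>b\<close>
  ranks.\<close>

lemma down_gaps_low: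
  assumes "n < b"
  shows "down_gaps s n = {}"
proof (rule ccontr)
  assume "down_gaps s n \<noteq> {}"
  then obtain v w w' where y: "\<rho> v = \<rho> s + n" "down_gap s v w w'"
    by (auto simp: down_gaps_def upper_level_def)
  obtain t u u' where t: "s \<le> t" "face_between (t, u, u') (v, w, w')"
    using ex_face_below[OF y(2)] by blast
  then have "\<rho> s \<le> \<rho> t" "\<rho> v = \<rho> t + b" using face_between_rank rank_le by blast+
  with y assms show False by simp
qed

lemma card_up_gaps:
  assumes "\<And>t::'a. card {u. covers t u} = i" "finite (upper_level s n)"
  shows "card (up_gaps s n) = (i - 1) * card (upper_level s n)"
proof -
  have "card {(u, u'). consecutive_covers pos t u u'} = i - 1" for t
  proof -
    have "inj_on (incl t) {u. covers t u}" using incl_inj_up by (auto simp: inj_on_def)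
    from card_consecutive_pairs[OF finite_covers this] assms(1)[of t] show ?thesis
      by (simp add: consecutive_covers_def conj_assoc)
  qed
  moreover have "up_gaps s n = Sigma (upper_level s n) (\<lambda>t. {(u, u'). consecutive_covers pos t u u'})"
    by (auto simp: up_gaps_def)
  moreover have "finite {(u, u'). consecutive_covers pos t u u'}" for t
    by (rule finite_subset[of _ "{u. covers t u} \<times> {u. covers t u}"])
      (auto simp: consecutive_covers_def finite_covers)
  ultimately show ?thesis using assms(2) by simp
qed

text \<open>Double counting of the edges between two successive levels of the filter:
  \<open>i\<close> edges leave each element of the lower level, and an element of the upper level
  receives one more than it has gaps, since it has at least one lower cover above
  \<open>s\<close>.\<close>

lemma upper_level_step:
  assumes deg: "\<And>t::'a. card {u. covers t u} = i"
    and fin: "\<And>n. finite (upper_level s n)"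
  shows "i * card (upper_level s n) = card (upper_level s (Suc n)) + card (down_gaps s (Suc n))"
proof -
  let ?U = "upper_level s"
  define D where "D v = {w. s \<le> w \<and> covers w v}" for v
  have finD: "finite (D v)" and D_ne: "D v \<noteq> {}" if "v \<in> ?U (Suc n)" for v
  proof -
    have "D v \<subseteq> ?U n" using that rank_covers by (fastforce simp: D_def upper_level_def)
    then show "finite (D v)" using fin finite_subset by blast
    have "s < v" using that by (auto simp: upper_level_def order.order_iff_strict)
    then show "D v \<noteq> {}" using ex_lower_cover by (auto simp: D_def)
  qed
  have gaps: "card {(w, w'). down_gap s v w w'} = card (D v) - 1" if "v \<in> ?U (Suc n)" for v
  proof -
    have "inj_on (\<lambda>w. - incl w v) (D v)" using incl_inj_down by (auto simp: inj_on_def D_def)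
    moreover have "{(w, w'). down_gap s v w w'} = {(x, y). x \<in> D v \<and> y \<in> D v \<and> - incl x v < - incl y v \<and>
        \<not> (\<exists>z\<in>D v. - incl x v < - incl z v \<and> - incl z v < - incl y v)}"
      by (auto simp: down_gap_def D_def)
    ultimately show ?thesis
      using card_consecutive_pairs[OF finD[OF that], of "\<lambda>w. - incl w v"] by simp
  qed
  have "i * card (?U n) = card (Sigma (?U n) (\<lambda>t. {u. covers t u}))"
    using fin finite_covers deg by simp
  also have "\<dots> = card (Sigma (?U (Suc n)) D)"
  proof (rule bij_betw_same_card[of prod.swap])
    have "prod.swap ` Sigma (?U n) (\<lambda>t. {u. covers t u}) = Sigma (?U (Suc n)) D"
    proof (intro equalityI subsetI)
      fix p assume "p \<in> prod.swap ` Sigma (?U n) (\<lambda>t. {u. covers t u})"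
      then obtain t u where "p = (u, t)" "t \<in> ?U n" "covers t u" by auto
      then show "p \<in> Sigma (?U (Suc n)) D"
        using rank_covers[of t u] coversD[of t u] by (auto simp: D_def upper_level_def)
    next
      fix p assume "p \<in> Sigma (?U (Suc n)) D"
      then obtain v w where p: "p = (v, w)" "v \<in> ?U (Suc n)" "s \<le> w" "covers w v" by (auto simp: D_def)
      then have "(w, v) \<in> Sigma (?U n) (\<lambda>t. {u. covers t u})"
        using rank_covers[of w v] by (auto simp: upper_level_def)
      then show "p \<in> prod.swap ` Sigma (?U n) (\<lambda>t. {u. covers t u})" using p(1) by force
    qed
    then show "bij_betw prod.swap (Sigma (?U n) (\<lambda>t. {u. covers t u})) (Sigma (?U (Suc n)) D)"
      by (intro bij_betw_imageI) auto
  qed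
  also have "\<dots> = (\<Sum>v\<in>?U (Suc n). card (D v))"
    using fin finD by simp
  also have "\<dots> = (\<Sum>v\<in>?U (Suc n). 1 + card {(w, w'). down_gap s v w w'})"
  proof (rule sum.cong)
    fix v assume v: "v \<in> ?U (Suc n)"
    then have "card (D v) > 0" using finD D_ne by (simp add: card_gt_0_iff)
    then show "card (D v) = 1 + card {(w, w'). down_gap s v w w'}" using gaps[OF v] by simp
  qed simp
  also have "\<dots> = card (?U (Suc n)) + (\<Sum>v\<in>?U (Suc n). card {(w, w'). down_gap s v w w'})"
    by (subst sum.distrib) simp
  also have "(\<Sum>v\<in>?U (Suc n). card {(w, w'). down_gap s v w w'}) = card (down_gaps s (Suc n))"
  proof -
    have "down_gaps s (Suc n) = Sigma (?U (Suc n)) (\<lambda>v. {(w, w'). down_gap s v w w'})"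
      by (auto simp: down_gaps_def)
    moreover have "finite {(w, w'). down_gap s v w w'}" if "v \<in> ?U (Suc n)" for v
      by (rule finite_subset[of _ "D v \<times> D v"]) (use finD that in \<open>auto simp: D_def down_gap_def\<close>)
    ultimately show ?thesis using fin by simp
  qed
  finally show ?thesis .
qed

lemma upper_level_recurrence:
  assumes "\<And>t::'a. card {u. covers t u} = i" "\<And>n. finite (upper_level s n)"
  shows "i * card (upper_level s n) = card (upper_level s (Suc n)) +
     (if Suc n < b then 0 else (i - 1) * card (upper_level s (Suc n - b)))"
proof (cases "Suc n < b")
  case True
  then show ?thesis using upper_level_step[OF assms, of n] down_gaps_low[OF True, of s] by simp
next
  case False
  then have "card (down_gaps s (Suc n)) = (i - 1) * card (upper_level s (Suc n - b))"
    using card_gaps[of s "Suc n - b"] card_up_gaps[OF assms, of "Suc n - b"] by simp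
  then show ?thesis using upper_level_step[OF assms, of n] False by simp
qed

end

section \<open>Empty polygons are faces\<close>

context ranked_diagram
begin

text \<open>The open set \<open>V\<close> between the chains and the open set \<open>W\<close>
  around them are disjoint and cover the complement of \<open>H\<close>. So the component of a point
  of \<open>V\<close> stays in \<open>V\<close>, which is bounded. This is the only half of the
  Jordan curve theorem that enters.\<close>

lemma inside_bigon:
  assumes bg: "bigon c d n"
    and H_on: "\<And>x y. (x, y) \<in> H \<Longrightarrow> x = chain_x pos c n y \<or> x = chain_x pos d n y"
    and H_c: "\<And>k. k < n \<Longrightarrow> closed_segment (pos (c k)) (pos (c (Suc k))) \<subseteq> H"
    and H_d: "\<And>k. k < n \<Longrightarrow> closed_segment (pos (d k)) (pos (d (Suc k))) \<subseteq> H"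
    and y: "yc (c 0) < y" "y < yc (c n)" and x: "chain_x pos c n y < x" "x < chain_x pos d n y"
  shows "(x, y) \<in> inside H"
proof -
  have b: "saturated c n" "saturated d n" "n > 0" "c 0 = d 0" "c n = d n"
    using bg by (auto simp: bigon_def)
  let ?f = "chain_x pos c n" and ?g = "chain_x pos d n"
  note cont = chain_x_continuous[OF b(1)] chain_x_continuous[OF b(2)]
  have on_H: "(chain_x pos e n y, y) \<in> H"
    if e: "saturated e n" "\<And>k. k < n \<Longrightarrow> closed_segment (pos (e k)) (pos (e (Suc k))) \<subseteq> H"
      "yc (e 0) \<le> y" "y \<le> yc (e n)" for e y
  proof -
    obtain k where k: "k < n" "yc (e k) \<le> y" "y \<le> yc (e (Suc k))"
      using ex_chain_edge[of e y n] e b by blast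
    then have "(chain_x pos e n y, y) \<in> closed_segment (pos (e k)) (pos (e (Suc k)))"
      using chain_x_edge[OF e(1) k] saturatedD[OF e(1) k(1)] by (simp add: mem_edge_iff)
    with e(2)[OF k(1)] show ?thesis by blast
  qed
  have cont': "continuous_on UNIV (\<lambda>p. ?f (snd p))" "continuous_on UNIV (\<lambda>p. ?g (snd p))"
    by (auto intro!: continuous_on_compose2[OF cont(1)] continuous_on_compose2[OF cont(2)] continuous_intros)
  define V :: "(real \<times> real) set" where "V = {p. yc (c 0) < snd p} \<inter> {p. snd p < yc (c n)} \<inter>
    {p. ?f (snd p) < fst p} \<inter> {p. fst p < ?g (snd p)}"
  define W :: "(real \<times> real) set" where "W = {p. snd p < yc (c 0)} \<union> {p. yc (c n) < snd p} \<union>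
    {p. fst p < ?f (snd p)} \<union> {p. ?g (snd p) < fst p}"
  have oV: "open V" unfolding V_def
    by (intro open_Int open_Collect_less continuous_intros cont')
  have oW: "open W" unfolding W_def
    by (intro open_Un open_Collect_less continuous_intros cont')
  have "V \<inter> W = {}" by (auto simp: V_def W_def)
  have cover: "p \<in> V \<union> W" if "p \<notin> H" for p
  proof (rule ccontr)
    assume "p \<notin> V \<union> W"
    obtain x y where p: "p = (x, y)" by (cases p)
    have h: "yc (c 0) \<le> y" "y \<le> yc (c n)" "?f y \<le> x" "x \<le> ?g y" "p \<notin> V"
      using \<open>p \<notin> V \<union> W\<close> p by (auto simp: W_def)
    have "(?f y, y) \<in> H" "(?g y, y) \<in> H" using on_H b h H_c H_d by auto
    moreover have "x = ?f y \<or> x = ?g y"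
    proof (rule ccontr)
      assume ne: "\<not> ?thesis"
      then have "?f y < ?g y" using h by simp
      then have "y \<noteq> yc (c 0)" "y \<noteq> yc (c n)"
        using chain_x_vertex[OF b(1), of 0] chain_x_vertex[OF b(2), of 0]
          chain_x_vertex[OF b(1), of n] chain_x_vertex[OF b(2), of n] b by auto
      then have "p \<in> V" using h ne p by (auto simp: V_def)
      with h show False by simp
    qed
    ultimately show False using that p by auto
  qed
  have pV: "(x, y) \<in> V" using x y by (simp add: V_def)
  have pH: "(x, y) \<notin> H" using H_on x by fastforce
  define K where "K = connected_component_set (- H) (x, y)"
  have "connected K" "K \<subseteq> - H" "(x, y) \<in> K"
    using pH by (auto simp: K_def connected_component_refl_eq dest: connected_component_in)
  then have "K \<subseteq> V \<union> W" using cover by blast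
  have "V \<inter> K = {} \<or> W \<inter> K = {}"
    using connectedD[OF \<open>connected K\<close> oV oW] \<open>V \<inter> W = {}\<close> \<open>K \<subseteq> V \<union> W\<close> by blast
  then have "K \<subseteq> V" using pV \<open>(x, y) \<in> K\<close> \<open>K \<subseteq> V \<union> W\<close> by blast
  have "bounded V"
  proof -
    let ?I = "{yc (c 0)..yc (c n)}"
    have "compact (?f ` ?I)" "compact (?g ` ?I)"
      using cont by (auto intro!: compact_continuous_image intro: continuous_on_subset)
    then have "bounded (?f ` ?I \<union> ?g ` ?I)" by (simp add: compact_imp_bounded)
    then obtain B where B: "\<And>z. z \<in> ?f ` ?I \<union> ?g ` ?I \<Longrightarrow> \<bar>z\<bar> \<le> B" by (auto simp: bounded_iff)
    have "V \<subseteq> {-B..B} \<times> ?I"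
    proof
      fix p assume p: "p \<in> V"
      then have "snd p \<in> ?I" by (auto simp: V_def)
      then have "\<bar>?f (snd p)\<bar> \<le> B" "\<bar>?g (snd p)\<bar> \<le> B" using B by blast+
      then have "fst p \<in> {-B..B}" using p by (auto simp: V_def)
      with \<open>snd p \<in> ?I\<close> show "p \<in> {-B..B} \<times> ?I" by (simp add: mem_Times_iff)
    qed
    moreover have "bounded ({-B..B} \<times> ?I)" by (intro bounded_Times) auto
    ultimately show ?thesis using bounded_subset by blast
  qed
  then have "bounded K" using \<open>K \<subseteq> V\<close> bounded_subset by blast
  then show ?thesis using pH by (simp add: inside_def K_def)
qed

text \<open>The witness of \<open>polygon_interval\<close> as a function, so that the cycle can be
  traversed in the opposite direction.\<close>

definition cycle_enum :: "(nat \<Rightarrow> 'a) \<Rightarrow> nat \<Rightarrow> 'a \<Rightarrow> 'a \<Rightarrow> bool" where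
  "cycle_enum g b t v \<longleftrightarrow> inj_on g {..<2 * b} \<and> g ` {..<2 * b} = {t..v} \<and> g 0 = t \<and> g b = v \<and>
     (\<forall>j<2 * b. \<forall>k<2 * b. (covers (g j) (g k) \<or> covers (g k) (g j)) \<longleftrightarrow>
        (k = Suc j mod (2 * b) \<or> j = Suc k mod (2 * b)))"

text \<open>The first half of the cycle climbs: \<open>g (Suc k)\<close>, if still below
  \<open>v\<close>, has an upper cover in the interval, which is one of its two neighbours on the
  cycle. As \<open>g k\<close> lies below it, this is the next vertex.\<close>

lemma cycle_enum_saturated:
  assumes g: "cycle_enum g b t v" and "b \<ge> 2"
  shows "saturated g b"
  unfolding saturated_def
proof (intro allI impI)
  fix k assume "k < b"
  have inj: "inj_on g {..<2 * b}" and im: "g ` {..<2 * b} = {t..v}" and ends: "g 0 = t" "g b = v"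
    and adj: "\<And>j k. j < 2 * b \<Longrightarrow> k < 2 * b \<Longrightarrow> (covers (g j) (g k) \<or> covers (g k) (g j)) \<longleftrightarrow>
        (k = Suc j mod (2 * b) \<or> j = Suc k mod (2 * b))"
    using g by (auto simp: cycle_enum_def)
  have mem: "t \<le> g k" "g k \<le> v" if "k < 2 * b" for k using im that by auto
  show "covers (g k) (g (Suc k))"
    using \<open>k < b\<close>
  proof (induction k)
    case 0
    have "covers (g 0) (g 1) \<or> covers (g 1) (g 0)" using adj[of 0 1] \<open>b \<ge> 2\<close> by simp
    moreover have "\<not> covers (g 1) (g 0)" using mem(1)[of 1] \<open>b \<ge> 2\<close> ends by (auto simp: covers_def)
    ultimately show ?case by simp
  next
    case (Suc k)
    then have prev: "covers (g k) (g (Suc k))" by simp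
    have "g (Suc k) \<noteq> g b" using inj Suc.prems by (auto dest!: inj_onD)
    then have "g (Suc k) < v" using mem(2)[of "Suc k"] Suc.prems ends by simp
    then obtain z where z: "covers (g (Suc k)) z" "z \<le> v" using ex_upper_cover by blast
    then have "t \<le> z" using mem(1)[of "Suc k"] Suc.prems coversD[OF z(1)] by (auto intro: order.trans)
    then obtain j where j: "j < 2 * b" "z = g j" using im z(2) by (metis atLeastAtMost_iff image_iff lessThan_iff)
    have "j = Suc (Suc k) mod (2 * b) \<or> Suc k = Suc j mod (2 * b)"
      using adj[of "Suc k" j] z(1) j Suc.prems by simp
    moreover have "Suc k \<noteq> Suc j mod (2 * b)"
    proof
      assume "Suc k = Suc j mod (2 * b)"
      then have "j = k" using j by (cases "Suc j = 2 * b") auto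
      with z j prev show False by (auto simp: covers_def)
    qed
    ultimately show ?case using z j Suc.prems by simp
  qed
qed

lemma Suc_mod_eq: "j < n \<Longrightarrow> Suc j mod n = (if Suc j = n then 0 else Suc j)"
  by auto

text \<open>The index \<open>k\<close> is replaced by \<open>- k\<close> modulo
  \<open>2 * b\<close>. This preserves adjacency and fixes 0 and \<open>b\<close>, hence bottom and
  top.\<close>

lemma cycle_enum_reverse:
  assumes g: "cycle_enum g b t v" and "b \<ge> 2"
  shows "cycle_enum (\<lambda>k. g (if k = 0 then 0 else 2 * b - k)) b t v"
proof -
  define r where "r k = (if k = 0 then 0 else 2 * b - k)" for k
  have r_lt: "r k < 2 * b" if "k < 2 * b" for k using that by (auto simp: r_def)
  have rr: "r (r k) = k" if "k < 2 * b" for k using that by (auto simp: r_def)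
  have r_suc: "r k = Suc (r j) mod (2 * b) \<longleftrightarrow> j = Suc k mod (2 * b)" if "j < 2 * b" "k < 2 * b" for j k
    using that r_lt[OF that(1)] by (auto simp: Suc_mod_eq r_def split: if_splits)
  have "inj_on r {..<2 * b}" by (rule inj_on_inverseI[of _ r]) (use rr in auto)
  moreover have "r ` {..<2 * b} = {..<2 * b}"
  proof (intro equalityI subsetI)
    fix k assume "k \<in> {..<2 * b}"
    then show "k \<in> r ` {..<2 * b}" using rr[of k] r_lt[of k] by (metis image_iff lessThan_iff)
  qed (use r_lt in auto)
  ultimately have "inj_on (\<lambda>k. g (r k)) {..<2 * b}" "(\<lambda>k. g (r k)) ` {..<2 * b} = {t..v}"
    using g comp_inj_on[of r "{..<2 * b}" g] image_comp[of g r "{..<2 * b}"]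
    by (auto simp: cycle_enum_def comp_def)
  moreover have "r 0 = 0" "r b = b" using \<open>b \<ge> 2\<close> by (auto simp: r_def)
  moreover have "(covers (g (r j)) (g (r k)) \<or> covers (g (r k)) (g (r j))) \<longleftrightarrow>
        (k = Suc j mod (2 * b) \<or> j = Suc k mod (2 * b))" if "j < 2 * b" "k < 2 * b" for j k
    using g r_lt[OF that(1)] r_lt[OF that(2)] r_suc[OF that] r_suc[OF that(2,1)]
    unfolding cycle_enum_def by blast
  ultimately show ?thesis using g unfolding cycle_enum_def r_def[symmetric] by simp
qed

text \<open>The sides are the first halves of the cycle and of the reversed cycle. By
  \<open>edge_cases\<close> they contain all edges of the polygon, so by \<open>inside_bigon\<close>
  any edge running between them would meet the empty inside.\<close>

lemma face_of_polygon:
  assumes poly: "polygon_interval b t v" and "b \<ge> 2"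
    and u: "covers t u" "covers t u'" "u \<le> v" "u' \<le> v" "incl t u < incl t u'"
    and empty: "inside (hasse_edges pos {t..v}) \<inter> hasse_edges pos UNIV = {}"
  shows "\<exists>c d. face c d b \<and> c 0 = t \<and> c 1 = u \<and> d 1 = u'"
proof -
  obtain l where l: "length l = 2 * b" "distinct l" "set l = {t..v}" "l ! 0 = t" "l ! b = v"
    "\<forall>j<2 * b. \<forall>k<2 * b. (covers (l ! j) (l ! k) \<or> covers (l ! k) (l ! j)) \<longleftrightarrow>
        (k = Suc j mod (2 * b) \<or> j = Suc k mod (2 * b))"
    using poly unfolding polygon_interval_def by blast
  have g: "cycle_enum ((!) l) b t v"
    unfolding cycle_enum_def using l
    by (auto simp: inj_on_def nth_eq_iff_index_eq set_conv_nth image_def)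
  \<comment> \<open>Orients the cycle: \<open>u\<close> and \<open>u'\<close> are the two neighbours
    of \<open>t\<close>, in one order or the other.\<close>
  have "\<exists>g. cycle_enum g b t v \<and> g 1 = u \<and> g (2 * b - 1) = u'"
  proof -
    have first: "z = l ! 1 \<or> z = l ! (2 * b - 1)" if "covers t z" "z \<le> v" for z
    proof -
      have "z \<in> {t..v}" using that coversD[of t z] by simp
      then obtain j where j: "j < 2 * b" "z = l ! j" using l(1,3) by (metis in_set_conv_nth)
      then have "j = Suc 0 mod (2 * b) \<or> 0 = Suc j mod (2 * b)" using l(4,6) that \<open>b \<ge> 2\<close> by fastforce
      then have "j = 1 \<or> j = 2 * b - 1" using j \<open>b \<ge> 2\<close> by (auto simp: Suc_mod_eq split: if_splits)
      with j show ?thesis by blast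
    qed
    have "u \<noteq> u'" using u(5) by auto
    then consider "u = l ! 1" "u' = l ! (2 * b - 1)" | "u = l ! (2 * b - 1)" "u' = l ! 1"
      using first[OF u(1,3)] first[OF u(2,4)] by blast
    then show ?thesis
    proof cases
      case 1
      with g show ?thesis by blast
    next
      case 2
      with cycle_enum_reverse[OF g \<open>b \<ge> 2\<close>] \<open>b \<ge> 2\<close> show ?thesis
        by (intro exI[of _ "\<lambda>k. l ! (if k = 0 then 0 else 2 * b - k)"]) auto
    qed
  qed
  then obtain c where c: "cycle_enum c b t v" "c 1 = u" "c (2 * b - 1) = u'" by blast
  define d where "d = (\<lambda>k. c (if k = 0 then 0 else 2 * b - k))"
  have d: "cycle_enum d b t v" unfolding d_def by (rule cycle_enum_reverse[OF c(1) \<open>b \<ge> 2\<close>])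
  have d1: "d 1 = u'" using c \<open>b \<ge> 2\<close> by (simp add: d_def)
  have sat: "saturated c b" "saturated d b" using c d cycle_enum_saturated \<open>b \<ge> 2\<close> by auto
  have ends: "c 0 = t" "d 0 = t" "c b = v" "d b = v" using c d by (auto simp: cycle_enum_def)
  have inj: "inj_on c {..<2 * b}" and im: "c ` {..<2 * b} = {t..v}" using c by (auto simp: cycle_enum_def)
  have bg: "bigon c d b"
    unfolding bigon_def
  proof (intro conjI allI impI)
    fix j k assume "0 < j" "j < b" "0 < k" "k < b"
    then show "c j \<noteq> d k" using inj by (auto simp: d_def dest!: inj_onD)
  qed (use sat ends d1 c u \<open>b \<ge> 2\<close> in auto)
  let ?H = "hasse_edges pos {t..v}"
  have mem_c: "c k \<in> {t..v}" if "k < 2 * b" for k using im that by blast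
  have mem_d: "d k \<in> {t..v}" if "k < 2 * b" for k using d that by (auto simp: cycle_enum_def)
  have edge_cases: "(\<exists>a<b. s = c a \<and> z = c (Suc a)) \<or> (\<exists>a<b. s = d a \<and> z = d (Suc a))"
    if sz: "s \<in> {t..v}" "z \<in> {t..v}" "covers s z" for s z
  proof -
    obtain j k where jk: "j < 2 * b" "s = c j" "k < 2 * b" "z = c k"
      using sz(1,2) unfolding im[symmetric] by blast
    have asym: "\<not> covers z s" using sz(3) by (auto simp: covers_def)
    have flip: "c m = d (2 * b - m)" if "0 < m" "m < 2 * b" for m
      using that by (simp add: d_def)
    have flip0: "c 0 = d 0" by (simp add: d_def)
    have "k = Suc j mod (2 * b) \<or> j = Suc k mod (2 * b)"
      using c(1) jk sz(3) unfolding cycle_enum_def by blast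
    then show ?thesis
    proof
      assume k: "k = Suc j mod (2 * b)"
      show ?thesis
      proof (cases "j < b")
        case True
        then have "k = Suc j" using k by simp
        with True jk show ?thesis by blast
      next
        case False
        define a where "a = 2 * b - Suc j"
        have "c j = d (Suc a)" "c k = d a" "a < b"
          using False jk flip[of j] flip[of k] flip0 k by (auto simp: a_def Suc_mod_eq Suc_diff_Suc split: if_splits)
        with saturatedD[OF sat(2), of a] jk asym show ?thesis by simp
      qed
    next
      assume j: "j = Suc k mod (2 * b)"
      show ?thesis
      proof (cases "k < b")
        case True
        then have "j = Suc k" using j by simp
        with True jk asym saturatedD[OF sat(1) True] show ?thesis by simp
      next
        case False
        define a where "a = 2 * b - Suc k"
        have "c k = d (Suc a)" "c j = d a" "a < b"
          using False jk flip[of j] flip[of k] flip0 j by (auto simp: a_def Suc_mod_eq Suc_diff_Suc split: if_splits)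
        with jk show ?thesis by blast
      qed
    qed
  qed
  have inside: "(x, y) \<in> inside ?H"
    if "yc (c 0) < y" "y < yc (c b)" "chain_x pos c b y < x" "x < chain_x pos d b y" for x y
  proof (rule inside_bigon[OF bg _ _ _ that])
    fix x y assume "(x, y) \<in> ?H"
    then obtain s z where s: "s \<in> {t..v}" "z \<in> {t..v}" "covers s z" "(x, y) \<in> closed_segment (pos s) (pos z)"
      by (auto simp: hasse_edges_def)
    then have xy: "yc s \<le> y" "y \<le> yc z" "x = edge_x pos s z y" by (auto simp: mem_edge_iff)
    from edge_cases[OF s(1-3)] show "x = chain_x pos c b y \<or> x = chain_x pos d b y"
      using xy chain_x_edge[OF sat(1)] chain_x_edge[OF sat(2)] by metis
  next
    fix k assume "k < b"
    then show "closed_segment (pos (c k)) (pos (c (Suc k))) \<subseteq> ?H"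
      using mem_c[of k] mem_c[of "Suc k"] saturatedD[OF sat(1)] unfolding hasse_edges_def by auto
    show "closed_segment (pos (d k)) (pos (d (Suc k))) \<subseteq> ?H"
      using \<open>k < b\<close> mem_d[of k] mem_d[of "Suc k"] saturatedD[OF sat(2)] unfolding hasse_edges_def by auto
  qed
  have "face c d b"
    unfolding face_def
  proof (intro conjI allI impI notI bg)
    fix s z y
    assume s: "covers s z" "yc s \<le> y" "y \<le> yc z" "yc (c 0) < y" "y < yc (c b)"
      and "chain_x pos c b y < edge_x pos s z y \<and> edge_x pos s z y < chain_x pos d b y"
    then have "(edge_x pos s z y, y) \<in> inside ?H" using inside by simp
    moreover have "(edge_x pos s z y, y) \<in> closed_segment (pos s) (pos z)"
      using s by (simp add: mem_edge_iff)
    then have "(edge_x pos s z y, y) \<in> hasse_edges pos UNIV"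
      using s(1) unfolding hasse_edges_def by blast
    ultimately show False using empty by blast
  qed
  then show ?thesis using c d1 ends by blast
qed

end

text \<open>Beyond this point the diagram enters only through these level sizes.\<close>

lemma is_P_level_recurrence:
  fixes \<rho> :: "'a::order_bot \<Rightarrow> nat" and s :: 'a
  assumes P: "is_P i b \<rho>" and "b \<ge> 2"
  defines "U \<equiv> \<lambda>n. {t. s \<le> t \<and> \<rho> t = \<rho> s + n}"
  shows "finite (U n)" and "U 0 = {s}"
    and "i * card (U n) = card (U (Suc n)) + (if Suc n < b then 0 else (i - 1) * card (U (Suc n - b)))"
proof -
  obtain pos :: "'a \<Rightarrow> real \<times> real" where pos: "planar_hasse_diagram pos"
    "\<And>t u u'. consecutive_covers pos t u u' \<Longrightarrow>
         \<exists>v>t. u \<in> {t..v} \<and> u' \<in> {t..v} \<and> polygon_interval b t v \<and>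
            inside (hasse_edges pos {t..v}) \<inter> (range pos \<union> hasse_edges pos UNIV) = {}"
    and rk: "rank_function \<rho>" and fin: "\<And>n. finite {t. \<rho> t = n}"
    and deg: "\<And>t :: 'a. finite {u. covers t u}" "\<And>t :: 'a. card {u. covers t u} = i"
    using P unfolding is_P_def by blast
  interpret ranked_diagram pos \<rho>
    using pos(1) rk by unfold_locales (auto simp: rank_function_def)
  interpret face_diagram pos \<rho> b
  proof
    fix t u u' :: 'a
    show "finite {u. covers t u}" by (rule deg)
    assume cons: "consecutive_covers pos t u u'"
    obtain v where "u \<in> {t..v}" "u' \<in> {t..v}" "polygon_interval b t v"
      "inside (hasse_edges pos {t..v}) \<inter> (range pos \<union> hasse_edges pos UNIV) = {}"
      using pos(2)[OF cons] by blast
    then show "\<exists>c d. face c d b \<and> c 0 = t \<and> c 1 = u \<and> d 1 = u'"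
      using face_of_polygon[of b t v u u'] cons \<open>b \<ge> 2\<close> by (auto simp: consecutive_covers_def)
  qed
  have U: "U = upper_level s" by (auto simp: U_def upper_level_def)
  have finU: "finite (upper_level s n)" for n
    by (rule finite_subset[OF _ fin[of "\<rho> s + n"]]) (auto simp: upper_level_def)
  show "finite (U n)" "U 0 = {s}" using finU upper_level_0 by (auto simp: U)
  show "i * card (U n) = card (U (Suc n)) + (if Suc n < b then 0 else (i - 1) * card (U (Suc n - b)))"
    using upper_level_recurrence[OF deg(2) finU, of n] by (simp add: U)
qed

section \<open>Newton recurrences for symmetric functions\<close>

lemma mcoeff_0 [simp]: "mcoeff 0 A = 0"
  by (simp add: zero_mps_def)

lemma mcoeff_1: "mcoeff 1 A = (if A = {#} then 1 else 0)"
  by (simp add: one_mps_def)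

lemma mcoeff_add [simp]: "mcoeff (f + g) A = mcoeff f A + mcoeff g A"
  by (simp add: plus_mps_def)

lemma mcoeff_mult: "mcoeff (f * g) A = (\<Sum>B | B \<subseteq># A. mcoeff f B * mcoeff g (A - B))"
  by (simp add: times_mps_def)

lemma mcoeff_sum: "mcoeff (sum f S) A = (\<Sum>x\<in>S. mcoeff (f x) A)"
  by (induction S rule: infinite_finite_induct) auto

lemma mcoeff_const_mult [simp]: "mcoeff (mps_const c * f) A = c * mcoeff f A"
proof -
  have "mcoeff (mps_const c * f) A = (\<Sum>B | B \<subseteq># A. if B = {#} then c * mcoeff f A else 0)"
    unfolding mcoeff_mult by (intro sum.cong) (auto simp: mps_const_def)
  also have "\<dots> = c * mcoeff f A" by (subst sum.delta) auto
  finally show ?thesis .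
qed

lemma mps_const_mult: "mps_const (c * d) = mps_const c * mps_const d"
proof (rule mps_eqI)
  fix A
  show "mcoeff (mps_const (c * d)) A = mcoeff (mps_const c * mps_const d) A"
    unfolding mcoeff_const_mult by (simp add: mps_const_def)
qed

lemma mps_const_1 [simp]: "mps_const 1 = 1"
  by (rule mps_eqI) (simp add: mps_const_def mcoeff_1)

lemma mps_const_cancel:
  fixes f g :: "'a::field mps"
  assumes "c \<noteq> 0" "mps_const c * f = mps_const c * g"
  shows "f = g"
proof (rule mps_eqI)
  fix A
  have "mcoeff (mps_const c * f) A = mcoeff (mps_const c * g) A" using assms(2) by simp
  then show "mcoeff f A = mcoeff g A" using assms(1) by simp
qed

lemma mcoeff_var_mult:
  "mcoeff (mps_var k * f) A = (if k \<in># A then mcoeff f (A - {#k#}) else 0)"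
proof -
  have "mcoeff (mps_var k * f) A = (\<Sum>B | B \<subseteq># A. if B = {#k#} then mcoeff f (A - {#k#}) else 0)"
    unfolding mcoeff_mult by (intro sum.cong) (auto simp: mps_var_def)
  then show ?thesis by (simp add: sum.delta)
qed

lemma mcoeff_monomial: "mcoeff (\<Prod>k\<in>#B. mps_var k) A = (if A = B then 1 else 0)"
proof (induction B arbitrary: A)
  case empty
  then show ?case by (simp add: mcoeff_1)
next
  case (add k B)
  then show ?case by (auto simp: mcoeff_var_mult)
qed

lemma mcoeff_var_power: "mcoeff (mps_var k ^ n) A = (if A = replicate_mset n k then 1 else 0)"
  using mcoeff_monomial[of "replicate_mset n k" A] by simp

lemma mcoeff_formal_sum_monomials:
  "mcoeff (formal_sum (\<lambda>A. \<Prod>k\<in>#A. mps_var k) S) A = (if A \<in> S then 1 else 0)"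
proof -
  have "{B \<in> S. mcoeff (\<Prod>k\<in>#B. mps_var k) A \<noteq> (0::'a)} = (if A \<in> S then {A} else {})"
    by (auto simp: mcoeff_monomial)
  then show ?thesis by (simp add: formal_sum_def mcoeff_monomial)
qed

definition psum :: "nat \<Rightarrow> rat mps" where
  "psum n = formal_sum (\<lambda>k. mps_var k ^ n) UNIV"

lemma power_sum_sym_eq: "power_sum_sym l = (\<Prod>n\<in>#l. psum n)"
  by (simp add: power_sum_sym_def psum_def)

lemma replicate_mset_inj: "n > 0 \<Longrightarrow> replicate_mset n k = replicate_mset n k' \<longleftrightarrow> k = k'"
  by (metis count_replicate_mset gr_implies_not0)

lemma mcoeff_psum:
  assumes "n > 0"
  shows "mcoeff (psum n) A = (if \<exists>k. A = replicate_mset n k then 1 else 0)"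
proof -
  have "{k \<in> UNIV. mcoeff (mps_var k ^ n) A \<noteq> (0::rat)} = {k. A = replicate_mset n k}"
    by (auto simp: mcoeff_var_power)
  moreover have "{k. A = replicate_mset n k} = {} \<or> (\<exists>k. {k. A = replicate_mset n k} = {k})"
  proof (cases "\<exists>k. A = replicate_mset n k")
    case True
    then obtain k where "A = replicate_mset n k" by blast
    then have "{k. A = replicate_mset n k} = {k}" by (auto simp: replicate_mset_inj[OF assms])
    then show ?thesis by blast
  qed blast
  ultimately show ?thesis by (auto simp: psum_def formal_sum_def mcoeff_var_power)
qed

lemma mcoeff_psum_mult:
  assumes "n > 0"
  shows "mcoeff (psum n * f) A =
    (\<Sum>k | k \<in> set_mset A \<and> n \<le> count A k. mcoeff f (A - replicate_mset n k))"
proof -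
  let ?K = "{k. k \<in> set_mset A \<and> n \<le> count A k}"
  have "mcoeff (psum n * f) A = (\<Sum>B\<in>replicate_mset n ` ?K. mcoeff (psum n) B * mcoeff f (A - B))"
    unfolding mcoeff_mult
  proof (rule sum.mono_neutral_right)
    show "replicate_mset n ` ?K \<subseteq> {B. B \<subseteq># A}" by (auto simp: count_le_replicate_mset_subset_eq)
    show "\<forall>B\<in>{B. B \<subseteq># A} - replicate_mset n ` ?K. mcoeff (psum n) B * mcoeff f (A - B) = 0"
    proof
      fix B assume B: "B \<in> {B. B \<subseteq># A} - replicate_mset n ` ?K"
      have "B \<noteq> replicate_mset n k" for k
      proof
        assume e: "B = replicate_mset n k"
        then have "n \<le> count A k" using B by (simp add: count_le_replicate_mset_subset_eq)
        moreover from this have "k \<in># A" using assms by (auto simp: not_in_iff intro!: count_inI)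
        ultimately show False using B e by auto
      qed
      then show "mcoeff (psum n) B * mcoeff f (A - B) = 0" using assms by (simp add: mcoeff_psum)
    qed
  qed simp
  also have "\<dots> = (\<Sum>k\<in>?K. mcoeff (psum n) (replicate_mset n k) * mcoeff f (A - replicate_mset n k))"
    by (subst sum.reindex) (auto simp: inj_on_def replicate_mset_inj assms)
  also have "\<dots> = (\<Sum>k\<in>?K. mcoeff f (A - replicate_mset n k))"
    by (intro sum.cong) (auto simp: mcoeff_psum assms)
  finally show ?thesis .
qed

section \<open>Products over all variables and their Newton recurrences\<close>

definition weight :: "(nat \<Rightarrow> rat) \<Rightarrow> nat multiset \<Rightarrow> rat" where
  "weight f A = (\<Prod>k\<in>set_mset A. f (count A k))"

text \<open>The part of degree \<open>n\<close> of the product over all variables \<open>x\<close> of the series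
  \<open>\<Sum>m. f m * x ^ m\<close>, where \<open>f 0 = 1\<close>.\<close>

definition prod_part :: "(nat \<Rightarrow> rat) \<Rightarrow> nat \<Rightarrow> rat mps" where
  "prod_part f n = Abs_mps (\<lambda>A. if size A = n then weight f A else 0)"

lemma mcoeff_prod_part [simp]: "mcoeff (prod_part f n) A = (if size A = n then weight f A else 0)"
  by (simp add: prod_part_def)

lemma weight_superset:
  assumes "f 0 = 1" "finite S" "set_mset A \<subseteq> S"
  shows "weight f A = (\<Prod>k\<in>S. f (count A k))"
  unfolding weight_def using assms by (intro prod.mono_neutral_left) (auto simp: not_in_iff)

text \<open>With \<open>F\<close> the series of \<open>f\<close> and \<open>C\<close> the series of
  \<open>c\<close> without constant term, the recurrence says \<open>x F' = C F\<close>: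
  \<open>C\<close> is \<open>x\<close> times the logarithmic derivative of \<open>F\<close>.\<close>

definition newton_pair :: "(nat \<Rightarrow> rat) \<Rightarrow> (nat \<Rightarrow> rat) \<Rightarrow> bool" where
  "newton_pair f c \<longleftrightarrow> f 0 = 1 \<and> (\<forall>m. of_nat m * f m = (\<Sum>j=1..m. c j * f (m - j)))"

text \<open>The same identity for a product of \<open>F(x_k)\<close> over all variables, degree by
  degree: the Euler operator multiplies the product by the sum of the \<open>C(x_k)\<close>, which
  is the sum of the \<open>c j\<close> times \<open>psum j\<close>.\<close>

definition newton_seq :: "(nat \<Rightarrow> rat mps) \<Rightarrow> (nat \<Rightarrow> rat) \<Rightarrow> bool" where
  "newton_seq X c \<longleftrightarrow> X 0 = 1 \<and>
     (\<forall>n. mps_const (of_nat n) * X n = (\<Sum>j=1..n. mps_const (c j) * (psum j * X (n - j))))"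

text \<open>At a monomial \<open>A\<close> the sum runs over the variables \<open>k\<close> of
  \<open>A\<close> and \<open>1 \<le> j \<le> count A k\<close>. For fixed \<open>k\<close> the
  recurrence in one variable gives \<open>count A k\<close> times the weight of \<open>A\<close>,
  and the multiplicities add up to the degree.\<close>

lemma newton_seq_prod_part:
  assumes "newton_pair f c"
  shows "newton_seq (prod_part f) c"
  unfolding newton_seq_def
proof (intro conjI allI)
  have f0: "f 0 = 1" and rec: "\<And>m. of_nat m * f m = (\<Sum>j=1..m. c j * f (m - j))"
    using assms by (auto simp: newton_pair_def)
  show "prod_part f 0 = 1" by (rule mps_eqI) (auto simp: mcoeff_1 weight_def)
  fix n
  show "mps_const (of_nat n) * prod_part f n =
    (\<Sum>j=1..n. mps_const (c j) * (psum j * prod_part f (n - j)))"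
  proof (rule mps_eqI)
    fix A :: "nat multiset"
    let ?K = "\<lambda>j. {k. k \<in> set_mset A \<and> j \<le> count A k}"
    have rhs: "mcoeff (\<Sum>j=1..n. mps_const (c j) * (psum j * prod_part f (n - j))) A =
        (\<Sum>j=1..n. \<Sum>k\<in>?K j. c j * mcoeff (prod_part f (n - j)) (A - replicate_mset j k))"
      unfolding mcoeff_sum mcoeff_const_mult
      by (intro sum.cong refl) (simp add: mcoeff_psum_mult sum_distrib_left del: mcoeff_prod_part)
    have size: "size (A - replicate_mset j k) = size A - j \<and> j \<le> size A" if "j \<le> count A k" for j k
    proof -
      have "j \<le> size A" using that count_le_size[of A k] by linarith
      then show ?thesis using that by (simp add: size_Diff_submset count_le_replicate_mset_subset_eq)
    qed
    show "mcoeff (mps_const (of_nat n) * prod_part f n) A =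
      mcoeff (\<Sum>j=1..n. mps_const (c j) * (psum j * prod_part f (n - j))) A"
    proof (cases "size A = n")
      case False
      have "mcoeff (prod_part f (n - j)) (A - replicate_mset j k) = 0" if "j \<in> {1..n}" "k \<in> ?K j" for j k
        using False size[of j k] that by auto
      then show ?thesis unfolding rhs using False by simp
    next
      case True
      have W: "weight f (A - replicate_mset j k) =
          f (count A k - j) * (\<Prod>x\<in>set_mset A - {k}. f (count A x))" if "k \<in># A" for j k
      proof -
        have "weight f (A - replicate_mset j k) = (\<Prod>x\<in>set_mset A. f (count (A - replicate_mset j k) x))"
          by (rule weight_superset) (auto simp: f0 dest: in_diffD)
        also have "\<dots> = f (count A k - j) * (\<Prod>x\<in>set_mset A - {k}. f (count (A - replicate_mset j k) x))"
          using that by (subst prod.remove[of _ k]) auto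
        also have "(\<Prod>x\<in>set_mset A - {k}. f (count (A - replicate_mset j k) x)) =
            (\<Prod>x\<in>set_mset A - {k}. f (count A x))"
          by (intro prod.cong) auto
        finally show ?thesis .
      qed
      have "(\<Sum>j=1..n. \<Sum>k\<in>?K j. c j * mcoeff (prod_part f (n - j)) (A - replicate_mset j k))
          = (\<Sum>j=1..n. \<Sum>k\<in>?K j. c j * weight f (A - replicate_mset j k))"
        using True size by (intro sum.cong) auto
      also have "\<dots> = (\<Sum>(j, k)\<in>Sigma {1..n} ?K. c j * weight f (A - replicate_mset j k))"
        by (subst sum.Sigma) auto
      also have "\<dots> = (\<Sum>(k, j)\<in>Sigma (set_mset A) (\<lambda>k. {1..count A k}).
          c j * weight f (A - replicate_mset j k))"
      proof (rule sum.reindex_bij_witness[of _ prod.swap prod.swap])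
        show "prod.swap p \<in> Sigma {1..n} ?K" if "p \<in> Sigma (set_mset A) (\<lambda>k. {1..count A k})" for p
          using that True count_le_size[of A "fst p"] by auto
      qed auto
      also have "\<dots> = (\<Sum>k\<in>set_mset A. \<Sum>j=1..count A k. c j * weight f (A - replicate_mset j k))"
        by (subst sum.Sigma) auto
      also have "\<dots> = (\<Sum>k\<in>set_mset A. of_nat (count A k) * weight f A)"
      proof (intro sum.cong refl)
        fix k assume k: "k \<in># A"
        have "(\<Sum>j=1..count A k. c j * weight f (A - replicate_mset j k)) =
            (\<Sum>j=1..count A k. c j * f (count A k - j)) * (\<Prod>x\<in>set_mset A - {k}. f (count A x))"
          by (simp add: W[OF k] sum_distrib_right mult.assoc)
        also have "\<dots> = of_nat (count A k) * (f (count A k) * (\<Prod>x\<in>set_mset A - {k}. f (count A x)))"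
          by (simp only: rec[symmetric] mult.assoc)
        also have "f (count A k) * (\<Prod>x\<in>set_mset A - {k}. f (count A x)) = weight f A"
          unfolding weight_def using k by (subst (2) prod.remove[of _ k]) auto
        finally show "(\<Sum>j=1..count A k. c j * weight f (A - replicate_mset j k)) =
            of_nat (count A k) * weight f A" .
      qed
      also have "\<dots> = of_nat n * weight f A"
        using True by (auto simp: size_multiset_overloaded_eq simp flip: sum_distrib_right of_nat_sum)
      finally show ?thesis unfolding rhs using True by simp
    qed
  qed
qed

text \<open>The recurrence determines \<open>X n\<close> after division by \<open>n\<close>, which
  is possible over the rationals.\<close>

lemma newton_seq_unique:
  assumes "newton_seq X c" "newton_seq Y c"
  shows "X n = Y n"
proof (induction n rule: less_induct)
  case (less n)
  show ?case
  proof (cases "n = 0")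
    case True
    then show ?thesis using assms by (simp add: newton_seq_def)
  next
    case False
    have "mps_const (of_nat n) * X n = (\<Sum>j=1..n. mps_const (c j) * (psum j * X (n - j)))"
      using assms(1) by (simp add: newton_seq_def)
    also have "\<dots> = (\<Sum>j=1..n. mps_const (c j) * (psum j * Y (n - j)))"
      using less by (intro sum.cong) auto
    also have "\<dots> = mps_const (of_nat n) * Y n" using assms(2) by (simp add: newton_seq_def)
    finally show ?thesis using False by (auto intro: mps_const_cancel[of "of_nat n"])
  qed
qed

lemma complete_sym_eq: "complete_sym n = prod_part (\<lambda>_. 1) n"
  by (rule mps_eqI) (simp add: complete_sym_def mcoeff_formal_sum_monomials weight_def)

text \<open>For \<open>F = 1 / (1 - x)\<close> the series \<open>x F' / F\<close> is
  \<open>x / (1 - x)\<close>.\<close>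

lemma newton_pair_complete: "newton_pair (\<lambda>_. 1) (\<lambda>_. 1)"
  by (simp add: newton_pair_def)

lemma elementary_sym_eq: "elementary_sym n = prod_part (\<lambda>m. if m \<le> 1 then 1 else 0) n"
proof (rule mps_eqI)
  fix A
  have mon: "mcoeff (\<Prod>k\<in>S. mps_var k) A = (if A = mset_set S then 1 else (0::rat))" for S
    using mcoeff_monomial[of "mset_set S" A] by (simp add: prod_unfold_prod_mset)
  have eq: "A = mset_set S \<longleftrightarrow> S = set_mset A \<and> (\<forall>k\<in>#A. count A k \<le> 1)" if "finite S" for S
  proof
    assume "A = mset_set S"
    then show "S = set_mset A \<and> (\<forall>k\<in>#A. count A k \<le> 1)" using that by (auto simp: count_mset_set')
  next
    assume a: "S = set_mset A \<and> (\<forall>k\<in>#A. count A k \<le> 1)"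
    show "A = mset_set S"
    proof (rule multiset_eqI)
      fix k
      show "count A k = count (mset_set S) k"
      proof (cases "k \<in># A")
        case True
        then have "count A k \<le> 1" "count A k > 0" using a by auto
        then have "count A k = 1" by linarith
        then show ?thesis using a True by simp
      next
        case False
        then show ?thesis using a by (simp add: not_in_iff)
      qed
    qed
  qed
  have size: "card (set_mset A) = size A" if "\<forall>k\<in>#A. count A k \<le> 1"
  proof -
    have "A = mset_set (set_mset A)" using eq[of "set_mset A"] that by simp
    then show ?thesis by (metis size_mset_set)
  qed
  have set: "{S \<in> {S. finite S \<and> card S = n}. mcoeff (\<Prod>k\<in>S. mps_var k) A \<noteq> (0::rat)} =
      (if size A = n \<and> (\<forall>k\<in>#A. count A k \<le> 1) then {set_mset A} else {})"
    using eq size by (auto simp: mon)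
  have w: "weight (\<lambda>m. if m \<le> 1 then 1 else 0) A = (if \<forall>k\<in>#A. count A k \<le> 1 then 1 else 0)"
    unfolding weight_def by (auto simp: prod_zero_iff)
  have one: "A = mset_set (set_mset A)" if "\<forall>k\<in>#A. count A k \<le> 1" using eq[of "set_mset A"] that by simp
  have "mcoeff (elementary_sym n) A = (\<Sum>S\<in>(if size A = n \<and> (\<forall>k\<in>#A. count A k \<le> 1) then {set_mset A} else {}).
      mcoeff (\<Prod>k\<in>S. mps_var k) A)"
    unfolding elementary_sym_def formal_sum_def mcoeff_Abs_mps set ..
  also have "\<dots> = mcoeff (prod_part (\<lambda>m. if m \<le> 1 then 1 else 0) n) A"
    using one unfolding mcoeff_prod_part w by (auto simp: mon)
  finally show "mcoeff (elementary_sym n) A = mcoeff (prod_part (\<lambda>m. if m \<le> 1 then 1 else 0) n) A" .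
qed

text \<open>For \<open>F = 1 + x\<close> the series \<open>x F' / F\<close> is
  \<open>x / (1 + x)\<close>, which has alternating signs.\<close>

lemma newton_pair_elementary: "newton_pair (\<lambda>m. if m \<le> 1 then 1 else 0) (\<lambda>j. (-1) ^ (j - 1))"
  unfolding newton_pair_def
proof (intro conjI allI)
  fix m :: nat
  show "of_nat m * (if m \<le> 1 then 1 else 0) =
    (\<Sum>j=1..m. (-1) ^ (j - 1) * (if m - j \<le> 1 then 1 else (0::rat)))"
  proof (cases "m \<le> 1")
    case True
    then consider "m = 0" | "m = 1" by linarith
    then show ?thesis by cases auto
  next
    case False
    then obtain k where k: "m = Suc (Suc k)" by (metis One_nat_def le_SucI not0_implies_Suc order.refl)
    have "(\<Sum>j=1..m. (-1) ^ (j - 1) * (if m - j \<le> 1 then 1 else (0::rat))) =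
        (\<Sum>j\<in>{Suc k, Suc (Suc k)}. (-1) ^ (j - 1))"
      using k by (intro sum.mono_neutral_cong_right) auto
    then show ?thesis using k by simp
  qed
qed simp

section \<open>The ring of symmetric functions and the involution\<close>

lemma symmetric_functionsI:
  assumes "\<And>\<pi> A. bij \<pi> \<Longrightarrow> mcoeff f (image_mset \<pi> A) = mcoeff f A"
    and "\<And>A. mcoeff f A \<noteq> 0 \<Longrightarrow> size A \<le> d"
  shows "f \<in> symmetric_functions"
  using assms unfolding symmetric_functions_def by blast

lemma symmetric_functionsD: "f \<in> symmetric_functions \<Longrightarrow> bij \<pi> \<Longrightarrow> mcoeff f (image_mset \<pi> A) = mcoeff f A"
  unfolding symmetric_functions_def by blast

lemma symmetric_functions_degree:
  assumes "f \<in> symmetric_functions"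
  obtains d where "\<And>A. mcoeff f A \<noteq> 0 \<Longrightarrow> size A \<le> d"
  using assms unfolding symmetric_functions_def by blast

lemma symmetric_0: "0 \<in> symmetric_functions"
  by (rule symmetric_functionsI[of _ 0]) auto

lemma symmetric_add:
  assumes "f \<in> symmetric_functions" "g \<in> symmetric_functions"
  shows "f + g \<in> symmetric_functions"
proof -
  obtain d e where d: "\<And>A. mcoeff f A \<noteq> 0 \<Longrightarrow> size A \<le> d" "\<And>A. mcoeff g A \<noteq> 0 \<Longrightarrow> size A \<le> e"
    using symmetric_functions_degree[OF assms(1)] symmetric_functions_degree[OF assms(2)] by metis
  show ?thesis
  proof (rule symmetric_functionsI[of _ "max d e"])
    fix A assume "mcoeff (f + g) A \<noteq> 0"
    then have "mcoeff f A \<noteq> 0 \<or> mcoeff g A \<noteq> 0" by auto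
    then show "size A \<le> max d e" using d by (auto simp: le_max_iff_disj)
  qed (use assms in \<open>simp add: symmetric_functionsD\<close>)
qed

lemma symmetric_sum: "(\<And>x. x \<in> S \<Longrightarrow> f x \<in> symmetric_functions) \<Longrightarrow> sum f S \<in> symmetric_functions"
  by (induction S rule: infinite_finite_induct) (auto intro: symmetric_0 symmetric_add)

lemma symmetric_const_mult:
  assumes "f \<in> symmetric_functions"
  shows "mps_const c * f \<in> symmetric_functions"
proof -
  obtain d where "\<And>A. mcoeff f A \<noteq> 0 \<Longrightarrow> size A \<le> d"
    using symmetric_functions_degree[OF assms] by blast
  then show ?thesis
    by (intro symmetric_functionsI[of _ d]) (auto simp: symmetric_functionsD[OF assms])
qed

lemma symmetric_mult:
  assumes "f \<in> symmetric_functions" "g \<in> symmetric_functions"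
  shows "f * g \<in> symmetric_functions"
proof -
  obtain d e where d: "\<And>A. mcoeff f A \<noteq> 0 \<Longrightarrow> size A \<le> d" "\<And>A. mcoeff g A \<noteq> 0 \<Longrightarrow> size A \<le> e"
    using symmetric_functions_degree[OF assms(1)] symmetric_functions_degree[OF assms(2)] by metis
  show ?thesis
  proof (rule symmetric_functionsI[of _ "d + e"])
    fix A assume "mcoeff (f * g) A \<noteq> 0"
    then obtain B where "B \<in> {B. B \<subseteq># A}" and B: "mcoeff f B * mcoeff g (A - B) \<noteq> 0"
      unfolding mcoeff_mult by (rule sum.not_neutral_contains_not_neutral)
    then have "size B \<le> d" "size (A - B) \<le> e" using d by auto
    moreover have "size A = size B + size (A - B)" using \<open>B \<in> _\<close>
      by simp (metis size_union subset_mset.add_diff_inverse)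
    ultimately show "size A \<le> d + e" by simp
  next
    fix \<pi> :: "nat \<Rightarrow> nat" and A assume "bij \<pi>"
    have inv: "image_mset (inv \<pi>) (image_mset \<pi> B) = B" "image_mset \<pi> (image_mset (inv \<pi>) B) = B" for B
      using \<open>bij \<pi>\<close> by (simp_all add: multiset.map_comp comp_def bij_is_inj bij_is_surj surj_f_inv_f)
    show "mcoeff (f * g) (image_mset \<pi> A) = mcoeff (f * g) A"
      unfolding mcoeff_mult
    proof (rule sum.reindex_bij_witness[of _ "image_mset \<pi>" "image_mset (inv \<pi>)"])
      fix B assume B: "B \<in> {B. B \<subseteq># image_mset \<pi> A}"
      then show "image_mset (inv \<pi>) B \<in> {B. B \<subseteq># A}"
        using image_mset_subseteq_mono[of B "image_mset \<pi> A" "inv \<pi>"] inv by simp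
      then have "image_mset \<pi> (A - image_mset (inv \<pi>) B) = image_mset \<pi> A - B"
        using image_mset_Diff[of "image_mset (inv \<pi>) B" A \<pi>] inv by simp
      then show "mcoeff f (image_mset (inv \<pi>) B) * mcoeff g (A - image_mset (inv \<pi>) B) =
          mcoeff f B * mcoeff g (image_mset \<pi> A - B)"
        using symmetric_functionsD[OF assms(1) \<open>bij \<pi>\<close>, of "image_mset (inv \<pi>) B"]
          symmetric_functionsD[OF assms(2) \<open>bij \<pi>\<close>, of "A - image_mset (inv \<pi>) B"] inv by simp
    qed (auto simp: inv image_mset_subseteq_mono)
  qed
qed

lemma count_image_bij:
  assumes "bij \<pi>"
  shows "count (image_mset \<pi> A) (\<pi> k) = count A k"
  by (induction A) (use assms in \<open>auto simp: bij_def inj_eq\<close>)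

lemma exponents_image_bij:
  assumes "bij \<pi>"
  shows "exponents (image_mset \<pi> A) = exponents A"
proof -
  have "exponents (image_mset \<pi> A) = image_mset (count (image_mset \<pi> A)) (mset_set (\<pi> ` set_mset A))"
    by (simp add: exponents_def)
  also have "mset_set (\<pi> ` set_mset A) = image_mset \<pi> (mset_set (set_mset A))"
    by (rule image_mset_mset_set[symmetric], rule inj_on_subset[OF bij_is_inj[OF assms]]) simp
  also have "image_mset (count (image_mset \<pi> A)) (image_mset \<pi> (mset_set (set_mset A))) = exponents A"
    by (simp add: exponents_def multiset.map_comp comp_def count_image_bij[OF assms])
  finally show ?thesis .
qed

text \<open>Shows that a weight sees only the multiset of exponents, which makes
  \<open>prod_part\<close> invariant under permutations of the variables.\<close>

lemma weight_exponents: "weight f A = (\<Prod>m\<in>#exponents A. f m)"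
  by (simp add: weight_def exponents_def prod_unfold_prod_mset multiset.map_comp comp_def)

lemma size_exponents: "size A = sum_mset (exponents A)"
  by (simp add: exponents_def size_multiset_overloaded_eq sum_unfold_sum_mset)

lemma symmetric_prod_part: "prod_part f n \<in> symmetric_functions"
  by (rule symmetric_functionsI[of _ n]) (auto simp: weight_exponents exponents_image_bij split: if_splits)

lemma mcoeff_monomial_sym: "mcoeff (monomial_sym l) A = (if exponents A = l then 1 else 0)"
  by (simp add: monomial_sym_def mcoeff_formal_sum_monomials)

lemma symmetric_monomial_sym: "monomial_sym l \<in> symmetric_functions"
  by (rule symmetric_functionsI[of _ "sum_mset l"])
    (auto simp: mcoeff_monomial_sym exponents_image_bij size_exponents split: if_splits)

lemma symmetric_psum:
  assumes "n > 0"
  shows "psum n \<in> symmetric_functions"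
proof (rule symmetric_functionsI[of _ n])
  fix A assume "mcoeff (psum n) A \<noteq> 0"
  then show "size A \<le> n" using assms by (auto simp: mcoeff_psum split: if_splits)
next
  fix \<pi> :: "nat \<Rightarrow> nat" and A assume "bij \<pi>"
  have "(\<exists>k. image_mset \<pi> A = replicate_mset n k) \<longleftrightarrow> (\<exists>k. A = replicate_mset n k)"
  proof
    assume "\<exists>k. image_mset \<pi> A = replicate_mset n k"
    then obtain k where "image_mset \<pi> A = replicate_mset n k" by blast
    then have "image_mset (inv \<pi>) (image_mset \<pi> A) = replicate_mset n (inv \<pi> k)" by simp
    moreover have "image_mset (inv \<pi>) (image_mset \<pi> A) = A"
      using \<open>bij \<pi>\<close> by (simp add: multiset.map_comp comp_def bij_is_inj)
    ultimately show "\<exists>k. A = replicate_mset n k" by auto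
  qed auto
  then show "mcoeff (psum n) (image_mset \<pi> A) = mcoeff (psum n) A"
    using assms by (simp add: mcoeff_psum)
qed

context
  fixes \<omega> :: "rat mps \<Rightarrow> rat mps"
  assumes \<omega>: "standard_involution \<omega>"
begin

lemma involution_mult:
  "f \<in> symmetric_functions \<Longrightarrow> g \<in> symmetric_functions \<Longrightarrow> \<omega> (f * g) = \<omega> f * \<omega> g"
  and involution_const_mult: "f \<in> symmetric_functions \<Longrightarrow> \<omega> (mps_const c * f) = mps_const c * \<omega> f"
  and involution_elementary: "\<omega> (elementary_sym n) = complete_sym n"
  using \<omega> unfolding standard_involution_def by blast+

lemma involution_0: "\<omega> 0 = 0"
proof -
  have "mps_const 0 = (0 :: rat mps)" by (rule mps_eqI) (simp add: mps_const_def)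
  then show ?thesis using involution_const_mult[OF symmetric_0, of 0] by simp
qed

lemma involution_sum:
  assumes "\<And>x. x \<in> S \<Longrightarrow> f x \<in> symmetric_functions"
  shows "\<omega> (sum f S) = (\<Sum>x\<in>S. \<omega> (f x))"
  using assms
proof (induction S rule: infinite_finite_induct)
  case (infinite S)
  then show ?case by (simp add: involution_0)
next
  case empty
  then show ?case by (simp add: involution_0)
next
  case (insert x S)
  then show ?case using \<omega> symmetric_sum[of S f] unfolding standard_involution_def by simp
qed

text \<open>Apply \<open>\<omega>\<close> to the recurrence of the elementary functions and compare
  with that of the complete ones: the terms with \<open>j < n\<close> agree by induction, so the
  terms with \<open>j = n\<close> agree too, and there the complete function is
  \<open>?h 0 = 1\<close>.\<close>

lemma involution_psum:
  assumes "n > 0"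
  shows "\<omega> (psum n) = mps_const ((-1) ^ (n - 1)) * psum n"
  using assms
proof (induction n rule: less_induct)
  case (less n)
  let ?e = "elementary_sym" and ?h = "complete_sym"
  have e: "newton_seq ?e (\<lambda>j. (-1) ^ (j - 1))"
    using newton_seq_prod_part[OF newton_pair_elementary] unfolding elementary_sym_eq[symmetric] .
  have h: "newton_seq ?h (\<lambda>_. 1)"
    using newton_seq_prod_part[OF newton_pair_complete] unfolding complete_sym_eq[symmetric] .
  have sym_e: "?e m \<in> symmetric_functions" for m unfolding elementary_sym_eq by (rule symmetric_prod_part)
  have "mps_const (of_nat n) * ?h n = \<omega> (mps_const (of_nat n) * ?e n)"
    by (simp add: involution_const_mult sym_e involution_elementary)
  also have "mps_const (of_nat n) * ?e n = (\<Sum>j=1..n. mps_const ((-1) ^ (j - 1)) * (psum j * ?e (n - j)))"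
    using e by (simp add: newton_seq_def)
  also have "\<omega> \<dots> = (\<Sum>j=1..n. \<omega> (mps_const ((-1) ^ (j - 1)) * (psum j * ?e (n - j))))"
    by (rule involution_sum) (auto intro!: symmetric_const_mult symmetric_mult symmetric_psum sym_e)
  also have "\<dots> = (\<Sum>j=1..n. mps_const ((-1) ^ (j - 1)) * (\<omega> (psum j) * ?h (n - j)))"
    by (intro sum.cong) (auto simp: involution_const_mult symmetric_mult symmetric_psum sym_e
      involution_mult involution_elementary)
  finally have 1: "mps_const (of_nat n) * ?h n = \<dots>" .
  have 2: "mps_const (of_nat n) * ?h n = (\<Sum>j=1..n. mps_const 1 * (psum j * ?h (n - j)))"
    using h by (simp add: newton_seq_def)
  have split: "{1..n} = insert n {1..<n}" using less.prems by auto
  have sgn: "mps_const ((-1) ^ m) * (mps_const ((-1) ^ m) * f) = (f :: rat mps)" for m f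
    by (simp flip: mult.assoc mps_const_mult power_mult_distrib)
  have "mps_const ((-1) ^ (j - 1)) * (\<omega> (psum j) * ?h (n - j)) = mps_const 1 * (psum j * ?h (n - j))"
    if "j \<in> {1..<n}" for j
    using less.IH[of j] that by (simp add: mult.assoc sgn)
  then have "(\<Sum>j=1..<n. mps_const ((-1) ^ (j - 1)) * (\<omega> (psum j) * ?h (n - j))) =
      (\<Sum>j=1..<n. mps_const 1 * (psum j * ?h (n - j)))"
    by (intro sum.cong) auto
  moreover have "(\<Sum>j=1..n. mps_const ((-1) ^ (j - 1)) * (\<omega> (psum j) * ?h (n - j))) =
      (\<Sum>j=1..n. mps_const 1 * (psum j * ?h (n - j)))"
    using 1 2 by simp
  ultimately have "mps_const ((-1) ^ (n - 1)) * (\<omega> (psum n) * ?h 0) = mps_const 1 * (psum n * ?h 0)"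
    unfolding split by (simp add: sum.insert)
  moreover have "?h 0 = 1" using h by (simp add: newton_seq_def)
  ultimately have "mps_const ((-1) ^ (n - 1)) * \<omega> (psum n) = psum n" by simp
  then show ?case using sgn[of "n - 1" "\<omega> (psum n)"] by simp
qed

lemma newton_seq_involution:
  assumes "newton_pair f (\<lambda>j. (-1) ^ (j - 1) * c j)"
  shows "newton_seq (\<lambda>n. \<omega> (prod_part f n)) c"
  unfolding newton_seq_def
proof (intro conjI allI)
  have X: "newton_seq (prod_part f) (\<lambda>j. (-1) ^ (j - 1) * c j)" by (rule newton_seq_prod_part[OF assms])
  \<comment> \<open>\<open>\<omega> 1 = 1\<close> is available only as the case of degree 0 of the
    rule for elementary functions.\<close>
  have "prod_part f 0 = elementary_sym 0"
    using X newton_seq_prod_part[OF newton_pair_elementary]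
    by (simp add: newton_seq_def elementary_sym_eq)
  then show "\<omega> (prod_part f 0) = 1"
    using newton_seq_prod_part[OF newton_pair_complete]
    by (simp add: involution_elementary complete_sym_eq newton_seq_def)
  fix n
  have "mps_const (of_nat n) * \<omega> (prod_part f n) = \<omega> (mps_const (of_nat n) * prod_part f n)"
    by (simp add: involution_const_mult symmetric_prod_part)
  also have "mps_const (of_nat n) * prod_part f n =
      (\<Sum>j=1..n. mps_const ((-1) ^ (j - 1) * c j) * (psum j * prod_part f (n - j)))"
    using X by (simp add: newton_seq_def)
  also have "\<omega> \<dots> = (\<Sum>j=1..n. \<omega> (mps_const ((-1) ^ (j - 1) * c j) * (psum j * prod_part f (n - j))))"
    by (rule involution_sum) (auto intro!: symmetric_const_mult symmetric_mult symmetric_psum symmetric_prod_part)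
  also have "\<dots> = (\<Sum>j=1..n. mps_const (c j) * (psum j * \<omega> (prod_part f (n - j))))"
  proof (intro sum.cong refl)
    fix j assume j: "j \<in> {1..n}"
    let ?s = "(-1) ^ (j - 1) :: rat"
    have "\<omega> (mps_const (?s * c j) * (psum j * prod_part f (n - j))) =
        mps_const (?s * c j) * (mps_const ?s * psum j * \<omega> (prod_part f (n - j)))"
      using j by (simp add: involution_const_mult involution_mult symmetric_mult symmetric_psum
        symmetric_prod_part involution_psum)
    also have "\<dots> = mps_const (?s * c j * ?s) * (psum j * \<omega> (prod_part f (n - j)))"
      by (simp only: mps_const_mult mult_ac)
    also have "?s * c j * ?s = c j" by simp
    finally show "\<omega> (mps_const (?s * c j) * (psum j * prod_part f (n - j))) =
        mps_const (c j) * (psum j * \<omega> (prod_part f (n - j)))" .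
  qed
  finally show "mps_const (of_nat n) * \<omega> (prod_part f n) =
      (\<Sum>j=1..n. mps_const (c j) * (psum j * \<omega> (prod_part f (n - j))))" .
qed

end

section \<open>Expansion in power sums\<close>

lemma zee_add_mset:
  assumes "k > 0"
  shows "zee (add_mset k l) = k * (count l k + 1) * zee l"
proof -
  let ?t = "\<lambda>l j. j ^ count l j * fact (count l j) :: nat"
  let ?S = "insert k (set_mset l)"
  have "zee l = (\<Prod>j\<in>?S. ?t l j)"
    unfolding zee_def by (rule prod.mono_neutral_left) (auto simp: not_in_iff)
  also have "\<dots> = ?t l k * (\<Prod>j\<in>?S - {k}. ?t l j)" by (rule prod.remove) auto
  finally have 1: "zee l = \<dots>" .
  have "zee (add_mset k l) = ?t (add_mset k l) k * (\<Prod>j\<in>?S - {k}. ?t (add_mset k l) j)"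
    unfolding zee_def set_mset_add_mset_insert by (rule prod.remove) auto
  also have "(\<Prod>j\<in>?S - {k}. ?t (add_mset k l) j) = (\<Prod>j\<in>?S - {k}. ?t l j)"
    by (intro prod.cong) auto
  also have "?t (add_mset k l) k = k * (count l k + 1) * ?t l k" by (simp add: algebra_simps)
  finally show ?thesis using 1 by (simp add: mult.assoc)
qed

lemma sum_mset_eq_sum_count: "sum_mset l = (\<Sum>k\<in>set_mset l. k * count l k)" for l :: "nat multiset"
proof -
  \<comment> \<open>The range is widened to a fixed finite \<open>S\<close> so that it does not
    change during the induction.\<close>
  have "sum_mset l = (\<Sum>k\<in>S. k * count l k)" if "finite S" "set_mset l \<subseteq> S" for S
    using that(2)
  proof (induction l)
    case (add x l)
    have "(\<Sum>k\<in>S. k * count (add_mset x l) k) = (\<Sum>k\<in>S. k * count l k + (if k = x then x else 0))"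
      by (intro sum.cong) auto
    also have "\<dots> = sum_mset l + x" using add that(1) by (simp add: sum.distrib)
    finally show ?case by simp
  qed simp
  then show ?thesis by simp
qed

definition partitions_of :: "nat \<Rightarrow> nat multiset set" where
  "partitions_of n = {l \<in> partitions. sum_mset l = n}"

lemma finite_partitions_of: "finite (partitions_of n)"
proof (rule finite_subset)
  \<comment> \<open>No part of such a partition exceeds \<open>n\<close>, and none occurs more than
    \<open>n\<close> times.\<close>
  show "partitions_of n \<subseteq> {l. l \<subseteq># repeat_mset n (mset_set {1..n})}"
  proof
    fix l assume l: "l \<in> partitions_of n"
    have "count l k \<le> count (repeat_mset n (mset_set {1..n})) k" for k
    proof (cases "k \<in># l")
      case True
      then have "k > 0" using l by (auto simp: partitions_of_def partitions_def intro: gr0I)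
      have "replicate_mset (count l k) k \<subseteq># l" by (simp flip: count_le_replicate_mset_subset_eq)
      then obtain l' where "l = replicate_mset (count l k) k + l'"
        by (metis mset_subset_eq_exists_conv)
      then have "sum_mset l = count l k * k + sum_mset l'"
        by (metis sum_mset.union sum_mset_replicate_mset of_nat_id)
      then have "count l k * k \<le> n" using l by (simp add: partitions_of_def)
      moreover have "count l k > 0" using True by simp
      ultimately have "count l k \<le> count l k * k" "k \<le> count l k * k" "count l k * k \<le> n"
        using \<open>k > 0\<close> by auto
      then have "count l k \<le> n" "k \<le> n" by linarith+
      then show ?thesis using \<open>k > 0\<close> by simp
    qed (simp add: not_in_iff)
    then show "l \<in> {l. l \<subseteq># repeat_mset n (mset_set {1..n})}" by (simp add: subseteq_mset_def)
  qed
qed simp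

definition ps_term :: "(nat \<Rightarrow> rat) \<Rightarrow> nat multiset \<Rightarrow> rat mps" where
  "ps_term c l = mps_const (inverse (of_nat (zee l)) * (\<Prod>n\<in>#l. c n)) * power_sum_sym l"

text \<open>A further part \<open>k\<close> multiplies \<open>zee\<close> by \<open>k\<close> times
  the new multiplicity, and this is the factor on the left.\<close>

lemma ps_term_add_mset:
  assumes "k > 0"
  shows "mps_const (of_nat (k * (count l k + 1))) * ps_term c (add_mset k l) =
    mps_const (c k) * (psum k * ps_term c l)"
proof -
  have "of_nat (k * (count l k + 1)) * (inverse (of_nat (zee (add_mset k l))) * (\<Prod>n\<in>#add_mset k l. c n))
      = c k * (inverse (of_nat (zee l)) * (\<Prod>n\<in>#l. c n))"
  proof -
    have *: "a * (inverse (a * z) * (x * p)) = x * (inverse z * p)" if "a \<noteq> 0" for a z x p :: rat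
      using that by (cases "z = 0") (auto simp: field_simps)
    have "of_nat (k * (count l k + 1)) \<noteq> (0 :: rat)" using assms by (simp del: of_nat_mult)
    from *[OF this] show ?thesis
      unfolding zee_add_mset[OF assms] of_nat_mult[of "k * (count l k + 1)" "zee l"]
        image_mset_add_mset prod_mset.add_mset .
  qed
  then have "mps_const (of_nat (k * (count l k + 1))) *
      mps_const (inverse (of_nat (zee (add_mset k l))) * (\<Prod>n\<in>#add_mset k l. c n)) =
      mps_const (c k) * mps_const (inverse (of_nat (zee l)) * (\<Prod>n\<in>#l. c n))"
    unfolding mps_const_mult[symmetric] by (rule arg_cong)
  then have "mps_const (of_nat (k * (count l k + 1))) *
      mps_const (inverse (of_nat (zee (add_mset k l))) * (\<Prod>n\<in>#add_mset k l. c n)) *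
      power_sum_sym (add_mset k l) =
      mps_const (c k) * mps_const (inverse (of_nat (zee l)) * (\<Prod>n\<in>#l. c n)) * (psum k * power_sum_sym l)"
    by (simp only: power_sum_sym_eq image_mset_add_mset prod_mset.add_mset)
  then show ?thesis unfolding ps_term_def by (simp only: mult_ac)
qed

text \<open>\<open>n\<close> is the sum of \<open>k\<close> times the multiplicity of
  \<open>k\<close> over the distinct parts \<open>k\<close> of \<open>l\<close>, and by
  \<open>ps_term_add_mset\<close> the summand of \<open>k\<close> deletes one part \<open>k\<close>.
  Partitions of \<open>n\<close> with a marked distinct part \<open>k\<close> correspond to
  partitions of \<open>n - k\<close>.\<close>

lemma newton_seq_partitions: "newton_seq (\<lambda>n. \<Sum>l\<in>partitions_of n. ps_term c l) c"
  unfolding newton_seq_def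
proof (intro conjI allI)
  have "partitions_of 0 = {{#}}"
    by (auto simp: partitions_of_def partitions_def) (metis multiset_nonemptyE)
  then show "(\<Sum>l\<in>partitions_of 0. ps_term c l) = 1"
    by (simp add: ps_term_def zee_def power_sum_sym_eq)
  fix n
  have split_term: "mps_const (of_nat n) * ps_term c l = (\<Sum>k\<in>set_mset l. mps_const (c k) * (psum k * ps_term c (l - {#k#})))"
    if l: "l \<in> partitions_of n" for l
  proof -
    have "n = (\<Sum>k\<in>set_mset l. k * count l k)"
      using l by (simp add: partitions_of_def flip: sum_mset_eq_sum_count)
    then have "mps_const (of_nat n) * ps_term c l = (\<Sum>k\<in>set_mset l. mps_const (of_nat (k * count l k)) * ps_term c l)"
    proof (intro mps_eqI)
      fix A
      assume n: "n = (\<Sum>k\<in>set_mset l. k * count l k)"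
      have "mcoeff (mps_const (of_nat n) * ps_term c l) A = of_nat n * mcoeff (ps_term c l) A" by simp
      also have "\<dots> = (\<Sum>k\<in>set_mset l. of_nat (k * count l k) * mcoeff (ps_term c l) A)"
        by (subst n) (simp only: of_nat_sum sum_distrib_right)
      finally show "mcoeff (mps_const (of_nat n) * ps_term c l) A =
          mcoeff (\<Sum>k\<in>set_mset l. mps_const (of_nat (k * count l k)) * ps_term c l) A"
        by (simp only: mcoeff_sum mcoeff_const_mult)
    qed
    also have "\<dots> = (\<Sum>k\<in>set_mset l. mps_const (c k) * (psum k * ps_term c (l - {#k#})))"
    proof (intro sum.cong refl)
      fix k assume k: "k \<in># l"
      then have "k > 0" using l by (auto simp: partitions_of_def partitions_def intro: gr0I)
      from ps_term_add_mset[OF this, of "l - {#k#}" c] k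
      show "mps_const (of_nat (k * count l k)) * ps_term c l = mps_const (c k) * (psum k * ps_term c (l - {#k#}))"
        by simp
    qed
    finally show ?thesis .
  qed
  have "mps_const (of_nat n) * (\<Sum>l\<in>partitions_of n. ps_term c l) =
      (\<Sum>l\<in>partitions_of n. \<Sum>k\<in>set_mset l. mps_const (c k) * (psum k * ps_term c (l - {#k#})))"
    by (simp add: sum_distrib_left split_term)
  also have "\<dots> = (\<Sum>(l, k)\<in>Sigma (partitions_of n) set_mset. mps_const (c k) * (psum k * ps_term c (l - {#k#})))"
    by (subst sum.Sigma) (auto simp: finite_partitions_of)
  also have "\<dots> = (\<Sum>(k, l)\<in>Sigma {1..n} (\<lambda>k. partitions_of (n - k)). mps_const (c k) * (psum k * ps_term c l))"
  proof (rule sum.reindex_bij_witness[of _ "\<lambda>(k, l). (add_mset k l, k)" "\<lambda>(l, k). (k, l - {#k#})"])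
    fix p assume "p \<in> Sigma (partitions_of n) set_mset"
    then obtain l k where p: "p = (l, k)" "l \<in> partitions_of n" "k \<in># l" by auto
    then obtain l' where l': "l = add_mset k l'" by (metis multi_member_split)
    show "(case p of (l, k) \<Rightarrow> (k, l - {#k#})) \<in> Sigma {1..n} (\<lambda>k. partitions_of (n - k))"
      using p l' by (auto simp: partitions_of_def partitions_def Suc_le_eq)
  next
    fix p assume "p \<in> Sigma {1..n} (\<lambda>k. partitions_of (n - k))"
    then show "(case p of (k, l) \<Rightarrow> (add_mset k l, k)) \<in> Sigma (partitions_of n) set_mset"
      by (auto simp: partitions_of_def partitions_def)
  qed auto
  also have "\<dots> = (\<Sum>k=1..n. \<Sum>l\<in>partitions_of (n - k). mps_const (c k) * (psum k * ps_term c l))"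
    by (subst sum.Sigma) (auto simp: finite_partitions_of)
  also have "\<dots> = (\<Sum>k=1..n. mps_const (c k) * (psum k * (\<Sum>l\<in>partitions_of (n - k). ps_term c l)))"
    by (simp add: sum_distrib_left)
  finally show "mps_const (of_nat n) * (\<Sum>l\<in>partitions_of n. ps_term c l) = \<dots>" .
qed

text \<open>Makes the sum over all partitions finite in each coefficient: only partitions of
  \<open>size A\<close> contribute at \<open>A\<close>.\<close>

lemma power_sum_sym_homogeneous:
  assumes "0 \<notin># l" "mcoeff (power_sum_sym l) A \<noteq> 0"
  shows "size A = sum_mset l"
  using assms
proof (induction l arbitrary: A)
  case empty
  then show ?case by (auto simp: power_sum_sym_eq mcoeff_1 split: if_splits)
next
  case (add n l)
  then have "n > 0" by (auto intro: gr0I)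
  have "mcoeff (psum n * power_sum_sym l) A \<noteq> 0" using add.prems by (simp add: power_sum_sym_eq)
  then obtain k where "k \<in> {k. k \<in> set_mset A \<and> n \<le> count A k}"
    "mcoeff (power_sum_sym l) (A - replicate_mset n k) \<noteq> 0"
    unfolding mcoeff_psum_mult[OF \<open>n > 0\<close>] by (rule sum.not_neutral_contains_not_neutral)
  then have k: "n \<le> count A k" "mcoeff (power_sum_sym l) (A - replicate_mset n k) \<noteq> 0" by auto
  then have "size (A - replicate_mset n k) = sum_mset l" using add by simp
  moreover have "replicate_mset n k \<subseteq># A" using k(1) by (simp add: count_le_replicate_mset_subset_eq)
  then have "size A = n + size (A - replicate_mset n k)"
    by (metis size_replicate_mset size_union subset_mset.add_diff_inverse)
  ultimately show ?case by simp
qed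

lemma has_formal_sum_power_sums:
  assumes "newton_pair f c" "\<And>A. mcoeff F A = weight f A"
  shows "has_formal_sum (ps_term c) partitions F"
  unfolding has_formal_sum_def
proof (intro conjI allI mps_eqI)
  fix A
  have sub: "{l \<in> partitions. mcoeff (ps_term c l) A \<noteq> 0} \<subseteq> partitions_of (size A)"
    using power_sum_sym_homogeneous by (fastforce simp: ps_term_def partitions_of_def partitions_def)
  then show "finite {l \<in> partitions. mcoeff (ps_term c l) A \<noteq> 0}"
    using finite_partitions_of finite_subset by blast
  have "mcoeff (formal_sum (ps_term c) partitions) A = (\<Sum>l\<in>partitions_of (size A). mcoeff (ps_term c l) A)"
    unfolding formal_sum_def mcoeff_Abs_mps
    by (rule sum.mono_neutral_left[OF finite_partitions_of sub]) (auto simp: partitions_of_def)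
  also have "\<dots> = mcoeff (prod_part f (size A)) A"
    using newton_seq_unique[OF newton_seq_partitions newton_seq_prod_part[OF assms(1)]]
    by (simp flip: mcoeff_sum)
  finally show "mcoeff (formal_sum (ps_term c) partitions) A = mcoeff F A" using assms(2) by simp
qed

lemma has_formal_sum_parts:
  assumes "\<And>A. mcoeff F A = weight f A"
  shows "has_formal_sum (prod_part f) UNIV F"
  unfolding has_formal_sum_def
proof (intro conjI allI mps_eqI)
  fix A
  have sub: "{n \<in> UNIV. mcoeff (prod_part f n) A \<noteq> 0} \<subseteq> {size A}" by auto
  then show "finite {n \<in> UNIV. mcoeff (prod_part f n) A \<noteq> 0}" using finite_subset by blast
  have "mcoeff (formal_sum (prod_part f) UNIV) A = (\<Sum>n\<in>{size A}. mcoeff (prod_part f n) A)"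
    unfolding formal_sum_def mcoeff_Abs_mps by (rule sum.mono_neutral_left[OF _ sub]) auto
  then show "mcoeff (formal_sum (prod_part f) UNIV) A = mcoeff F A" using assms by simp
qed

section \<open>The quasisymmetric function of the poset\<close>

text \<open>The coefficients of \<open>1 - i x + (i - 1) x ^ b\<close>, and of the same polynomial at \<open>- x\<close>.\<close>

definition denom :: "nat \<Rightarrow> nat \<Rightarrow> nat \<Rightarrow> rat" where
  "denom i b n = (if n = 0 then 1 else if n = 1 then - of_nat i else if n = b then of_nat i - 1 else 0)"

definition numer :: "nat \<Rightarrow> nat \<Rightarrow> nat \<Rightarrow> rat" where
  "numer i b n = (if n = 0 then 1 else if n = 1 then of_nat i
     else if n = b then (-1) ^ b * (of_nat i - 1) else 0)"

lemma numer_eq: "numer i b n = (-1) ^ n * denom i b n"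
  by (simp add: numer_def denom_def)

lemma mult_denom_nth:
  assumes "b \<ge> 2"
  shows "fps_nth (F * Abs_fps (denom i b)) n = fps_nth F n - of_nat i * (if n = 0 then 0 else fps_nth F (n - 1))
     + (of_nat i - 1) * (if n < b then 0 else fps_nth F (n - b))"
proof -
  have "Abs_fps (denom i b) = 1 - fps_const (of_nat i) * fps_X + fps_const (of_nat i - 1) * fps_X ^ b"
    using assms by (auto simp: fps_eq_iff denom_def fps_X_power_nth)
  then have *: "F * Abs_fps (denom i b) =
      F - fps_const (of_nat i) * (F * fps_X) + fps_const (of_nat i - 1) * (F * fps_X ^ b)"
    by (simp only: distrib_left right_diff_distrib mult_1_right mult.left_commute)
  show ?thesis unfolding * by (simp add: fps_X_power_mult_right_nth)
qed

text \<open>With \<open>G\<close> the series of \<open>denom i b\<close>, the series of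
  \<open>qtilde i b\<close> without constant term is \<open>- x G' / G\<close>, the generating
  function of the power sums of the reciprocal roots. In degree \<open>b\<close> the right side is
  \<open>- b (i - 1)\<close>. As the constant term is cut off on the left, this value comes from the
  recurrence with \<open>qtilde i b 0 = b\<close>.\<close>

lemma qtilde_mult_denom:
  assumes "b \<ge> 2"
  shows "Abs_fps (\<lambda>n. if n = 0 then 0 else qtilde i b n) * Abs_fps (denom i b) =
    - (fps_X * fps_deriv (Abs_fps (denom i b)))"
proof (rule fps_ext)
  fix n
  have q0: "qtilde i b 0 = of_nat b" by (simp add: qtilde.simps)
  have low: "qtilde i b m = of_nat i ^ m" if "0 < m" "m < b" for m
    using that by (subst qtilde.simps) simp
  have high: "qtilde i b m = of_nat i * qtilde i b (m - 1) - (of_nat i - 1) * qtilde i b (m - b)"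
    if "b \<le> m" for m
    using that assms by (subst qtilde.simps) simp
  have pow: "of_nat i * of_nat i ^ (m - 1) = (of_nat i ^ m :: rat)" if "0 < m" for m
    using that by (cases m) auto
  consider "n = 0" | "n = 1" | "1 < n" "n < b" | "n = b" | "n > b" by linarith
  then show "fps_nth (Abs_fps (\<lambda>n. if n = 0 then 0 else qtilde i b n) * Abs_fps (denom i b)) n =
      fps_nth (- (fps_X * fps_deriv (Abs_fps (denom i b)))) n"
    unfolding mult_denom_nth[OF assms] fps_mult_fps_X_deriv_shift
  proof cases
    case 3
    then show "fps_nth (Abs_fps (\<lambda>n. if n = 0 then 0 else qtilde i b n)) n
      - of_nat i * (if n = 0 then 0 else fps_nth (Abs_fps (\<lambda>n. if n = 0 then 0 else qtilde i b n)) (n - 1))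
      + (of_nat i - 1) * (if n < b then 0 else fps_nth (Abs_fps (\<lambda>n. if n = 0 then 0 else qtilde i b n)) (n - b))
      = fps_nth (- Abs_fps (\<lambda>n. of_nat n * fps_nth (Abs_fps (denom i b)) n)) n"
      using low[of n] low[of "n - 1"] pow[of n] by (simp add: denom_def)
  qed (use assms high[of n] low[of 1] q0 in \<open>auto simp: denom_def algebra_simps\<close>)
qed

text \<open>The identity \<open>qtilde_mult_denom\<close> at \<open>- x\<close>: for
  \<open>F(x) = G(- x)\<close> the coefficients of \<open>x F' / F\<close> are those of
  \<open>- x G' / G\<close> with the sign \<open>(-1) ^ (j - 1)\<close>.\<close>

lemma newton_pair_numer:
  assumes "b \<ge> 2"
  shows "newton_pair (numer i b) (\<lambda>j. (-1) ^ (j - 1) * qtilde i b j)"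
  unfolding newton_pair_def
proof (intro conjI allI)
  show "numer i b 0 = 1" by (simp add: numer_def)
  fix m
  let ?C = "Abs_fps (\<lambda>n. if n = 0 then 0 else qtilde i b n)"
  have "(\<Sum>j=1..m. (-1) ^ (j - 1) * qtilde i b j * numer i b (m - j)) =
      (\<Sum>j=1..m. - ((-1) ^ m * (qtilde i b j * denom i b (m - j))))"
  proof (rule sum.cong)
    fix j assume j: "j \<in> {1..m}"
    then have "(-1) ^ m = (-1) * ((-1) ^ (j - 1) * (-1) ^ (m - j) :: rat)"
      by (simp flip: power_add power_Suc)
    then show "(-1) ^ (j - 1) * qtilde i b j * numer i b (m - j) =
        - ((-1) ^ m * (qtilde i b j * denom i b (m - j)))"
      by (simp add: numer_eq)
  qed simp
  also have "\<dots> = - ((-1) ^ m * (\<Sum>j=1..m. qtilde i b j * denom i b (m - j)))"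
    by (simp add: sum_negf sum_distrib_left)
  also have "(\<Sum>j=1..m. qtilde i b j * denom i b (m - j)) = fps_nth (?C * Abs_fps (denom i b)) m"
    unfolding fps_mult_nth by (rule sum.mono_neutral_cong_left) auto
  also have "\<dots> = - (of_nat m * denom i b m)"
    unfolding qtilde_mult_denom[OF assms] fps_mult_fps_X_deriv_shift by simp
  finally show "of_nat m * numer i b m = (\<Sum>j=1..m. (-1) ^ (j - 1) * qtilde i b j * numer i b (m - j))"
    by (simp add: numer_eq mult_ac)
qed

text \<open>The recurrence says that the series \<open>Q\<close> of \<open>q\<close> is inverse to
  \<open>G\<close>. Differentiating \<open>Q G = 1\<close> and inserting \<open>- x G' = C G\<close>
  gives \<open>x Q' = C Q\<close>.\<close>

lemma newton_pair_levels:
  assumes "b \<ge> 2" "q 0 = 1"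
    and rec: "\<And>n. of_nat i * q n = q (Suc n) + (if Suc n < b then 0 else (of_nat i - 1) * q (Suc n - b))"
  shows "newton_pair q (qtilde i b)"
  unfolding newton_pair_def
proof (intro conjI allI)
  show "q 0 = 1" by fact
  fix m
  let ?Q = "Abs_fps q" and ?G = "Abs_fps (denom i b)"
    and ?C = "Abs_fps (\<lambda>n. if n = 0 then 0 else qtilde i b n)"
  have QG: "?Q * ?G = 1"
  proof (rule fps_ext)
    fix n
    show "fps_nth (?Q * ?G) n = fps_nth 1 n"
      unfolding mult_denom_nth[OF assms(1)]
      using assms(1,2) rec[of "n - 1"] by (cases n) (auto split: if_splits)
  qed
  have "fps_X * fps_deriv (?Q * ?G) = 0" unfolding QG by simp
  then have "fps_X * fps_deriv ?Q * ?G = ?Q * (- (fps_X * fps_deriv ?G))"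
    by (simp add: algebra_simps add_eq_0_iff2)
  also have "\<dots> = ?C * (?Q * ?G)"
    unfolding qtilde_mult_denom[OF assms(1), symmetric] by (simp add: mult_ac)
  finally have "fps_X * fps_deriv ?Q * ?G = ?C" using QG by simp
  then have "fps_X * fps_deriv ?Q * (?Q * ?G) = ?C * ?Q" by (metis mult.assoc mult.commute)
  then have "fps_X * fps_deriv ?Q = ?C * ?Q" using QG by simp
  then have "fps_nth (fps_X * fps_deriv ?Q) m = fps_nth (?C * ?Q) m" by simp
  moreover have "fps_nth (?C * ?Q) m = (\<Sum>j=1..m. qtilde i b j * q (m - j))"
    unfolding fps_mult_nth by (rule sum.mono_neutral_cong_right) auto
  ultimately show "of_nat m * q m = (\<Sum>j=1..m. qtilde i b j * q (m - j))"
    unfolding fps_mult_fps_X_deriv_shift by simp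
qed

text \<open>A monomial contributes only if all its exponents are 1 or \<open>b\<close>. As these
  differ, the number \<open>j\<close> of exponents \<open>b\<close> can be read off, and each of
  them carries the factor \<open>(-1) ^ b * (i - 1)\<close>.\<close>

lemma prod_part_numer:
  assumes "b \<ge> 2"
  shows "prod_part (numer i b) n = (\<Sum>j | j * b \<le> n.
    mps_const ((-1) ^ (j * b) * (of_nat i - 1) ^ j * of_nat i ^ (n - j * b)) *
    monomial_sym (replicate_mset j b + replicate_mset (n - j * b) 1))"
proof (rule mps_eqI)
  fix A
  define E where "E = exponents A"
  let ?l = "\<lambda>j. replicate_mset j b + replicate_mset (n - j * b) (1::nat)"
  let ?a = "\<lambda>j. (-1) ^ (j * b) * (of_nat i - 1) ^ j * of_nat i ^ (n - j * b) :: rat"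
  have fin: "finite {j. j * b \<le> n}"
  proof (rule finite_subset)
    show "{j. j * b \<le> n} \<subseteq> {..n}"
    proof
      fix j assume "j \<in> {j. j * b \<le> n}"
      moreover have "j * 1 \<le> j * b" using assms by (intro mult_le_mono2) simp
      ultimately have "j * 1 \<le> n" by (metis le_trans mem_Collect_eq)
      then show "j \<in> {..n}" by simp
    qed
  qed simp
  have lhs: "mcoeff (prod_part (numer i b) n) A = (if sum_mset E = n then \<Prod>m\<in>#E. numer i b m else 0)"
    by (simp add: weight_exponents size_exponents E_def)
  have rhs: "mcoeff (\<Sum>j | j * b \<le> n. mps_const (?a j) * monomial_sym (?l j)) A =
      (\<Sum>j | j * b \<le> n. if E = ?l j then ?a j else 0)"
    unfolding mcoeff_sum by (intro sum.cong) (auto simp: mcoeff_monomial_sym E_def)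
  have inj: "j = j'" if "?l j = ?l j'" for j j'
  proof -
    have "count (?l j) b = count (?l j') b" using that by simp
    then show ?thesis using assms by simp
  qed
  show "mcoeff (prod_part (numer i b) n) A = mcoeff (\<Sum>j | j * b \<le> n. mps_const (?a j) * monomial_sym (?l j)) A"
  proof (cases "\<exists>j. j * b \<le> n \<and> E = ?l j")
    case True
    then obtain j where j: "j * b \<le> n" "E = ?l j" by blast
    have "sum_mset E = n" using j by simp
    moreover have "(\<Prod>m\<in>#E. numer i b m) = ?a j"
      using assms by (simp add: j(2) numer_def power_mult_distrib power_mult mult.commute[of j b])
    moreover have "(\<Sum>j' | j' * b \<le> n. if E = ?l j' then ?a j' else 0) = (\<Sum>j' | j' * b \<le> n. if j' = j then ?a j else 0)"
      using inj j by (intro sum.cong) auto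
    then have "(\<Sum>j' | j' * b \<le> n. if E = ?l j' then ?a j' else 0) = ?a j"
      using fin j(1) by simp
    ultimately show ?thesis unfolding lhs rhs by simp
  next
    case False
    then have "(\<Sum>j | j * b \<le> n. if E = ?l j then ?a j else 0) = 0" by (intro sum.neutral) auto
    moreover have "(\<Prod>m\<in>#E. numer i b m) = 0" if n: "sum_mset E = n"
    proof (rule ccontr)
      assume nz: "(\<Prod>m\<in>#E. numer i b m) \<noteq> 0"
      have "m = 1 \<or> m = b" if "m \<in># E" for m
      proof -
        have "numer i b m \<noteq> 0" using nz that by auto
        moreover have "m \<noteq> 0" using that by (auto simp: E_def exponents_def)
        ultimately show ?thesis by (auto simp: numer_def split: if_splits)
      qed
      then have "count E x = 0" if "x \<noteq> 1" "x \<noteq> b" for x using that by (meson not_in_iff)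
      then have E: "E = replicate_mset (count E b) b + replicate_mset (count E 1) 1"
        using assms by (intro multiset_eqI) auto
      have "sum_mset E = count E b * b + count E 1"
        by (subst E) simp
      then have "count E b * b \<le> n" "E = ?l (count E b)" using E n by auto
      with False show False by blast
    qed
    ultimately show ?thesis unfolding lhs rhs by simp
  qed
qed

section \<open>Counting multichains by their rank jumps\<close>

lemma mcoeff_prod_var_powers:
  "mcoeff (\<Prod>k<K. mps_var k ^ a k) A = (if \<forall>x. count A x = (if x < K then a x else 0) then 1 else (0::rat))"
proof -
  define M where "M = (\<Sum>k<K. replicate_mset (a k) k)"
  have "(\<Prod>k<K. mps_var k ^ a k) = (\<Prod>k\<in>#M. mps_var k :: rat mps)"
    unfolding M_def by (induction K) (auto simp: mult.commute)
  moreover have "count M x = (if x < K then a x else 0)" for x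
    unfolding M_def by (induction K) (auto simp: less_Suc_eq)
  ultimately show ?thesis by (simp add: mcoeff_monomial multiset_eq_iff)
qed

text \<open>Every jump may be 0, also the last one, unlike in \<open>multichains\<close>; so the
  count is a plain product. For a monomial the strict last step is recovered by the choice of
  \<open>K\<close>.\<close>

definition rank_chains :: "('a::order \<Rightarrow> nat) \<Rightarrow> 'a \<Rightarrow> (nat \<Rightarrow> nat) \<Rightarrow> nat \<Rightarrow> 'a list set" where
  "rank_chains \<rho> s a K = {ts. length ts = Suc K \<and> hd ts = s \<and> sorted_wrt (\<le>) ts \<and>
     (\<forall>x<K. \<rho> (ts ! Suc x) = \<rho> (ts ! x) + a x)}"

text \<open>Induction over all starting points at once: the first step contributes
  \<open>q (a 0)\<close>, and the rest starts at another element, where the count is the same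
  because \<open>q\<close> does not depend on it.\<close>

lemma card_rank_chains:
  fixes \<rho> :: "'a::order \<Rightarrow> nat"
  assumes "\<And>s n. finite {t. s \<le> t \<and> \<rho> t = \<rho> s + n}" "\<And>s n. card {t. s \<le> t \<and> \<rho> t = \<rho> s + n} = q n"
  shows "finite (rank_chains \<rho> s a K) \<and> card (rank_chains \<rho> s a K) = (\<Prod>x<K. q (a x))"
proof (induction K arbitrary: s a)
  case 0
  have "rank_chains \<rho> s a 0 = {[s]}"
    by (auto simp: rank_chains_def length_Suc_conv)
  then show ?case by simp
next
  case (Suc K)
  let ?U = "{t. s \<le> t \<and> \<rho> t = \<rho> s + a 0}"
  let ?S = "Sigma ?U (\<lambda>t. rank_chains \<rho> t (\<lambda>x. a (Suc x)) K)"
  have eq: "rank_chains \<rho> s a (Suc K) = (\<lambda>(t, ts). s # ts) ` ?S"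
  proof (intro equalityI subsetI)
    fix ts assume "ts \<in> rank_chains \<rho> s a (Suc K)"
    then have ts: "length ts = Suc (Suc K)" "hd ts = s" "sorted_wrt (\<le>) ts"
      "\<And>x. x < Suc K \<Longrightarrow> \<rho> (ts ! Suc x) = \<rho> (ts ! x) + a x" by (auto simp: rank_chains_def)
    then obtain t us where us: "ts = s # t # us" by (cases ts; cases "tl ts") auto
    have "t \<in> ?U" using ts(3) ts(4)[of 0] us by simp
    moreover have "t # us \<in> rank_chains \<rho> t (\<lambda>x. a (Suc x)) K"
      using ts(1,3) ts(4)[of "Suc _"] us by (auto simp: rank_chains_def)
    ultimately show "ts \<in> (\<lambda>(t, ts). s # ts) ` ?S" using us by (intro image_eqI[of _ _ "(t, t # us)"]) auto
  next
    fix ts assume "ts \<in> (\<lambda>(t, ts). s # ts) ` ?S"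
    then obtain t us where us: "ts = s # us" "t \<in> ?U" "us \<in> rank_chains \<rho> t (\<lambda>x. a (Suc x)) K" by auto
    then obtain vs where vs: "us = t # vs" by (cases us) (auto simp: rank_chains_def)
    show "ts \<in> rank_chains \<rho> s a (Suc K)"
      unfolding rank_chains_def
    proof (intro CollectI conjI allI impI)
      show "length ts = Suc (Suc K)" "hd ts = s" using us by (auto simp: rank_chains_def)
      show "sorted_wrt (\<le>) ts" using us vs by (auto simp: rank_chains_def intro: order.trans)
      fix x assume "x < Suc K"
      then show "\<rho> (ts ! Suc x) = \<rho> (ts ! x) + a x"
        using us vs by (cases x) (auto simp: rank_chains_def)
    qed
  qed
  have inj: "inj_on (\<lambda>(t, ts). s # ts) ?S"
    by (auto simp: inj_on_def rank_chains_def)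
  have "finite ?S" using assms(1) Suc.IH by (intro finite_SigmaI) auto
  moreover have "card ?S = q (a 0) * (\<Prod>x<K. q (a (Suc x)))"
    using assms Suc.IH by (subst card_SigmaI) auto
  ultimately show ?case
    unfolding eq card_image[OF inj] by (simp add: prod.lessThan_Suc_shift del: prod.lessThan_Suc)
qed

text \<open>The exponent of a variable is the rank jump at its position, and the last jump of a
  multichain is positive. So \<open>A\<close> fixes the number of steps: one more than its largest
  index, as indices start at 0.\<close>

lemma mcoeff_ehrenborg:
  fixes \<rho> :: "'a::order_bot \<Rightarrow> nat"
  assumes rk: "rank_function \<rho>" and fin: "\<And>a K. finite (rank_chains \<rho> bot a K)"
    and "A \<noteq> {#}" and K: "K = Suc (Max (set_mset A))"
  shows "mcoeff (ehrenborg \<rho> bot t) A = of_nat (card {ts \<in> rank_chains \<rho> bot (count A) K. last ts = t})"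
proof -
  have less: "\<rho> s < \<rho> t" if "s < t" for s t using rk that by (simp add: rank_function_def)
  have le: "\<rho> s \<le> \<rho> t" if "s \<le> t" for s t using less[of s t] that by (auto simp: order.order_iff_strict)
  have KA: "count A (K - 1) > 0" using \<open>A \<noteq> {#}\<close> Max_in[of "set_mset A"] by (simp add: K)
  have out: "count A x = 0" if "x \<ge> K" for x
  proof (rule ccontr)
    assume "count A x \<noteq> 0"
    then have "x \<in># A" by (meson count_inI)
    then have "x \<le> Max (set_mset A)" by simp
    with that K show False by simp
  qed
  let ?D = "{ts \<in> rank_chains \<rho> bot (count A) K. last ts = t}"
  have last_less: "ts ! (length ts - 2) < last ts \<and> length ts = Suc K"
    if ts: "ts \<in> rank_chains \<rho> bot (count A) K" for ts
  proof -
    have l: "length ts = Suc K" "sorted_wrt (\<le>) ts" "\<rho> (ts ! Suc (K - 1)) = \<rho> (ts ! (K - 1)) + count A (K - 1)"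
      using ts K by (auto simp: rank_chains_def)
    have "Suc (K - 1) = K" using K by simp
    moreover have "ts ! (K - 1) \<le> ts ! K" using l K by (intro sorted_wrt_nth_less[of "(\<le>)"]) auto
    moreover have "ts ! (K - 1) \<noteq> ts ! Suc (K - 1)"
      using l(3) KA by (intro notI) (simp del: count_greater_zero_iff)
    ultimately have "ts ! (K - 1) < ts ! K" by simp
    moreover have "last ts = ts ! K" using l by (metis diff_Suc_1 last_conv_nth length_0_conv nat.distinct(1))
    ultimately show ?thesis using l by simp
  qed
  show ?thesis
  proof (cases "t = bot")
    case True
    have "?D = {}"
    proof (rule ccontr)
      assume "?D \<noteq> {}"
      then obtain ts where "ts \<in> rank_chains \<rho> bot (count A) K" "last ts = bot" using True by blast
      with last_less[of ts] show False by simp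
    qed
    then show ?thesis using True \<open>A \<noteq> {#}\<close> by (simp add: ehrenborg_def mcoeff_1 del: Collect_empty_eq)
  next
    case False
    let ?m = "\<lambda>ts. \<Prod>k<length ts - 1. mps_var k ^ (\<rho> (ts ! Suc k) - \<rho> (ts ! k)) :: rat mps"
    have eq: "{ts \<in> multichains bot t. mcoeff (?m ts) A \<noteq> 0} = ?D"
    proof (intro equalityI subsetI)
      fix ts assume "ts \<in> {ts \<in> multichains bot t. mcoeff (?m ts) A \<noteq> 0}"
      then have ts: "length ts \<ge> 2" "hd ts = bot" "last ts = t" "sorted_wrt (\<le>) ts"
        "ts ! (length ts - 2) < last ts" and
        c: "\<And>x. count A x = (if x < length ts - 1 then \<rho> (ts ! Suc x) - \<rho> (ts ! x) else 0)"
        by (auto simp: multichains_def mcoeff_prod_var_powers split: if_splits)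
      define m where "m = length ts - 2"
      have m: "length ts = Suc (Suc m)" using ts(1) by (simp add: m_def)
      have "last ts = ts ! Suc m" using m by (metis diff_Suc_1 last_conv_nth length_0_conv nat.distinct(1))
      then have "\<rho> (ts ! m) < \<rho> (ts ! Suc m)" using ts(5) less m_def by simp
      then have "count A m > 0" using c[of m] m by simp
      then have "m \<in># A" by simp
      moreover have "x \<le> m" if "x \<in># A" for x
        using c[of x] that m by (auto split: if_splits simp flip: count_greater_zero_iff)
      ultimately have "Max (set_mset A) = m" by (intro Max_eqI) auto
      then have "K = Suc m" using K by simp
      moreover have "\<rho> (ts ! Suc x) = \<rho> (ts ! x) + count A x" if "x < Suc m" for x
      proof -
        have "ts ! x \<le> ts ! Suc x" using ts(4) m that by (intro sorted_wrt_nth_less[of "(\<le>)"]) auto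
        then show ?thesis using le c[of x] that m by simp
      qed
      ultimately show "ts \<in> ?D" using ts m by (auto simp: rank_chains_def)
    next
      fix ts assume "ts \<in> ?D"
      then have ts: "ts \<in> rank_chains \<rho> bot (count A) K" "last ts = t" by auto
      have "ts \<in> multichains bot t"
        using ts last_less[OF ts(1)] K by (auto simp: multichains_def rank_chains_def)
      moreover have "mcoeff (?m ts) A = 1"
        using ts(1) out by (auto simp: mcoeff_prod_var_powers rank_chains_def)
      ultimately show "ts \<in> {ts \<in> multichains bot t. mcoeff (?m ts) A \<noteq> 0}" by simp
    qed
    have one: "mcoeff (?m ts) A = 1" if "ts \<in> ?D" for ts
      using that unfolding eq[symmetric] by (auto simp: mcoeff_prod_var_powers split: if_splits)
    have "mcoeff (ehrenborg \<rho> bot t) A = (\<Sum>ts\<in>?D. mcoeff (?m ts) A)"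
      using False unfolding ehrenborg_def formal_sum_def mcoeff_Abs_mps eq[symmetric] by simp
    also have "\<dots> = (\<Sum>ts\<in>?D. 1)" by (rule sum.cong) (use one in auto)
    finally show ?thesis by simp
  qed
qed

lemma mcoeff_ehrenborg_poset:
  fixes \<rho> :: "'a::order_bot \<Rightarrow> nat"
  assumes rk: "rank_function \<rho>"
    and U: "\<And>s n. finite {t. s \<le> t \<and> \<rho> t = \<rho> s + n}" "\<And>s n. card {t. s \<le> t \<and> \<rho> t = \<rho> s + n} = q n"
    and q0: "q 0 = 1"
  shows "mcoeff (ehrenborg_poset \<rho>) A = weight (\<lambda>n. of_nat (q n)) A"
proof (cases "A = {#}")
  case True
  have less: "\<rho> s < \<rho> t" if "s < t" for s t using rk that by (simp add: rank_function_def)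
  have "mcoeff (ehrenborg \<rho> bot t) {#} = (if t = bot then 1 else 0)" for t
  proof (cases "t = bot")
    case False
    let ?m = "\<lambda>ts. \<Prod>k<length ts - 1. mps_var k ^ (\<rho> (ts ! Suc k) - \<rho> (ts ! k)) :: rat mps"
    \<comment> \<open>The last jump of a multichain is positive, so its monomial is never
      constant.\<close>
    have "{ts \<in> multichains bot t. mcoeff (?m ts) {#} \<noteq> 0} = {}"
    proof (rule ccontr)
      assume "\<not> ?thesis"
      then obtain ts where ts: "length ts \<ge> 2" "ts ! (length ts - 2) < last ts"
        and c: "\<And>x. 0 = (if x < length ts - 1 then \<rho> (ts ! Suc x) - \<rho> (ts ! x) else 0)"
        by (auto simp: multichains_def mcoeff_prod_var_powers split: if_splits)
      define m where "m = length ts - 2"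
      have m: "length ts = Suc (Suc m)" using ts(1) by (simp add: m_def)
      have "last ts = ts ! Suc m" using m by (metis diff_Suc_1 last_conv_nth length_0_conv nat.distinct(1))
      then have "\<rho> (ts ! m) < \<rho> (ts ! Suc m)" using ts(2) less m_def by simp
      then show False using c[of m] m by simp
    qed
    then show ?thesis using False
      unfolding ehrenborg_def formal_sum_def mcoeff_Abs_mps by (simp del: Collect_empty_eq)
  qed (simp add: ehrenborg_def mcoeff_1)
  then show ?thesis using True
    by (simp add: ehrenborg_poset_def formal_sum_def weight_def)
next
  case False
  define K where "K = Suc (Max (set_mset A))"
  let ?R = "rank_chains \<rho> bot (count A) K"
  have R: "finite (rank_chains \<rho> bot a K)" "card (rank_chains \<rho> bot a K) = (\<Prod>x<K. q (a x))" for a K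
    using card_rank_chains[OF U] by auto
  have e: "mcoeff (ehrenborg \<rho> bot t) A = of_nat (card {ts \<in> ?R. last ts = t})" for t
    using mcoeff_ehrenborg[OF rk R(1) False K_def] .
  have "mcoeff (ehrenborg_poset \<rho>) A =
      (\<Sum>t | t \<in> UNIV \<and> mcoeff (ehrenborg \<rho> bot t) A \<noteq> 0. mcoeff (ehrenborg \<rho> bot t) A)"
    by (simp add: ehrenborg_poset_def formal_sum_def)
  also have "\<dots> = (\<Sum>t\<in>last ` ?R. mcoeff (ehrenborg \<rho> bot t) A)"
    by (rule sum.mono_neutral_left) (use R e in auto)
  also have "\<dots> = of_nat (\<Sum>t\<in>last ` ?R. \<Sum>ts\<in>{ts \<in> ?R. last ts = t}. 1)" by (simp add: e)
  also have "(\<Sum>t\<in>last ` ?R. \<Sum>ts\<in>{ts \<in> ?R. last ts = t}. 1) = (\<Sum>ts\<in>?R. 1)"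
    by (rule sum.image_gen[symmetric]) (rule R)
  also have "(of_nat (\<Sum>ts\<in>?R. 1) :: rat) = (\<Prod>x<K. of_nat (q (count A x)))" by (simp add: R)
  also have "\<dots> = weight (\<lambda>n. of_nat (q n)) A"
    by (rule weight_superset[symmetric]) (auto simp: q0 K_def less_Suc_eq_le)
  finally show ?thesis .
qed

theorem theorem4:
  fixes i b :: nat
    and \<rho> :: "'a::order_bot \<Rightarrow> nat"
    and \<omega> :: "rat mps \<Rightarrow> rat mps"
  assumes "i \<ge> 2" and "b \<ge> 2"
    and "is_P i b \<rho>"
    and "standard_involution \<omega>"
  shows "has_formal_sum
           (\<lambda>l. mps_const (inverse (of_nat (zee l)) * (\<Prod>n\<in>#l. qtilde i b n)) * power_sum_sym l)
           partitions (ehrenborg_poset \<rho>) \<and>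
         has_formal_sum
           (\<lambda>n. \<Sum>j | j * b \<le> n.
              mps_const ((-1) ^ (j * b) * (of_nat i - 1) ^ j * of_nat i ^ (n - j * b)) *
              forgotten_sym \<omega> (replicate_mset j b + replicate_mset (n - j * b) 1))
           UNIV (ehrenborg_poset \<rho>)"
proof -
  define U where "U s n = {t. s \<le> t \<and> \<rho> t = \<rho> s + n}" for s n
  note level = is_P_level_recurrence[OF assms(3,2), folded U_def]
  \<comment> \<open>The recurrence and the one-element bottom level determine all level sizes, so
    they are the same for every filter, as \<open>card_rank_chains\<close> requires.\<close>
  have indep: "card (U s n) = card (U bot n)" for s n
  proof (induction n rule: less_induct)
    case (less n)
    show ?case
    proof (cases n)
      case 0
      then show ?thesis using level(2) by simp
    next
      case (Suc m)
      have "card (U s (Suc m - b)) = card (U bot (Suc m - b))" "card (U s m) = card (U bot m)"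
        using less.IH[of "Suc m - b"] less.IH[of m] Suc \<open>b \<ge> 2\<close> by auto
      then show ?thesis using level(3)[of s m] level(3)[of bot m] Suc by (simp split: if_splits)
    qed
  qed
  define q where "q n = card (U bot n)" for n
  have q0: "q 0 = 1" using level(2)[of bot] by (simp add: q_def)
  have rk: "rank_function \<rho>" using assms(3) by (simp add: is_P_def)
  have E: "mcoeff (ehrenborg_poset \<rho>) A = weight (\<lambda>n. of_nat (q n)) A" for A
    by (rule mcoeff_ehrenborg_poset[OF rk]) (use level(1) indep q0 in \<open>auto simp: q_def U_def\<close>)
  have pair: "newton_pair (\<lambda>n. of_nat (q n)) (qtilde i b)"
  proof (rule newton_pair_levels[OF assms(2)])
    fix n
    have "of_nat (i * q n) = (of_nat (q (Suc n) + (if Suc n < b then 0 else (i - 1) * q (Suc n - b))) :: rat)"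
      using level(3)[of bot n] by (simp add: q_def)
    then show "of_nat i * of_nat (q n) = of_nat (q (Suc n)) +
        (if Suc n < b then 0 else (of_nat i - 1) * (of_nat (q (Suc n - b)) :: rat))"
      using \<open>i \<ge> 2\<close> by (simp add: of_nat_diff split: if_splits)
  qed (simp add: q0)
  have "(\<Sum>j | j * b \<le> n. mps_const ((-1) ^ (j * b) * (of_nat i - 1) ^ j * of_nat i ^ (n - j * b)) *
      forgotten_sym \<omega> (replicate_mset j b + replicate_mset (n - j * b) 1)) =
      prod_part (\<lambda>n. of_nat (q n)) n" for n
  proof -
    \<comment> \<open>Both sides satisfy the recurrence with \<open>qtilde i b\<close>, since
      \<open>\<omega>\<close> absorbs the signs that come from \<open>- x\<close>.\<close>
    have "prod_part (\<lambda>n. of_nat (q n)) n = \<omega> (prod_part (numer i b) n)"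
      using newton_seq_unique[OF newton_seq_prod_part[OF pair]
        newton_seq_involution[OF assms(4) newton_pair_numer[OF assms(2)]]] by simp
    also have "\<dots> = (\<Sum>j | j * b \<le> n. \<omega> (mps_const ((-1) ^ (j * b) * (of_nat i - 1) ^ j * of_nat i ^ (n - j * b)) *
        monomial_sym (replicate_mset j b + replicate_mset (n - j * b) 1)))"
      unfolding prod_part_numer[OF assms(2)]
      by (rule involution_sum[OF assms(4)]) (intro symmetric_const_mult symmetric_monomial_sym)
    finally show ?thesis
      by (simp add: involution_const_mult[OF assms(4) symmetric_monomial_sym] forgotten_sym_def)
  qed
  then have "has_formal_sum
      (\<lambda>n. \<Sum>j | j * b \<le> n.
         mps_const ((-1) ^ (j * b) * (of_nat i - 1) ^ j * of_nat i ^ (n - j * b)) *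
         forgotten_sym \<omega> (replicate_mset j b + replicate_mset (n - j * b) 1))
      UNIV (ehrenborg_poset \<rho>)"
    using has_formal_sum_parts[OF E] by simp
  then show ?thesis using has_formal_sum_power_sums[OF pair E] unfolding ps_term_def by blast
qed

end
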